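(* For every $n\ge4$ there are origin-symmetric convex bodies $K$ and $L$ in $\mathbb{R}^n$ such that $$\Gamma^*_0K\subset\Gamma^*_0L,$$ but $$\mathrm{vol}(K)<\mathrm{vol}(L).$$
   Context: A convex body is a compact convex set with non-empty interior in $\mathbb{R}^n$; $\mathrm{vol}$ denotes $n$-dimensional Lebesgue measure, and $(x,\xi)$ is the standard inner product. Polar $0$-centroid body: $\Gamma^*_0K=\{\xi:\|\xi\|_{\Gamma^*_0K}\le1\}$ is the body with Minkowski functional $$\|\xi\|_{\Gamma^*_0K}=\exp\left(\frac{1}{\mathrm{vol}(K)}\int_K\ln|(x,\xi)|\,dx\right),\quad \xi\in\mathbb{R}^n\setminus\{0\}.$$ Thus $\Gamma^*_0K\subset\Gamma^*_0L$ means that $\frac{1}{\mathrm{vol}(L)}\int_L\ln|(x,\xi)|\,dx\le\frac{1}{\mathrm{vol}(K)}\int_K\ln|(x,\xi)|\,dx$ for every $\xi\in S^{n-1}$. *)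

theory Defs
  imports "HOL-Analysis.Analysis"
begin

definition convex_body :: "(real ^ 'n) set \<Rightarrow> bool" where
  "convex_body K \<longleftrightarrow> compact K \<and> convex K \<and> interior K \<noteq> {}"

definition origin_symmetric :: "(real ^ 'n) set \<Rightarrow> bool" where
  "origin_symmetric K \<longleftrightarrow> (\<forall>x\<in>K. - x \<in> K)"

definition vol :: "(real ^ 'n) set \<Rightarrow> real" where
  "vol K = measure lebesgue K"

text \<open>
  Minkowski functional of the polar 0-centroid body. The exponential formula applies to nonzero
  \<open>\<xi>\<close>; at the origin a Minkowski functional is \<open>0\<close>. For nonzero \<open>\<xi>\<close>, the convention
  \<open>ln 0 = 0\<close> only affects the integrand on the hyperplane orthogonal to \<open>\<xi>\<close>, a null set.
\<close>
definition polar_centroid0_norm :: "(real ^ 'n) set \<Rightarrow> real ^ 'n \<Rightarrow> real" where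
  "polar_centroid0_norm K \<xi> =
     (if \<xi> = 0 then 0
      else exp (1 / vol K * (LINT x:K|lebesgue. ln \<bar>x \<bullet> \<xi>\<bar>)))"

definition polar_centroid0_body :: "(real ^ 'n) set \<Rightarrow> (real ^ 'n) set" where
  "polar_centroid0_body K = {\<xi>. polar_centroid0_norm K \<xi> \<le> 1}"

end

theory Submission
  imports Defs "HOL-Real_Asymp.Real_Asymp"
begin

text \<open>
  Write \<open>f\<^sub>G(\<xi>)\<close> for the average of \<open>ln |x \<bullet> \<xi>|\<close> over \<open>G\<close>. Let \<open>K\<close> be the cylinder
  \<open>|t| \<le> 1, |y| \<le> 1\<close> in \<open>\<real> \<times> \<real>\<^sup>m\<close> with \<open>m = n - 1 \<ge> 3\<close>, and let \<open>E\<close> be a thin neighbourhood of its rim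
  \<open>|t| = |y| = 1\<close>, cut off so that \<open>L\<^sub>0 = K - E\<close> is convex. If \<open>f\<^sub>E \<ge> f\<^sub>K + 1/n\<close> everywhere, then
  with \<open>V\<close> denoting volume, \<open>f\<^sub>L\<^sub>0 \<le> f\<^sub>K - V(E) / (n V(L\<^sub>0))\<close>, so \<open>L\<^sub>0\<close> may be dilated by \<open>s\<close> with
  \<open>ln s = V(E) / (n V(L\<^sub>0))\<close>; since \<open>1 + x < exp x\<close>, the dilate \<open>L\<close> has larger volume than \<open>K\<close>.

  The bound on \<open>f\<^sub>E\<close> is where \<open>m \<ge> 3\<close> enters. The marginals of the sphere in \<open>\<real>\<^sup>m\<close> are then
  unimodal, that is, mixtures of uniform laws on intervals \<open>[-l, l]\<close>. This reduces the
  bound to \<open>\<integral>\<integral> u(at, br) dt d(r\<^sup>m) \<le> u(a, b) - 1/m\<close> over the unit square, where \<open>u(\<tau>, \<beta>)\<close> is the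
  average of \<open>ln |\<tau> + \<beta> v|\<close> over \<open>v \<in> [-1, 1]\<close>; the gap \<open>1/m > 1/n\<close> leaves room for a rim of
  positive width.
\<close>

section \<open>Integration in cylindrical coordinates\<close>

text \<open>Let \<open>\<xi>\<close> have axial part a and distance b from the axis. On the cylinder
  x \<bullet> \<open>\<xi>\<close> is distributed as at + brv, where v is a coordinate of a uniform
  point on the unit sphere of dimension m - 1. Its density is proportional to (1 - v^2)^((m-3)/2):
  it would grow towards the endpoints for m = 2, is constant for m = 3, and decreases in |v| beyond.
  Replacing the law of v by a uniform one on [-l, l] only turns b into bl, so uniform v and
  arbitrary a, b suffice. The constant 1/m is forced at a = 0: there u(0, br) = ln (br) - 1, and ln
  r has mean -1/m under d(r^m). Near this case little may be lost. The expansion u(a, b) = ln b - 1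
  + (a/b)^2/2 + ... meets a bound on the ball average with quadratic term 3/2 (at/b)^2, whose mean
  over t is again (a/b)^2/2, so the second-order terms cancel. What remains is the slack 1/m - 1/n,
  and it fixes the thickness of the rim. For b \<le> a the expansion is of no use, but cruder bounds
  leave a gap of 1/3, which is at least 1/m.\<close>

text \<open>Polar coordinates as an identity of measures on the line: half-lines generate the Borel
  sets, and there the law of the Euclidean norm is the volume of a ball, whose derivative in the
  radius is the density. The integral runs over a product indexed by \<open>A\<close> because the
  coordinates left after splitting off two basis vectors have no type of their own.\<close>

lemma nn_integral_PiM_radial:
  fixes g :: "real \<Rightarrow> ennreal"
  assumes A: "finite A" "A \<noteq> {}" and [measurable]: "g \<in> borel_measurable borel"
  shows "(\<integral>\<^sup>+f. g (sqrt (\<Sum>i\<in>A. (f i)\<^sup>2)) \<partial>Pi\<^sub>M A (\<lambda>_. lborel)) =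
    (\<integral>\<^sup>+\<rho>. ennreal (unit_ball_vol (card A) * card A * \<rho> ^ (card A - 1)) * indicator {0..} \<rho> * g \<rho> \<partial>lborel)"
proof -
  define k where "k = card A"
  define c where "c = unit_ball_vol k"
  have k: "k > 0" using A by (simp add: k_def card_gt_0_iff)
  have c: "c > 0" by (simp add: c_def)
  let ?R = "\<lambda>f. sqrt (\<Sum>i\<in>A. (f i)\<^sup>2)"
  let ?M = "distr (Pi\<^sub>M A (\<lambda>_. lborel)) borel ?R"
  let ?d = "\<lambda>\<rho>. ennreal (c * k * \<rho> ^ (k - 1)) * indicator {0..} \<rho>"
  have Mpos: "emeasure ?M {..a} = ennreal (c * a ^ k)" if "a > 0" for a
    using emeasure_cball_aux[OF A(1) that]
    by (subst emeasure_distr) (auto simp: k_def c_def vimage_def)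
  \<comment> \<open>\<open>emeasure_cball_aux\<close> needs a positive radius, so the mass at the
    origin is squeezed by small balls.\<close>
  have M0: "emeasure ?M {..0} = 0"
  proof -
    have "emeasure ?M {..0} \<le> 0"
    proof (rule ennreal_le_epsilon)
      fix e :: real assume e: "0 < e"
      define r where "r = min 1 (e / c)"
      have r: "0 < r" "r \<le> 1" "c * r \<le> e" using e c by (auto simp: r_def min_def field_simps)
      have "emeasure ?M {..0} \<le> emeasure ?M {..r}"
        using r by (intro emeasure_mono) auto
      also have "\<dots> = ennreal (c * r ^ k)" using Mpos r by blast
      also have "c * r ^ k \<le> c * r ^ 1"
        using r k c by (intro mult_left_mono power_decreasing) auto
      also have "\<dots> \<le> e" using r by simp
      finally show "emeasure ?M {..0} \<le> 0 + ennreal e"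
        by (simp add: ennreal_leI)
    qed
    then show ?thesis by simp
  qed
  have Mneg: "emeasure ?M {..a} = 0" if "a \<le> 0" for a
  proof -
    have "emeasure ?M {..a} \<le> emeasure ?M {..0}" using that by (intro emeasure_mono) auto
    then show ?thesis using M0 by simp
  qed
  have N: "emeasure (density lborel ?d) {..a} = (if a > 0 then ennreal (c * a ^ k) else 0)" for a
  proof (cases "a > 0")
    case True
    have "emeasure (density lborel ?d) {..a} = (\<integral>\<^sup>+\<rho>. ennreal (c * k * \<rho> ^ (k - 1)) * indicator {0..a} \<rho> \<partial>lborel)"
      by (subst emeasure_density) (auto intro!: nn_integral_cong split: split_indicator)
    also have "\<dots> = ennreal (c * a ^ k - c * 0 ^ k)"
      using True c k by (intro nn_integral_FTC_Icc) (auto intro!: derivative_eq_intros)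
    finally show ?thesis using True k by (simp add: zero_power)
  next
    case False
    have "AE \<rho> in lborel. ?d \<rho> * indicator {..a} \<rho> = 0"
      using AE_lborel_singleton[of "0::real"]
      by eventually_elim (use False in \<open>auto split: split_indicator\<close>)
    then have "emeasure (density lborel ?d) {..a} = 0"
      by (simp add: emeasure_density nn_integral_0_iff_AE)
    then show ?thesis using False by simp
  qed
  have "?M = density lborel ?d"
  proof (rule measure_eqI_generator_eq[where E="range atMost" and \<Omega>=UNIV and A="\<lambda>i. {..real i}"])
    show "Int_stable (range (atMost :: real \<Rightarrow> _))"
      by (auto simp: Int_stable_def)
    show "emeasure ?M X = emeasure (density lborel ?d) X" if X: "X \<in> range atMost" for X
    proof -
      obtain a where "X = {..a}" using X by auto
      then show ?thesis using Mpos[of a] Mneg[of a] N[of a] by (cases "a > 0") auto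
    qed
    show "sets ?M = sigma_sets UNIV (range atMost)" "sets (density lborel ?d) = sigma_sets UNIV (range atMost)"
      by (simp_all add: borel_eq_atMost[where 'a=real])
    show "(\<Union>i. {..real i}) = UNIV" by (auto simp: real_arch_simple)
    show "emeasure ?M {..real i} \<noteq> \<infinity>" for i
      using Mpos[of "real i"] Mneg[of "real i"] by (cases "i = 0") auto
  qed auto
  then have "integral\<^sup>N ?M g = integral\<^sup>N (density lborel ?d) g" by simp
  then show ?thesis
    by (subst (asm) nn_integral_distr, simp, simp, subst (asm) nn_integral_density)
       (auto simp: k_def c_def)
qed

section \<open>Invariance under translations and orthogonal maps\<close>

lemma nn_integral_lborel_translate:
  fixes f :: "'a::euclidean_space \<Rightarrow> ennreal"
  assumes [measurable]: "f \<in> borel_measurable borel"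
  shows "(\<integral>\<^sup>+x. f (x + c) \<partial>lborel) = (\<integral>\<^sup>+x. f x \<partial>lborel)"
proof -
  have "(\<integral>\<^sup>+x. f x \<partial>lborel) = (\<integral>\<^sup>+x. f x \<partial>distr lborel borel (\<lambda>x. c + x))"
    using lborel_affine[of 1 c] by (simp add: density_1)
  also have "\<dots> = (\<integral>\<^sup>+x. f (c + x) \<partial>lborel)" by (subst nn_integral_distr) auto
  finally show ?thesis by (simp add: add.commute)
qed

text \<open>
  The uniqueness argument for invariant measures: both sides are compared through a convolution
  with the unit ball, which \<open>T\<close> preserves.
\<close>

lemma nn_integral_lborel_orthogonal:
  fixes f :: "'a::euclidean_space \<Rightarrow> ennreal" and T :: "'a \<Rightarrow> 'a"
  assumes T: "orthogonal_transformation T" and [measurable]: "f \<in> borel_measurable borel"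
  shows "(\<integral>\<^sup>+x. f (T x) \<partial>lborel) = (\<integral>\<^sup>+x. f x \<partial>lborel)"
proof -
  have lin: "linear T" using T by (rule orthogonal_transformation_linear)
  have [measurable]: "T \<in> borel_measurable borel"
    using lin by (intro borel_measurable_continuous_onI linear_continuous_on linear_conv_bounded_linear[THEN iffD1])
  obtain S where S: "\<And>x. T (S x) = x"
    using orthogonal_transformation_surj[OF T] by (metis surjD)
  let ?B = "ball (0::'a) 1"
  have [measurable]: "ball x r \<in> sets borel" for x :: 'a and r by simp
  have "emeasure lborel ?B * (\<integral>\<^sup>+y. f (T y) \<partial>lborel) =
      (\<integral>\<^sup>+x. \<integral>\<^sup>+y. indicator ?B x * f (T y) \<partial>lborel \<partial>lborel)"
    by (simp add: nn_integral_cmult, subst nn_integral_multc) simp_all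
  also have "\<dots> = (\<integral>\<^sup>+x. \<integral>\<^sup>+y. indicator ?B x * f (T y + x) \<partial>lborel \<partial>lborel)"
  proof (rule nn_integral_cong)
    fix x
    have "(\<integral>\<^sup>+y. f (T y) \<partial>lborel) = (\<integral>\<^sup>+y. f (T (y + S x)) \<partial>lborel)"
      by (rule nn_integral_lborel_translate[symmetric]) measurable
    then show "(\<integral>\<^sup>+y. indicator ?B x * f (T y) \<partial>lborel) = (\<integral>\<^sup>+y. indicator ?B x * f (T y + x) \<partial>lborel)"
      by (simp add: nn_integral_cmult linear_add[OF lin] S)
  qed
  also have "\<dots> = (\<integral>\<^sup>+y. \<integral>\<^sup>+x. indicator ?B x * f (T y + x) \<partial>lborel \<partial>lborel)"
    by (rule lborel_pair.Fubini') measurable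
  also have "\<dots> = (\<integral>\<^sup>+y. \<integral>\<^sup>+x. indicator ?B (x - T y) * f x \<partial>lborel \<partial>lborel)"
  proof (rule nn_integral_cong)
    fix y
    show "(\<integral>\<^sup>+x. indicator ?B x * f (T y + x) \<partial>lborel) = (\<integral>\<^sup>+x. indicator ?B (x - T y) * f x \<partial>lborel)"
      using nn_integral_lborel_translate[of "\<lambda>x. indicator ?B (x - T y) * f x" "T y"]
      by (simp add: add.commute)
  qed
  also have "\<dots> = (\<integral>\<^sup>+x. \<integral>\<^sup>+y. indicator ?B (x - T y) * f x \<partial>lborel \<partial>lborel)"
    by (rule lborel_pair.Fubini') measurable
  also have "\<dots> = (\<integral>\<^sup>+x. emeasure lborel ?B * f x \<partial>lborel)"
  proof (rule nn_integral_cong)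
    fix x
    \<comment> \<open>The isometry turns the condition on \<open>T y\<close> into membership of
      \<open>y\<close> in the unit ball about \<open>S x\<close>, whose volume does not depend on
      \<open>x\<close>.\<close>
    have "x - T y = T (S x - y)" for y by (simp add: linear_diff[OF lin] S)
    then have "indicator ?B (x - T y) = (indicator (ball (S x) 1) y :: ennreal)" for y
      using orthogonal_transformation_norm[OF T]
      by (auto simp: indicator_def dist_norm norm_minus_commute)
    then have "(\<integral>\<^sup>+y. indicator ?B (x - T y) * f x \<partial>lborel) = emeasure lborel (ball (S x) 1) * f x"
      by (simp, subst nn_integral_multc) simp_all
    then show "(\<integral>\<^sup>+y. indicator ?B (x - T y) * f x \<partial>lborel) = emeasure lborel ?B * f x"
      by (simp add: emeasure_ball)
  qed
  also have "\<dots> = emeasure lborel ?B * (\<integral>\<^sup>+x. f x \<partial>lborel)"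
    by (simp add: nn_integral_cmult)
  finally have *: "emeasure lborel ?B * (\<integral>\<^sup>+y. f (T y) \<partial>lborel) = emeasure lborel ?B * (\<integral>\<^sup>+x. f x \<partial>lborel)" .
  have "unit_ball_vol (real DIM('a)) \<noteq> 0"
    by (rule less_imp_neq[THEN not_sym], rule unit_ball_vol_pos) simp
  then have "emeasure lborel ?B \<noteq> 0" "emeasure lborel ?B \<noteq> top"
    by (simp_all add: emeasure_ball)
  with * show ?thesis
    by (simp only: ennreal_mult_cancel_left) auto
qed

section \<open>Coordinates adapted to an axis\<close>

text \<open>For a unit vector \<open>e\<close> this is the distance from the axis; the coordinate
  along the axis is \<open>x \<bullet> e\<close>.\<close>

definition axial :: "'a::euclidean_space \<Rightarrow> 'a \<Rightarrow> real" where
  "axial e x = norm (x - (x \<bullet> e) *\<^sub>R e)"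

lemma axial_measurable [measurable]: "axial e \<in> borel_measurable borel"
  unfolding axial_def by measurable

text \<open>A second basis vector is kept apart because, after a rotation,
  \<open>x \<bullet> \<xi>\<close> depends on the coordinates \<open>t\<close> and \<open>s\<close>
  only; the other \<open>k\<close> coordinates enter through their norm.\<close>

lemma nn_integral_axial_cartesian:
  fixes P :: "real \<times> real \<times> real \<Rightarrow> ennreal" and e0 e1 :: "'a::euclidean_space"
  assumes e: "e0 \<in> Basis" "e1 \<in> Basis" "e0 \<noteq> e1" and D: "DIM('a) \<ge> 3"
    and [measurable]: "P \<in> borel_measurable borel"
  defines "k \<equiv> DIM('a) - 2"
  shows "(\<integral>\<^sup>+x. P (x \<bullet> e0, x \<bullet> e1, axial e0 x) \<partial>lborel) =
    (\<integral>\<^sup>+t. \<integral>\<^sup>+s. \<integral>\<^sup>+\<rho>. ennreal (unit_ball_vol k * k * \<rho> ^ (k - 1)) * indicator {0..} \<rho> *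
        P (t, s, sqrt (s\<^sup>2 + \<rho>\<^sup>2)) \<partial>lborel \<partial>lborel \<partial>lborel)"
proof -
  define A where "A = Basis - {e0, e1}"
  interpret product_sigma_finite "\<lambda>_::'a. lborel :: real measure"
    by standard
  have B: "(Basis :: 'a set) = insert e0 (insert e1 A)" and nA: "finite A" "e1 \<notin> A" "e0 \<notin> insert e1 A"
    using e by (auto simp: A_def)
  have cA: "card A = k" using e by (simp add: A_def k_def card_Diff_subset)
  then have A0: "A \<noteq> {}" using D by (auto simp: k_def)
  have inner: "(\<Sum>b\<in>Basis. f b *\<^sub>R b) \<bullet> e = f e" if "e \<in> Basis" for f and e :: 'a
    using that by (simp add: inner_sum_left inner_Basis if_distrib sum.delta cong: if_cong)
  have ax: "axial e0 (\<Sum>b\<in>Basis. f b *\<^sub>R b) = sqrt ((f e1)\<^sup>2 + (\<Sum>i\<in>A. (f i)\<^sup>2))" for f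
  proof -
    have "(\<Sum>b\<in>Basis. f b *\<^sub>R b) - f e0 *\<^sub>R e0 = (\<Sum>b\<in>Basis. (if b = e0 then 0 else f b) *\<^sub>R b)"
      by (simp add: sum.remove[OF finite_Basis e(1)])
    then have "axial e0 (\<Sum>b\<in>Basis. f b *\<^sub>R b) = norm (\<Sum>b\<in>Basis. (if b = e0 then 0 else f b) *\<^sub>R b)"
      by (simp add: axial_def inner[OF e(1)])
    also have "\<dots> = sqrt (\<Sum>i\<in>Basis. (if i = e0 then 0 else f i)\<^sup>2)"
    proof -
      have "norm y = sqrt (\<Sum>i\<in>Basis. (y \<bullet> i)\<^sup>2)" for y :: 'a
        by (simp add: norm_eq_sqrt_inner euclidean_inner[of y y] power2_eq_square)
      then show ?thesis by (simp add: inner)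
    qed
    also have "(\<Sum>i\<in>Basis. (if i = e0 then 0 else f i)\<^sup>2) = (f e1)\<^sup>2 + (\<Sum>i\<in>A. (f i)\<^sup>2)"
    proof -
      have "Basis - {e0} = insert e1 A" using e by (auto simp: A_def)
      moreover have "(\<Sum>i\<in>A. (if i = e0 then 0 else f i)\<^sup>2) = (\<Sum>i\<in>A. (f i)\<^sup>2)"
        by (intro sum.cong) (auto simp: A_def)
      ultimately show ?thesis
        using nA e by (simp add: sum.remove[OF finite_Basis e(1)])
    qed
    finally show ?thesis .
  qed
  have "(\<integral>\<^sup>+x. P (x \<bullet> e0, x \<bullet> e1, axial e0 x) \<partial>lborel) =
      (\<integral>\<^sup>+f. P (f e0, f e1, sqrt ((f e1)\<^sup>2 + (\<Sum>i\<in>A. (f i)\<^sup>2))) \<partial>Pi\<^sub>M Basis (\<lambda>_. lborel))"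
    by (subst lborel_eq, subst nn_integral_distr) (simp_all add: inner e ax)
  also have "\<dots> = (\<integral>\<^sup>+t. \<integral>\<^sup>+s. \<integral>\<^sup>+f. P (t, s, sqrt (s\<^sup>2 + (\<Sum>i\<in>A. (f i)\<^sup>2))) \<partial>Pi\<^sub>M A (\<lambda>_. lborel) \<partial>lborel \<partial>lborel)"
    unfolding B using nA
  proof (subst product_nn_integral_insert_rev, simp, simp, measurable, intro nn_integral_cong, goal_cases)
    case (1 t)
    have *: "(\<Sum>i\<in>A. ((f(e1 := s)) i)\<^sup>2) = (\<Sum>i\<in>A. (f i)\<^sup>2)"
      "(\<Sum>i\<in>A. ((f(e0 := s)) i)\<^sup>2) = (\<Sum>i\<in>A. (f i)\<^sup>2)" for f and s :: real
      using nA by (auto intro!: sum.cong)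
    show ?case
      using nA e * by (subst product_nn_integral_insert_rev) (simp_all add: fun_upd_other)
  qed
  also have "\<dots> = (\<integral>\<^sup>+t. \<integral>\<^sup>+s. \<integral>\<^sup>+\<rho>. ennreal (unit_ball_vol k * k * \<rho> ^ (k - 1)) * indicator {0..} \<rho> *
        P (t, s, sqrt (s\<^sup>2 + \<rho>\<^sup>2)) \<partial>lborel \<partial>lborel \<partial>lborel)"
  proof (intro nn_integral_cong)
    fix t s :: real
    show "(\<integral>\<^sup>+f. P (t, s, sqrt (s\<^sup>2 + (\<Sum>i\<in>A. (f i)\<^sup>2))) \<partial>Pi\<^sub>M A (\<lambda>_. lborel)) =
      (\<integral>\<^sup>+\<rho>. ennreal (unit_ball_vol k * k * \<rho> ^ (k - 1)) * indicator {0..} \<rho> * P (t, s, sqrt (s\<^sup>2 + \<rho>\<^sup>2)) \<partial>lborel)"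
      using nn_integral_PiM_radial[OF nA(1) A0, of "\<lambda>\<rho>. P (t, s, sqrt (s\<^sup>2 + \<rho>\<^sup>2))"]
      by (simp add: cA sum_nonneg)
  qed
  finally show ?thesis .
qed

text \<open>Substitution r = sqrt (s^2 + \<open>\<rho>\<close>^2): since r dr =
  \<open>\<rho>\<close> d\<open>\<rho>\<close>, one factor \<open>\<rho>\<close> is used up and the
  exponent drops to \<open>k - 2\<close>. The excluded values of \<open>s\<close> form a null set;
  at them the square root is not differentiable at \<open>\<rho> = 0\<close>, or the interval of
  integration shrinks to a point.\<close>

lemma nn_integral_axial_radius:
  fixes P :: "real \<Rightarrow> ennreal"
  assumes [measurable]: "P \<in> borel_measurable borel" and P0: "\<And>r. r > 1 \<Longrightarrow> P r = 0"
    and k: "k \<ge> 2" and c: "c \<ge> 0" and s: "s \<noteq> 0" "\<bar>s\<bar> \<noteq> 1"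
  shows "(\<integral>\<^sup>+\<rho>. ennreal (c * \<rho> ^ (k - 1)) * indicator {0..} \<rho> * P (sqrt (s\<^sup>2 + \<rho>\<^sup>2)) \<partial>lborel) =
    (\<integral>\<^sup>+r. ennreal (c * r * sqrt (r\<^sup>2 - s\<^sup>2) ^ (k - 2)) * indicator {\<bar>s\<bar>..1} r * P r \<partial>lborel)"
proof (cases "\<bar>s\<bar> < 1")
  case True
  define g where "g = (\<lambda>\<rho>. sqrt (s\<^sup>2 + \<rho>\<^sup>2))"
  define R where "R = sqrt (1 - s\<^sup>2)"
  have s1: "s\<^sup>2 < 1" using True by (simp add: abs_square_less_1)
  have R: "R > 0" using s1 by (simp add: R_def)
  have pos: "s\<^sup>2 + \<rho>\<^sup>2 > 0" for \<rho>
    using s by (simp add: add_pos_nonneg)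
  then have gpos: "g \<rho> > 0" for \<rho>
    unfolding g_def by simp
  then have gne: "g \<rho> \<noteq> 0" for \<rho>
    by (metis less_irrefl)
  have cont_g: "continuous_on S g" for S
    unfolding g_def by (intro continuous_intros)
  have [measurable]: "g \<in> borel_measurable borel"
    unfolding g_def by measurable
  have gd: "(g has_real_derivative \<rho> / g \<rho>) (at \<rho>)" for \<rho>
    unfolding g_def using pos[of \<rho>] by (auto intro!: derivative_eq_intros simp: field_simps)
  have g0: "g 0 = \<bar>s\<bar>" and gR: "g R = 1"
    using s1 by (simp_all add: g_def R_def)
  let ?f = "\<lambda>r. ennreal (c * r * sqrt (r\<^sup>2 - s\<^sup>2) ^ (k - 2)) * P r"
  have "(\<integral>\<^sup>+\<rho>. ennreal (c * \<rho> ^ (k - 1)) * indicator {0..} \<rho> * P (sqrt (s\<^sup>2 + \<rho>\<^sup>2)) \<partial>lborel) =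
     (\<integral>\<^sup>+\<rho>. ?f (g \<rho>) * ennreal (\<rho> / g \<rho>) * indicator {0..R} \<rho> \<partial>lborel)"
  proof (rule nn_integral_cong)
    fix \<rho> :: real
    consider "\<rho> < 0" | "0 \<le> \<rho>" "\<rho> \<le> R" | "\<rho> > R" by linarith
    then show "ennreal (c * \<rho> ^ (k - 1)) * indicator {0..} \<rho> * P (sqrt (s\<^sup>2 + \<rho>\<^sup>2)) =
      ?f (g \<rho>) * ennreal (\<rho> / g \<rho>) * indicator {0..R} \<rho>"
    proof cases
      case 2
      have "sqrt ((g \<rho>)\<^sup>2 - s\<^sup>2) = \<rho>" using 2 by (simp add: g_def)
      moreover have "c * g \<rho> * \<rho> ^ (k - 2) * (\<rho> / g \<rho>) = c * \<rho> ^ (k - 1)"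
      proof -
        have "k - 1 = Suc (k - 2)" using k by simp
        then show ?thesis using gpos[of \<rho>] by (simp add: field_simps)
      qed
      moreover have "ennreal (c * g \<rho> * \<rho> ^ (k - 2)) * ennreal (\<rho> / g \<rho>) = ennreal (c * g \<rho> * \<rho> ^ (k - 2) * (\<rho> / g \<rho>))"
        using 2 gpos[of \<rho>] c by (intro ennreal_mult[symmetric]) auto
      ultimately have "ennreal (c * \<rho> ^ (k - 1)) =
          ennreal (c * g \<rho> * sqrt ((g \<rho>)\<^sup>2 - s\<^sup>2) ^ (k - 2)) * ennreal (\<rho> / g \<rho>)"
        by simp
      moreover have "indicator {0..} \<rho> = (1::ennreal)" "indicator {0..R} \<rho> = (1::ennreal)"
        using 2 by auto
      moreover have "P (sqrt (s\<^sup>2 + \<rho>\<^sup>2)) = P (g \<rho>)" by (simp add: g_def)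
      ultimately show ?thesis by (simp only: mult_ac)
    next
      case 3
      then have "R\<^sup>2 < \<rho>\<^sup>2" using R by (intro power_strict_mono) auto
      then have "sqrt (s\<^sup>2 + \<rho>\<^sup>2) > 1" using s1 by (simp add: R_def)
      then show ?thesis using 3 P0 by simp
    qed auto
  qed
  also have "\<dots> = (\<integral>\<^sup>+r. ?f r * indicator {g 0..g R} r \<partial>lborel)"
    using R gd gpos
    by (intro nn_integral_substitution_aux[symmetric])
      (auto simp: gne intro!: continuous_intros cont_g divide_nonneg_pos)
  finally show ?thesis by (simp add: g0 gR mult_ac)
next
  case False
  have "1 < sqrt (s\<^sup>2 + \<rho>\<^sup>2)" for \<rho>
  proof -
    have "1 < \<bar>s\<bar>" using False s by simp
    also have "\<bar>s\<bar> \<le> sqrt (s\<^sup>2 + \<rho>\<^sup>2)" by (intro real_le_rsqrt) simp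
    finally show ?thesis .
  qed
  then show ?thesis using False s P0 by (simp add: indicator_def)
qed

text \<open>Setting s = rv separates the variables. With m = k + 1 the dimension orthogonal to the
  axis, \<open>r ^ k\<close> is the radial density and the weight in \<open>v\<close> is, up to a
  constant, the marginal density of the sphere.\<close>

lemma nn_integral_axial:
  fixes P :: "real \<times> real \<times> real \<Rightarrow> ennreal" and e0 e1 :: "'a::euclidean_space"
  assumes e: "e0 \<in> Basis" "e1 \<in> Basis" "e0 \<noteq> e1" and D: "DIM('a) \<ge> 4"
    and [measurable]: "P \<in> borel_measurable borel"
    and P0: "\<And>t s r. r > 1 \<Longrightarrow> P (t, s, r) = 0"
  defines "k \<equiv> DIM('a) - 2"
  shows "(\<integral>\<^sup>+x. P (x \<bullet> e0, x \<bullet> e1, axial e0 x) \<partial>lborel) =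
    ennreal (unit_ball_vol k * k) * (\<integral>\<^sup>+t. \<integral>\<^sup>+r. \<integral>\<^sup>+v. ennreal (r ^ k) * indicator {0<..1} r *
      (ennreal (sqrt (1 - v\<^sup>2) ^ (k - 2)) * indicator {-1..1} v * P (t, r * v, r)) \<partial>lborel \<partial>lborel \<partial>lborel)"
proof -
  define c where "c = unit_ball_vol k * k"
  have c: "c \<ge> 0" by (simp add: c_def)
  have k: "k \<ge> 2" using D by (simp add: k_def)
  let ?F = "\<lambda>t s r. ennreal (c * r * sqrt (r\<^sup>2 - s\<^sup>2) ^ (k - 2)) * indicator {\<bar>s\<bar>..1} r * P (t, s, r)"
  have F[measurable]: "(\<lambda>(s, r). ?F t s r) \<in> borel_measurable (lborel \<Otimes>\<^sub>M lborel)" for t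
  proof -
    have [measurable]: "(\<lambda>x. P (t, fst x, snd x)) \<in> borel_measurable (lborel \<Otimes>\<^sub>M lborel)"
      by (simp add: lborel_prod)
    show ?thesis
      unfolding indicator_def atLeastAtMost_iff by measurable
  qed
  have "(\<integral>\<^sup>+x. P (x \<bullet> e0, x \<bullet> e1, axial e0 x) \<partial>lborel) =
    (\<integral>\<^sup>+t. \<integral>\<^sup>+s. \<integral>\<^sup>+\<rho>. ennreal (c * \<rho> ^ (k - 1)) * indicator {0..} \<rho> *
        P (t, s, sqrt (s\<^sup>2 + \<rho>\<^sup>2)) \<partial>lborel \<partial>lborel \<partial>lborel)"
    unfolding c_def k_def using D by (intro nn_integral_axial_cartesian e) auto
  also have "\<dots> = (\<integral>\<^sup>+t. \<integral>\<^sup>+s. \<integral>\<^sup>+r. ?F t s r \<partial>lborel \<partial>lborel \<partial>lborel)"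
  proof (rule nn_integral_cong, rule nn_integral_cong_AE)
    fix t :: real
    have "AE s in lborel. s \<noteq> 0" "AE s in lborel. s \<noteq> 1" "AE s in lborel. s \<noteq> (-1::real)"
      by (rule AE_lborel_singleton)+
    then show "AE s in lborel. (\<integral>\<^sup>+\<rho>. ennreal (c * \<rho> ^ (k - 1)) * indicator {0..} \<rho> * P (t, s, sqrt (s\<^sup>2 + \<rho>\<^sup>2)) \<partial>lborel)
       = (\<integral>\<^sup>+r. ?F t s r \<partial>lborel)"
    proof eventually_elim
      case (elim s)
      then have "\<bar>s\<bar> \<noteq> 1" by auto
      then show ?case
        using elim k c P0 by (intro nn_integral_axial_radius[where P="\<lambda>r. P (t, s, r)"]) auto
    qed
  qed
  also have "\<dots> = (\<integral>\<^sup>+t. \<integral>\<^sup>+r. \<integral>\<^sup>+s. ?F t s r \<partial>lborel \<partial>lborel \<partial>lborel)"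
    using F by (intro nn_integral_cong lborel_pair.Fubini'[symmetric]) simp
  also have "\<dots> = (\<integral>\<^sup>+t. \<integral>\<^sup>+r. ennreal c * (\<integral>\<^sup>+v. ennreal (r ^ k) * indicator {0<..1} r *
      (ennreal (sqrt (1 - v\<^sup>2) ^ (k - 2)) * indicator {-1..1} v * P (t, r * v, r)) \<partial>lborel) \<partial>lborel \<partial>lborel)"
  proof (intro nn_integral_cong)
    fix t r :: real
    show "(\<integral>\<^sup>+s. ?F t s r \<partial>lborel) = ennreal c * (\<integral>\<^sup>+v. ennreal (r ^ k) * indicator {0<..1} r *
      (ennreal (sqrt (1 - v\<^sup>2) ^ (k - 2)) * indicator {-1..1} v * P (t, r * v, r)) \<partial>lborel)"
    proof (cases "0 < r \<and> r \<le> 1")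
      case False
      then have "?F t s r = 0" for s by (cases "r = 0") (auto simp: indicator_def)
      then have "(\<integral>\<^sup>+s. ?F t s r \<partial>lborel) = 0" by (simp only: nn_integral_0_iff_AE) simp
      moreover have "indicator {0<..1} r = (0 :: ennreal)" using False by auto
      ultimately show ?thesis by simp
    next
      case True
      have "(\<integral>\<^sup>+s. ?F t s r \<partial>lborel) = \<bar>r\<bar> * (\<integral>\<^sup>+v. ?F t (0 + r * v) r \<partial>lborel)"
      proof (rule nn_integral_real_affine)
        show "(\<lambda>s. ?F t s r) \<in> borel_measurable borel"
          unfolding indicator_def atLeastAtMost_iff by measurable
      qed (use True in auto)
      also have "\<dots> = (\<integral>\<^sup>+v. ennreal r * ?F t (0 + r * v) r \<partial>lborel)"
      proof (subst nn_integral_cmult)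
        show "(\<lambda>v. ?F t (0 + r * v) r) \<in> borel_measurable lborel"
          unfolding indicator_def atLeastAtMost_iff by measurable
      qed (use True in auto)
      also have "\<dots> = (\<integral>\<^sup>+v. ennreal c * (ennreal (r ^ k) * indicator {0<..1} r *
      (ennreal (sqrt (1 - v\<^sup>2) ^ (k - 2)) * indicator {-1..1} v * P (t, r * v, r))) \<partial>lborel)"
      proof (rule nn_integral_cong)
        fix v :: real
        have i: "\<bar>r * v\<bar> \<le> r \<longleftrightarrow> v \<in> {-1..1}"
          using True by (auto simp: abs_mult abs_le_iff)
        have k2: "r ^ k = r * r * r ^ (k - 2)"
          using k by (metis add_2_eq_Suc le_add_diff_inverse mult.assoc power_Suc)
        have "sqrt (r\<^sup>2 - (r * v)\<^sup>2) = r * sqrt (1 - v\<^sup>2)"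
          using True by (simp add: power_mult_distrib real_sqrt_mult right_diff_distrib[symmetric, of "r\<^sup>2" 1, simplified])
        then have eq: "r * (c * r * sqrt (r\<^sup>2 - (r * v)\<^sup>2) ^ (k - 2)) = c * (r ^ k * sqrt (1 - v\<^sup>2) ^ (k - 2))"
          by (simp add: power_mult_distrib k2)
        show "ennreal r * ?F t (0 + r * v) r = ennreal c * (ennreal (r ^ k) * indicator {0<..1} r *
          (ennreal (sqrt (1 - v\<^sup>2) ^ (k - 2)) * indicator {-1..1} v * P (t, r * v, r)))"
        proof (cases "v \<in> {-1..1}")
          case v: True
          then have "v\<^sup>2 \<le> 1" by (simp add: abs_square_le_1 abs_le_iff)
          then have "ennreal c * (ennreal (r ^ k) * ennreal (sqrt (1 - v\<^sup>2) ^ (k - 2))) =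
              ennreal (r * (c * r * sqrt (r\<^sup>2 - (r * v)\<^sup>2) ^ (k - 2)))"
            unfolding eq using c True by (simp add: ennreal_mult)
          also have "\<dots> = ennreal r * ennreal (c * r * sqrt (r\<^sup>2 - (r * v)\<^sup>2) ^ (k - 2))"
            using True by (intro ennreal_mult') auto
          finally show ?thesis
            using v True i by (simp add: indicator_def mult.assoc[symmetric])
        next
          case False
          then show ?thesis using i by (auto simp: indicator_def)
        qed
      qed
      also have "\<dots> = ennreal c * (\<integral>\<^sup>+v. ennreal (r ^ k) * indicator {0<..1} r *
      (ennreal (sqrt (1 - v\<^sup>2) ^ (k - 2)) * indicator {-1..1} v * P (t, r * v, r)) \<partial>lborel)"
        by (rule nn_integral_cmult) measurable
      finally show ?thesis .
    qed
  qed
  also have "\<dots> = ennreal c * (\<integral>\<^sup>+t. \<integral>\<^sup>+r. \<integral>\<^sup>+v. ennreal (r ^ k) * indicator {0<..1} r *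
      (ennreal (sqrt (1 - v\<^sup>2) ^ (k - 2)) * indicator {-1..1} v * P (t, r * v, r)) \<partial>lborel \<partial>lborel \<partial>lborel)"
    by (simp add: nn_integral_cmult)
  finally show ?thesis by (simp add: c_def)
qed

section \<open>Logarithmic averages over intervals\<close>

text \<open>Up to a linear term an antiderivative of \<open>ln \<bar>x\<bar>\<close>; its continuity
  at 0 lets the fundamental theorem of calculus pass over the singularity.\<close>

definition xlnx :: "real \<Rightarrow> real" where
  "xlnx x = x * ln \<bar>x\<bar>"

lemma xlnx_deriv [derivative_intros]:
  "x \<noteq> 0 \<Longrightarrow> (xlnx has_real_derivative ln \<bar>x\<bar> + 1) (at x)"
proof -
  assume x: "x \<noteq> 0"
  have "((\<lambda>x. ln \<bar>x\<bar>) has_real_derivative 1 / x) (at x)"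
  proof (cases "x > 0")
    case True
    have "(ln has_real_derivative 1 / x) (at x)" using True by (auto intro!: derivative_eq_intros simp: field_simps)
    then show ?thesis
      by (rule has_field_derivative_transform_within_open[of _ _ _ "{0<..}"]) (use True in auto)
  next
    case False
    have "((\<lambda>x. ln (- x)) has_real_derivative 1 / x) (at x)" using False x by (auto intro!: derivative_eq_intros simp: field_simps)
    then show ?thesis
      by (rule has_field_derivative_transform_within_open[of _ _ _ "{..<0}"]) (use False x in auto)
  qed
  from DERIV_mult[OF DERIV_ident this] show ?thesis
    unfolding xlnx_def[abs_def] using x by simp
qed

lemma xlnx_deriv_chain [derivative_intros]:
  assumes "(f has_real_derivative f') (at x)" "f x \<noteq> 0" "D = (ln \<bar>f x\<bar> + 1) * f'"
  shows "((\<lambda>x. xlnx (f x)) has_real_derivative D) (at x)"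
  using DERIV_chain2[OF xlnx_deriv assms(1)] assms by simp

lemma xlnx_continuous_at: "isCont xlnx x"
proof (cases "x = 0")
  case False
  then show ?thesis using xlnx_deriv[of x] DERIV_isCont by blast
next
  case True
  have "((\<lambda>x. \<bar>xlnx x\<bar>) \<longlongrightarrow> 0) (at 0)"
  proof -
    have "((\<lambda>x::real. \<bar>\<bar>x\<bar> * ln \<bar>x\<bar>\<bar>) \<longlongrightarrow> 0) (at 0)"
      by real_asymp
    then show ?thesis by (simp add: xlnx_def abs_mult)
  qed
  then have "(xlnx \<longlongrightarrow> 0) (at 0)" by (rule tendsto_rabs_zero_cancel)
  then show ?thesis using True by (simp add: isCont_def xlnx_def)
qed

lemma xlnx_continuous_on [continuous_intros]:
  "continuous_on S f \<Longrightarrow> continuous_on S (\<lambda>x. xlnx (f x))"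
  using continuous_on_compose2[of UNIV xlnx S f]
  by (simp add: continuous_on_eq_continuous_at xlnx_continuous_at)

lemma xlnx_minus [simp]: "xlnx (- x) = - xlnx x"
  by (simp add: xlnx_def)

text \<open>
  This is \<open>u(\<tau>, \<beta>)\<close> of the introduction in closed form. The case \<open>\<beta> = 0\<close> is its limit, which the
  quotient would miss.
\<close>

definition avg_log :: "real \<Rightarrow> real \<Rightarrow> real" where
  "avg_log \<tau> \<beta> = (if \<beta> = 0 then ln \<bar>\<tau>\<bar> else (xlnx (\<tau> + \<beta>) - xlnx (\<tau> - \<beta>)) / (2 * \<beta>) - 1)"

lemma has_integral_avg_log:
  assumes "\<beta> \<ge> 0"
  shows "((\<lambda>v. ln \<bar>\<tau> + \<beta> * v\<bar>) has_integral 2 * avg_log \<tau> \<beta>) {-1..1}"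
proof (cases "\<beta> = 0")
  case True
  then show ?thesis
    using has_integral_const_real[of "ln \<bar>\<tau>\<bar>" "-1" 1] by (simp add: avg_log_def)
next
  case False
  define F where "F = (\<lambda>v. xlnx (\<tau> + \<beta> * v) / \<beta> - v)"
  have "((\<lambda>v. ln \<bar>\<tau> + \<beta> * v\<bar>) has_integral F 1 - F (-1)) {-1..1}"
  \<comment> \<open>The exceptional point is the only possible singularity of the integrand, and
    \<open>F\<close> is continuous there.\<close>
  proof (rule fundamental_theorem_of_calculus_interior_strong[where S="{- \<tau> / \<beta>}"])
    fix v assume v: "v \<in> {-1<..<1} - {- \<tau> / \<beta>}"
    then have "\<tau> + \<beta> * v \<noteq> 0" using False by (auto simp: field_simps)
    then have "(F has_real_derivative ln \<bar>\<tau> + \<beta> * v\<bar>) (at v)"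
      unfolding F_def using False by (auto intro!: derivative_eq_intros simp: field_simps)
    then show "(F has_vector_derivative ln \<bar>\<tau> + \<beta> * v\<bar>) (at v)"
      by (simp add: has_real_derivative_iff_has_vector_derivative)
  qed (auto simp: F_def intro!: continuous_intros False)
  also have "F 1 - F (-1) = 2 * avg_log \<tau> \<beta>"
    using False by (simp add: F_def avg_log_def field_simps)
  finally show ?thesis .
qed

lemma nn_integral_avg_log:
  assumes "\<beta> \<ge> 0" and "\<And>v. v \<in> {-1..1} \<Longrightarrow> ln \<bar>\<tau> + \<beta> * v\<bar> \<le> N"
  shows "(\<integral>\<^sup>+v. ennreal (N - ln \<bar>\<tau> + \<beta> * v\<bar>) * indicator {-1..1} v \<partial>lborel) = ennreal (2 * (N - avg_log \<tau> \<beta>))"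
proof -
  have "((\<lambda>v. N - ln \<bar>\<tau> + \<beta> * v\<bar>) has_integral (N * 2 - 2 * avg_log \<tau> \<beta>)) {-1..1}"
    using has_integral_diff[OF has_integral_const_real[of N "-1" 1] has_integral_avg_log[OF assms(1)]]
    by (simp add: mult.commute)
  then show ?thesis
    using assms by (subst nn_integral_has_integral_lebesgue') (auto simp: algebra_simps)
qed

lemma avg_log_minus: "avg_log (- \<tau>) \<beta> = avg_log \<tau> \<beta>"
  using xlnx_minus[of "\<tau> - \<beta>"] xlnx_minus[of "\<tau> + \<beta>"] by (simp add: avg_log_def)

lemma avg_log_abs: "avg_log \<bar>\<tau>\<bar> \<beta> = avg_log \<tau> \<beta>"
  by (simp add: abs_if avg_log_minus)

lemma xlnx_scale: "c > 0 \<Longrightarrow> xlnx (c * x) = c * xlnx x + c * x * ln c"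
  by (cases "x = 0") (auto simp: xlnx_def abs_mult ln_mult algebra_simps)

text \<open>At the excluded pair the convention \<open>ln 0 = 0\<close> breaks logarithmic
  homogeneity.\<close>

lemma avg_log_scale:
  assumes "c > 0" "\<tau> \<noteq> 0 \<or> \<beta> \<noteq> 0"
  shows "avg_log (c * \<tau>) (c * \<beta>) = ln c + avg_log \<tau> \<beta>"
proof (cases "\<beta> = 0")
  case True
  then show ?thesis using assms by (simp add: avg_log_def abs_mult ln_mult)
next
  case False
  have "xlnx (c * \<tau> + c * \<beta>) - xlnx (c * \<tau> - c * \<beta>) = c * (xlnx (\<tau> + \<beta>) - xlnx (\<tau> - \<beta>)) + 2 * c * \<beta> * ln c"
    using xlnx_scale[OF assms(1), of "\<tau> + \<beta>"] xlnx_scale[OF assms(1), of "\<tau> - \<beta>"]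
    by (simp add: algebra_simps)
  then have "avg_log (c * \<tau>) (c * \<beta>) =
      (c * (xlnx (\<tau> + \<beta>) - xlnx (\<tau> - \<beta>)) + 2 * c * \<beta> * ln c) / (2 * c * \<beta>) - 1"
    using False assms by (simp add: avg_log_def mult.assoc)
  also have "\<dots> = ln c + avg_log \<tau> \<beta>"
    using False assms by (simp add: avg_log_def add_divide_distrib)
  finally show ?thesis .
qed

text \<open>Up to the factor \<open>2 * \<beta>\<close> the derivative in \<open>\<tau>\<close> is
  ln (\<open>\<tau>\<close> + \<open>\<beta>\<close>) - ln |\<open>\<tau>\<close> -
  \<open>\<beta>\<close>|, which is nonnegative. It is singular at \<open>\<tau> = \<beta>\<close>,
  hence the passage through that point by continuity.\<close>

lemma avg_log_mono:
  assumes "0 \<le> \<tau>" "\<tau> \<le> \<tau>'" "\<beta> \<ge> 0" "\<tau> > 0 \<or> \<beta> > 0"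
  shows "avg_log \<tau> \<beta> \<le> avg_log \<tau>' \<beta>"
proof (cases "\<beta> = 0")
  case True
  then show ?thesis using assms by (simp add: avg_log_def)
next
  case False
  define G where "G = (\<lambda>x. xlnx (x + \<beta>) - xlnx (x - \<beta>))"
  have G: "G x \<le> G y" if "0 \<le> x" "x \<le> y" "y \<le> \<beta> \<or> \<beta> \<le> x" for x y
  proof (rule DERIV_nonneg_imp_increasing_open[of x y G])
    fix z assume z: "x < z" "z < y"
    then have nz: "z + \<beta> \<noteq> 0" "z - \<beta> \<noteq> 0" using that assms by auto
    have "(G has_real_derivative ln (abs (z + \<beta>)) - ln (abs (z - \<beta>))) (at z)"
      unfolding G_def using nz by (auto intro!: derivative_eq_intros)
    moreover have "ln \<bar>z - \<beta>\<bar> \<le> ln \<bar>z + \<beta>\<bar>"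
      using nz z that assms by (intro ln_mono) auto
    ultimately show "\<exists>D. (G has_real_derivative D) (at z) \<and> 0 \<le> D" by auto
  qed (use that in \<open>auto simp: G_def intro!: continuous_intros\<close>)
  have "G \<tau> \<le> G \<tau>'"
  proof (cases "\<tau>' \<le> \<beta> \<or> \<beta> \<le> \<tau>")
    case True
    then show ?thesis using G assms by auto
  next
    case False
    then have "G \<tau> \<le> G \<beta>" "G \<beta> \<le> G \<tau>'" using G assms by auto
    then show ?thesis by simp
  qed
  then show ?thesis using False assms
    by (simp add: avg_log_def G_def divide_right_mono)
qed

section \<open>Quadratic and logarithmic bounds for the averages\<close>

text \<open>The right side is 2 artanh w, and the left side is the first term of its power series;
  the difference has derivative 2x^2/(1 - x^2).\<close>

lemma ln_ratio_lower:
  fixes w :: real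
  assumes "0 \<le> w" "w < 1"
  shows "2 * w \<le> ln (1 + w) - ln (1 - w)"
proof -
  let ?h = "\<lambda>w::real. ln (1 + w) - ln (1 - w) - 2 * w"
  have "?h 0 \<le> ?h w"
  proof (rule DERIV_nonneg_imp_nondecreasing[of 0 w ?h, OF assms(1)])
    fix x assume x: "0 \<le> x" "x \<le> w"
    have "(?h has_real_derivative 1 / (1 + x) + 1 / (1 - x) - 2) (at x)"
      using x assms by (auto intro!: derivative_eq_intros simp: divide_inverse)
    moreover have "1 / (1 + x) + 1 / (1 - x) - 2 = 2 * x\<^sup>2 / (1 - x\<^sup>2)"
    proof -
      have "1 - x\<^sup>2 = (1 + x) * (1 - x)" by (simp add: algebra_simps power2_eq_square)
      then show ?thesis using x assms by (auto simp: divide_simps) (auto simp: algebra_simps power2_eq_square)?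
    qed
    moreover have "x\<^sup>2 < 1" using x assms by (simp add: abs_square_less_1)
    ultimately show "\<exists>y. (?h has_real_derivative y) (at x) \<and> 0 \<le> y"
      by (metis diff_gt_0_iff_gt divide_nonneg_pos mult_nonneg_nonneg zero_le_numeral zero_le_power2)
  qed
  then show ?thesis by simp
qed

text \<open>The gap vanishes at 0 and its derivative is \<open>2 * x\<close> times the logarithmic
  ratio. The integral over the ball of dimension 3 turns on this inequality.\<close>

lemma ln_ratio_upper:
  fixes w :: real
  assumes "0 \<le> w" "w < 1"
  shows "(1 - w\<^sup>2) * (ln (1 + w) - ln (1 - w)) \<le> 2 * w"
proof -
  let ?h = "\<lambda>w::real. 2 * w - (1 - w\<^sup>2) * (ln (1 + w) - ln (1 - w))"
  have "?h 0 \<le> ?h w"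
  proof (rule DERIV_nonneg_imp_nondecreasing[of 0 w ?h, OF assms(1)])
    fix x assume x: "0 \<le> x" "x \<le> w"
    have "(?h has_real_derivative 2 * x * (ln (1 + x) - ln (1 - x)) + 2 -
        (1 - x\<^sup>2) * (1 / (1 + x) + 1 / (1 - x))) (at x)"
      using x assms by (auto intro!: derivative_eq_intros simp: divide_inverse)
    moreover have "(1 - x\<^sup>2) * (1 / (1 + x) + 1 / (1 - x)) = 2"
    proof -
      have "1 - x\<^sup>2 = (1 + x) * (1 - x)" by (simp add: algebra_simps power2_eq_square)
      then show ?thesis using x assms by (simp add: divide_simps)
    qed
    moreover have "0 \<le> 2 * x * (ln (1 + x) - ln (1 - x))"
      using ln_ratio_lower[of x] x assms by (intro mult_nonneg_nonneg) auto
    ultimately show "\<exists>y. (?h has_real_derivative y) (at x) \<and> 0 \<le> y" by auto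
  qed
  then show ?thesis by simp
qed

text \<open>The derivative of \<open>avg_log w 1\<close> is artanh w, which is at least w. The
  coefficient 1/2 is that of the Taylor expansion at 0, so nothing is lost to second order.\<close>

lemma avg_log_1_lower:
  assumes "0 \<le> w" "w \<le> 1"
  shows "w\<^sup>2 / 2 - 1 \<le> avg_log w 1"
proof -
  let ?f = "\<lambda>w. xlnx (w + 1) - xlnx (w - 1) - w\<^sup>2"
  have "?f 0 \<le> ?f w"
  proof (rule DERIV_nonneg_imp_increasing_open[of 0 w ?f])
    fix x assume x: "0 < x" "x < w"
    have "(?f has_real_derivative ln (abs (x + 1)) - ln (abs (x - 1)) - 2 * x) (at x)"
      using x assms by (auto intro!: derivative_eq_intros)
    moreover have "ln (abs (x + 1)) - ln (abs (x - 1)) - 2 * x \<ge> 0"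
      using ln_ratio_lower[of x] x assms by (simp add: abs_if add.commute)
    ultimately show "\<exists>y. (?f has_real_derivative y) (at x) \<and> 0 \<le> y" by auto
  qed (use assms in \<open>auto intro!: continuous_intros\<close>)
  then show ?thesis by (simp add: avg_log_def xlnx_def)
qed

text \<open>Follows from ln (1 + x) \<le> x at x = w and x = -w. The coefficient is twice the Taylor
  one, which is affordable because this bound only serves the case \<open>b \<le> a\<close>.\<close>

lemma avg_log_1_upper:
  assumes "0 \<le> w" "w \<le> 1"
  shows "avg_log w 1 \<le> w\<^sup>2 - 1"
proof -
  have A: "(1 + w) * ln (1 + w) \<le> (1 + w) * w"
    using assms ln_add_one_self_le_self[of w] by (intro mult_left_mono) auto
  have B: "(1 - w) * ln (1 - w) \<le> (1 - w) * (- w)"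
  proof (cases "w = 1")
    case False
    then have "ln (1 - w) \<le> - w" using assms ln_le_minus_one[of "1 - w"] by simp
    then show ?thesis using assms by (intro mult_left_mono) auto
  qed simp
  have "xlnx (w - 1) = - ((1 - w) * ln (1 - w))"
    using assms by (simp add: xlnx_def abs_if) (simp add: algebra_simps)
  moreover have "xlnx (w + 1) = (1 + w) * ln (1 + w)"
    using assms by (simp add: xlnx_def add.commute)
  ultimately show ?thesis using A B
    by (simp add: avg_log_def power2_eq_square algebra_simps)
qed

lemma avg_log_normalize:
  assumes "\<beta> > 0"
  shows "avg_log \<tau> \<beta> = ln \<beta> + avg_log (\<tau> / \<beta>) 1"
  using avg_log_scale[of \<beta> "\<tau> / \<beta>" 1] assms by simp

lemma avg_log_upper:
  assumes "\<beta> > 0" "\<bar>s\<bar> \<le> \<beta>"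
  shows "avg_log s \<beta> \<le> ln \<beta> - 1 + (s / \<beta>)\<^sup>2"
proof -
  have "avg_log s \<beta> = ln \<beta> + avg_log \<bar>s / \<beta>\<bar> 1"
    unfolding avg_log_abs by (rule avg_log_normalize[OF assms(1)])
  moreover have "avg_log \<bar>s / \<beta>\<bar> 1 \<le> \<bar>s / \<beta>\<bar>\<^sup>2 - 1"
    using assms by (intro avg_log_1_upper) auto
  ultimately show ?thesis by (simp only: power2_abs)
qed

lemma avg_log_lower:
  assumes "\<beta> > 0" "0 \<le> \<tau>" "\<tau> \<le> \<beta>"
  shows "ln \<beta> - 1 + (\<tau> / \<beta>)\<^sup>2 / 2 \<le> avg_log \<tau> \<beta>"
  using avg_log_1_lower[of "\<tau> / \<beta>"] assms by (simp add: avg_log_normalize[OF assms(1)])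

text \<open>After scaling \<open>\<tau>\<close> to 1, pairing v with -v gives ln (1 - (bv)^2), which
  decreases as b = \<open>\<beta> / \<tau>\<close> grows. The extreme case is therefore
  \<open>\<beta> = \<tau>\<close>, with average ln 2 - 1.\<close>

lemma avg_log_lower_far:
  assumes "\<tau> > 0" "0 \<le> \<beta>" "\<beta> \<le> \<tau>"
  shows "ln \<tau> + ln 2 - 1 \<le> avg_log \<tau> \<beta>"
proof -
  \<comment> \<open>The open interval is essential: at v = 1 and v = -1 the convention
    \<open>ln 0 = 0\<close> would falsify the pointwise comparison.\<close>
  have hi: "((\<lambda>v. ln \<bar>1 + \<beta> * v\<bar> + ln \<bar>-1 + \<beta> * v\<bar>) has_integral 4 * avg_log 1 \<beta>) {-1<..<1}" if "\<beta> \<ge> 0" for \<beta>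
    using has_integral_add[OF has_integral_avg_log[OF that, of 1] has_integral_avg_log[OF that, of "-1"]]
    by (simp add: has_integral_Icc_iff_Ioo avg_log_minus)
  define b where "b = \<beta> / \<tau>"
  have b: "0 \<le> b" "b \<le> 1" using assms by (auto simp: b_def)
  have "4 * avg_log 1 1 \<le> 4 * avg_log 1 b"
  proof (rule has_integral_le[OF hi[of 1] hi[of b]])
    fix v :: real assume v: "v \<in> {-1<..<1}"
    have e: "ln \<bar>1 + c * v\<bar> + ln \<bar>-1 + c * v\<bar> = ln (1 - (c * v)\<^sup>2)" "(c * v)\<^sup>2 < 1" if "0 \<le> c" "c \<le> 1" for c
    proof -
      have "\<bar>c * v\<bar> \<le> \<bar>v\<bar>" using that by (simp add: abs_mult mult_left_le_one_le)
      then have cv: "\<bar>c * v\<bar> < 1" using v by (auto simp: abs_less_iff)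
      then show "(c * v)\<^sup>2 < 1" by (simp only: abs_square_less_1)
      have "ln \<bar>1 + c * v\<bar> + ln \<bar>-1 + c * v\<bar> = ln (1 + c * v) + ln (1 - c * v)"
      proof -
        have "\<bar>1 + c * v\<bar> = 1 + c * v" "\<bar>-1 + c * v\<bar> = 1 - c * v" using cv by linarith+
        then show ?thesis by simp
      qed
      also have "\<dots> = ln ((1 + c * v) * (1 - c * v))"
        using cv by (intro ln_mult_pos[symmetric]) (auto simp: abs_less_iff)
      finally show "ln \<bar>1 + c * v\<bar> + ln \<bar>-1 + c * v\<bar> = ln (1 - (c * v)\<^sup>2)"
        by (simp add: algebra_simps power2_eq_square)
    qed
    have "(b * v)\<^sup>2 \<le> (1 * v)\<^sup>2"
      using b by (simp add: power_mult_distrib mult_left_le_one_le power_le_one)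
    then have "ln (1 - (1 * v)\<^sup>2) \<le> ln (1 - (b * v)\<^sup>2)"
      using e(2)[of 1] by (intro ln_mono) auto
    then show "ln \<bar>1 + 1 * v\<bar> + ln \<bar>-1 + 1 * v\<bar> \<le> ln \<bar>1 + b * v\<bar> + ln \<bar>-1 + b * v\<bar>"
      using e(1)[of 1] e(1)[of b] b by simp
  qed (use b in auto)
  moreover have "avg_log 1 1 = ln 2 - 1" by (simp add: avg_log_def xlnx_def)
  moreover have "avg_log \<tau> \<beta> = ln \<tau> + avg_log 1 b"
    using avg_log_scale[of \<tau> 1 b] assms by (simp add: b_def)
  ultimately show ?thesis by simp
qed

text \<open>Jensen's inequality: \<open>ln\<close> lies below its tangent at \<open>\<tau>\<close>,
  whose linear part averages to 0.\<close>

lemma avg_log_le_ln: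
  assumes "\<tau> > 0" "0 < \<beta>" "\<beta> \<le> \<tau>"
  shows "avg_log \<tau> \<beta> \<le> ln \<tau>"
proof -
  have up: "((\<lambda>v. ln \<tau> + \<beta> / \<tau> * v) has_integral (2 * ln \<tau>)) {-1<..<1}"
  proof -
    have "((\<lambda>v. ln \<tau> + \<beta> / \<tau> * v) has_integral
        (\<lambda>v. ln \<tau> * v + \<beta> / \<tau> * v\<^sup>2 / 2) 1 - (\<lambda>v. ln \<tau> * v + \<beta> / \<tau> * v\<^sup>2 / 2) (-1)) {-1..1}"
      using assms by (intro fundamental_theorem_of_calculus)
        (auto simp flip: has_real_derivative_iff_has_vector_derivative intro!: derivative_eq_intros)
    then show ?thesis by (simp add: has_integral_Icc_iff_Ioo algebra_simps)
  qed
  have avg: "((\<lambda>v. ln \<bar>\<tau> + \<beta> * v\<bar>) has_integral 2 * avg_log \<tau> \<beta>) {-1<..<1}"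
    using has_integral_avg_log[of \<beta> \<tau>] assms by (simp add: has_integral_Icc_iff_Ioo)
  have le: "ln \<bar>\<tau> + \<beta> * v\<bar> \<le> ln \<tau> + \<beta> / \<tau> * v" if v: "v \<in> {-1<..<1}" for v
  proof -
    have "\<tau> * \<bar>v\<bar> < \<tau> * 1" using assms v by (intro mult_strict_left_mono) auto
    moreover have "\<beta> * \<bar>v\<bar> \<le> \<tau> * \<bar>v\<bar>" using assms by (intro mult_right_mono) auto
    ultimately have "\<beta> * \<bar>v\<bar> < \<tau>" by linarith
    then have "\<bar>\<beta> * v\<bar> < \<tau>" using assms by (simp add: abs_mult)
    then have p: "0 < \<tau> + \<beta> * v" by (simp add: abs_less_iff)
    have "ln (\<tau> + \<beta> * v) - ln \<tau> = ln ((\<tau> + \<beta> * v) / \<tau>)" using assms p by (simp add: ln_div)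
    also have "\<dots> \<le> (\<tau> + \<beta> * v) / \<tau> - 1" using assms p by (intro ln_le_minus_one) simp
    also have "\<dots> = \<beta> / \<tau> * v" using assms by (simp add: field_simps)
    finally show ?thesis using p by simp
  qed
  from has_integral_le[OF avg up le] show ?thesis by simp
qed

text \<open>
  The bound is sharp to second order in \<open>\<tau>\<close>: the derivatives of its two sides differ by a multiple of
  \<open>2\<tau> - (1 - \<tau>\<^sup>2)(ln(1 + \<tau>) - ln(1 - \<tau>))\<close>.
\<close>

lemma avg_log_ball3_integral:
  assumes "0 \<le> \<tau>"
  obtains P where "((\<lambda>r. 3 * r\<^sup>2 * avg_log \<tau> r) has_integral P) {0..1}" "P \<le> 3 / 2 * \<tau>\<^sup>2 - 4 / 3"
proof -
  \<comment> \<open>The integrand is 3/2 r (\<open>xlnx (\<tau> + r)\<close> -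
    \<open>xlnx (\<tau> - r)\<close>) - 3 r^2. With x = \<open>\<tau>\<close> + r or x =
    \<open>\<tau>\<close> - r both products call for an antiderivative of
    \<open>(x - \<tau>) * xlnx x\<close>, which is \<open>H \<tau>\<close>.\<close>
  define H where "H = (\<lambda>\<tau> x. x\<^sup>2 / 3 * xlnx x - x ^ 3 / 9 - \<tau> * (x / 2 * xlnx x - x\<^sup>2 / 4))"
  define S where "S = (\<lambda>r. 3 / 2 * (H \<tau> (\<tau> + r) - H \<tau> (\<tau> - r)) - r ^ 3)"
  have dH: "(H \<tau> has_real_derivative (x - \<tau>) * xlnx x) (at x)" if "x \<noteq> 0" for x
    unfolding H_def using that
    by (auto intro!: derivative_eq_intros) (simp add: xlnx_def field_simps power2_eq_square power3_eq_cube)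
  have int: "((\<lambda>r. 3 * r\<^sup>2 * avg_log \<tau> r) has_integral S 1 - S 0) {0..1}"
  proof (rule fundamental_theorem_of_calculus_interior_strong[where S="{\<tau>}"])
    fix r assume r: "r \<in> {0<..<1} - {\<tau>}"
    then have nz: "\<tau> + r \<noteq> 0" "\<tau> - r \<noteq> 0" using assms by auto
    have d: "((\<lambda>r. \<tau> + r) has_real_derivative 1) (at r)" "((\<lambda>r. \<tau> - r) has_real_derivative -1) (at r)"
      by (auto intro!: derivative_eq_intros)
    from DERIV_chain2[where f="H \<tau>", OF dH[OF nz(1)] d(1)] DERIV_chain2[where f="H \<tau>", OF dH[OF nz(2)] d(2)]
    have "((\<lambda>r. H \<tau> (\<tau> + r)) has_real_derivative r * xlnx (\<tau> + r)) (at r)"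
      "((\<lambda>r. H \<tau> (\<tau> - r)) has_real_derivative r * xlnx (\<tau> - r)) (at r)"
      by simp_all
    then have "(S has_real_derivative 3 / 2 * (r * xlnx (\<tau> + r) - r * xlnx (\<tau> - r)) - 3 * r\<^sup>2) (at r)"
      unfolding S_def by (auto intro!: derivative_eq_intros)
    moreover have "3 / 2 * (r * xlnx (\<tau> + r) - r * xlnx (\<tau> - r)) - 3 * r\<^sup>2 = 3 * r\<^sup>2 * avg_log \<tau> r"
      using r by (simp add: avg_log_def field_simps power2_eq_square)
    ultimately show "(S has_vector_derivative 3 * r\<^sup>2 * avg_log \<tau> r) (at r)"
      by (simp add: has_real_derivative_iff_has_vector_derivative)
  qed (auto simp: S_def H_def intro!: continuous_intros)
  have "S 1 - S 0 \<le> 3 / 2 * \<tau>\<^sup>2 - 4 / 3"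
  proof (cases "\<tau> \<le> 1")
    case True
    let ?f = "\<lambda>t. 3 / 2 * t\<^sup>2 - 3 / 2 * (H t (t + 1) - H t (t - 1))"
    have "?f 0 \<le> ?f \<tau>"
    proof (rule DERIV_nonneg_imp_increasing_open[of 0 \<tau> ?f])
      fix x assume x: "0 < x" "x < \<tau>"
      define A where "A = ln (1 + x)"
      define B where "B = ln (1 - x)"
      have AB: "ln \<bar>x + 1\<bar> = A" "ln \<bar>1 + x\<bar> = A" "ln \<bar>x - 1\<bar> = B" using x True by (auto simp: A_def B_def abs_if add.commute)
      have nz: "x + 1 \<noteq> 0" "x - 1 \<noteq> 0" using x True by auto
      have "(?f has_real_derivative 3 * x - 3 / 4 * ((1 - x\<^sup>2) * (A - B) + 2 * x)) (at x)"
        unfolding H_def using nz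
        by (auto intro!: derivative_eq_intros simp: AB)
          (simp add: xlnx_def AB field_simps power2_eq_square power3_eq_cube)
      moreover have "3 * x - 3 / 4 * ((1 - x\<^sup>2) * (A - B) + 2 * x) \<ge> 0"
        using ln_ratio_upper[of x] x True by (simp add: A_def B_def)
      ultimately show "\<exists>y. (?f has_real_derivative y) (at x) \<and> 0 \<le> y" by blast
    qed (use assms in \<open>auto simp: H_def intro!: continuous_intros\<close>)
    \<comment> \<open>At \<open>\<tau> = 0\<close> the bound is an equality: 4/3 = 1 + 1/3 is the
      mean of 1 - ln r under 3 r^2 dr.\<close>
    moreover have "?f 0 = 1 / 3" by (simp add: H_def xlnx_def)
    ultimately show ?thesis by (simp add: S_def algebra_simps)
  next
    case False
    \<comment> \<open>For \<open>\<tau> > 1\<close> the singularity stays outside the range of r,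
      and Jensen's bound is already strong enough.\<close>
    have "((\<lambda>r. 3 * r\<^sup>2 * ln \<tau>) has_integral (\<lambda>r. r ^ 3 * ln \<tau>) 1 - (\<lambda>r. r ^ 3 * ln \<tau>) 0) {0..1}"
      by (intro fundamental_theorem_of_calculus)
        (auto simp flip: has_real_derivative_iff_has_vector_derivative intro!: derivative_eq_intros)
    then have up: "((\<lambda>r. 3 * r\<^sup>2 * ln \<tau>) has_integral ln \<tau>) {0..1}" by simp
    have le: "3 * r\<^sup>2 * avg_log \<tau> r \<le> 3 * r\<^sup>2 * ln \<tau>" if "r \<in> {0..1}" for r
      using that False avg_log_le_ln[of \<tau> r] by (cases "r = 0") (auto intro!: mult_left_mono)
    have "S 1 - S 0 \<le> ln \<tau>"
      by (rule has_integral_le[OF int up le])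
    also have "ln \<tau> \<le> \<tau> - 1" using False by (intro ln_le_minus_one) auto
    also have "\<tau> - 1 \<le> 3 / 2 * \<tau>\<^sup>2 - 4 / 3"
    proof -
      have "\<tau> * 1 \<le> \<tau> * \<tau>" using False by (intro mult_left_mono) auto
      then show ?thesis unfolding power2_eq_square using False by linarith
    qed
    finally show ?thesis .
  qed
  then show ?thesis using that int by blast
qed

text \<open>
  Reduction to \<open>m = 3\<close>: \<open>F(r) = u(\<tau>, r) - ln r\<close> is decreasing, and \<open>3 r\<^sup>2 - m r\<^sup>m\<^sup>-\<^sup>1\<close> has integral 0 and a
  single sign change, at \<open>r\<^sub>0\<close>; so \<open>(3 r\<^sup>2 - m r\<^sup>m\<^sup>-\<^sup>1)(F(r) - F(r\<^sub>0)) \<ge> 0\<close>.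
\<close>

lemma avg_log_ball_bound:
  assumes m: "m \<ge> 3" and "0 \<le> \<tau>"
  obtains G I where "(G has_integral I) {0..1}" "I \<le> 3 / 2 * \<tau>\<^sup>2 - 1 - 1 / real m"
    "\<And>r. r \<in> {0<..<1} \<Longrightarrow> real m * r ^ (m - 1) * avg_log \<tau> r \<le> G r"
proof -
  obtain P where P: "((\<lambda>r. 3 * r\<^sup>2 * avg_log \<tau> r) has_integral P) {0..1}" "P \<le> 3 / 2 * \<tau>\<^sup>2 - 4 / 3"
    using avg_log_ball3_integral[OF assms(2)] .
  define F where "F = (\<lambda>r. avg_log (\<tau> / r) 1)"
  have F_anti: "F r' \<le> F r" if "0 < r" "r \<le> r'" for r r'
    unfolding F_def using that assms by (intro avg_log_mono) (auto simp: divide_left_mono)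
  have F: "avg_log \<tau> r = ln r + F r" if "r > 0" for r
    unfolding F_def using that by (rule avg_log_normalize)
  obtain r0 where r0: "\<And>r. 0 < r \<Longrightarrow> r < 1 \<Longrightarrow>
      (3 * r\<^sup>2 - real m * r ^ (m - 1)) * (F r - F r0) \<ge> 0"
  proof (cases "m = 3")
    case True
    then show ?thesis using that[of 1] by simp
  next
    case False
    define r0 where "r0 = root (m - 3) (3 / m)"
    have m3: "m - 3 > 0" using m False by simp
    have r0: "r0 > 0" "real m * r0 ^ (m - 3) = 3"
      using m m3 by (auto simp: r0_def)
    show ?thesis
    proof (rule that[of r0])
      fix r :: real assume r: "0 < r" "r < 1"
      have pw: "r ^ (m - 1) = r\<^sup>2 * r ^ (m - 3)"
      proof -
        have "m - 1 = 2 + (m - 3)" using m m3 by simp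
        then show ?thesis by (simp only: power_add)
      qed
      then have e: "3 * r\<^sup>2 - real m * r ^ (m - 1) = r\<^sup>2 * (real m * r0 ^ (m - 3) - real m * r ^ (m - 3))"
        by (simp add: r0 algebra_simps)
      show "(3 * r\<^sup>2 - real m * r ^ (m - 1)) * (F r - F r0) \<ge> 0"
      proof (cases "r \<le> r0")
        case True
        then have "r ^ (m - 3) \<le> r0 ^ (m - 3)" using r by (intro power_mono) auto
        then show ?thesis unfolding e using F_anti[OF r(1) True]
          by (intro mult_nonneg_nonneg) (auto intro!: mult_left_mono)
      next
        case False
        then have "r0 ^ (m - 3) \<le> r ^ (m - 3)" using r0 by (intro power_mono) auto
        then show ?thesis unfolding e using F_anti[OF r0(1), of r] False
          by (intro mult_nonpos_nonpos mult_nonneg_nonpos) (auto intro!: mult_left_mono)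
      qed
    qed
  qed
  \<comment> \<open>Since \<open>avg_log \<tau> r\<close> is ln r + \<open>F r\<close>, the sign
    relation bounds the integrand for \<open>m\<close> by \<open>a\<close> plus the integrand for 3.
    Here \<open>a\<close> is explicit: its \<open>F r0\<close> term integrates to 0 and its
    logarithmic terms to 1/3 - 1/m, which turns -4/3 into -1 - 1/m.\<close>
  define A where "A = (\<lambda>r. r ^ (m - 1) * xlnx r - r ^ m / m - r\<^sup>2 * xlnx r + r ^ 3 / 3 + F r0 * (r ^ m - r ^ 3))"
  define a where "a = (\<lambda>r. real m * r ^ (m - 1) * ln r - 3 * r\<^sup>2 * ln r + F r0 * (real m * r ^ (m - 1) - 3 * r\<^sup>2))"
  have "(a has_integral A 1 - A 0) {0..1}"
  proof (rule fundamental_theorem_of_calculus_interior_strong[where S="{}"])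
    fix r :: real assume r: "r \<in> {0<..<1} - {}"
    have mk: "m - 1 = Suc (m - 2)" using m by simp
    have d1: "((\<lambda>r. r ^ (m - 1) * xlnx r) has_real_derivative
        real (m - 1) * r ^ (m - 2) * xlnx r + (ln \<bar>r\<bar> + 1) * r ^ (m - 1)) (at r)"
      using r mk DERIV_mult[OF DERIV_pow[of "m - 1" r UNIV] xlnx_deriv[of r]] by simp
    have d2: "((\<lambda>r. r ^ m / m) has_real_derivative r ^ (m - 1)) (at r)"
      using DERIV_cdivide[OF DERIV_pow[of m r UNIV], of "real m"] m by simp
    have d3: "((\<lambda>r. r\<^sup>2 * xlnx r) has_real_derivative 2 * r * xlnx r + (ln \<bar>r\<bar> + 1) * r\<^sup>2) (at r)"
      using r DERIV_mult[OF DERIV_pow[of 2 r UNIV] xlnx_deriv[of r]] by simp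
    have d4: "((\<lambda>r. r ^ 3 / 3) has_real_derivative r\<^sup>2) (at r)"
      using DERIV_cdivide[OF DERIV_pow[of 3 r UNIV], of 3] by simp
    have d5: "((\<lambda>r. r ^ m - r ^ 3) has_real_derivative real m * r ^ (m - 1) - 3 * r\<^sup>2) (at r)"
      using DERIV_diff[OF DERIV_pow[of m r UNIV] DERIV_pow[of 3 r UNIV]] by simp
    have "(A has_real_derivative (((real (m - 1) * r ^ (m - 2) * xlnx r + (ln \<bar>r\<bar> + 1) * r ^ (m - 1)) - r ^ (m - 1)
        - (2 * r * xlnx r + (ln \<bar>r\<bar> + 1) * r\<^sup>2)) + r\<^sup>2) + F r0 * (real m * r ^ (m - 1) - 3 * r\<^sup>2)) (at r)"
      unfolding A_def by (intro DERIV_add DERIV_diff DERIV_cmult d1 d2 d3 d4 d5)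
    also have "real (m - 1) * r ^ (m - 2) * xlnx r = (real m - 1) * r ^ (m - 1) * ln r"
    proof -
      have e: "r ^ (m - 1) = r ^ (m - 2) * r" using mk by (metis power_Suc2)
      show ?thesis unfolding e using r m by (simp add: xlnx_def of_nat_diff)
    qed
    also have "(((real m - 1) * r ^ (m - 1) * ln r + (ln \<bar>r\<bar> + 1) * r ^ (m - 1)) - r ^ (m - 1)
        - (2 * r * xlnx r + (ln \<bar>r\<bar> + 1) * r\<^sup>2)) + r\<^sup>2 + F r0 * (real m * r ^ (m - 1) - 3 * r\<^sup>2) = a r"
      using r by (simp add: a_def xlnx_def algebra_simps power2_eq_square)
    finally have "(A has_real_derivative a r) (at r)" .
    then show "(A has_vector_derivative a r) (at r)"
      by (simp add: has_real_derivative_iff_has_vector_derivative)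
  qed (use m in \<open>auto simp: A_def intro!: continuous_intros\<close>)
  then have "((\<lambda>r. a r + 3 * r\<^sup>2 * avg_log \<tau> r) has_integral A 1 - A 0 + P) {0..1}"
    using P(1) by (rule has_integral_add)
  moreover have "A 1 - A 0 + P \<le> 3 / 2 * \<tau>\<^sup>2 - 1 - 1 / real m"
    using P(2) m by (simp add: A_def xlnx_def zero_power)
  moreover have "real m * r ^ (m - 1) * avg_log \<tau> r \<le> a r + 3 * r\<^sup>2 * avg_log \<tau> r"
    if "r \<in> {0<..<1}" for r
    using r0[of r] that F[of r] by (simp add: a_def algebra_simps)
  ultimately show ?thesis using that by blast
qed

text \<open>Spares a proof that \<open>f\<close> is integrable: if its integral is infinite there is
  nothing to show, and otherwise both sides are gauge integrals. The minorant \<open>g\<close> may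
  take negative values.\<close>

lemma nn_integral_ge_has_integral:
  fixes f g :: "real \<Rightarrow> real"
  assumes [measurable]: "f \<in> borel_measurable borel"
    and f: "\<And>x. x \<in> {a<..<b} \<Longrightarrow> 0 \<le> f x" and g: "\<And>x. x \<in> {a<..<b} \<Longrightarrow> g x \<le> f x"
    and I: "(g has_integral I) {a..b}"
  shows "ennreal I \<le> (\<integral>\<^sup>+x. ennreal (f x) * indicator {a<..<b} x \<partial>lborel)"
proof (cases "(\<integral>\<^sup>+x. ennreal (f x) * indicator {a<..<b} x \<partial>lborel) = \<infinity>")
  case False
  let ?F = "\<lambda>x. f x * indicator {a<..<b} x"
  have nn: "(\<integral>\<^sup>+x. ennreal (f x) * indicator {a<..<b} x \<partial>lborel) = (\<integral>\<^sup>+x. ennreal (?F x) \<partial>lborel)"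
    by (intro nn_integral_cong) (auto split: split_indicator)
  have F0: "0 \<le> ?F x" for x using f by (auto split: split_indicator)
  have int: "integrable lborel ?F"
    using False F0 by (intro integrableI_nonneg) (auto simp: nn less_top)
  then have "(?F has_integral integral\<^sup>L lborel ?F) UNIV"
    by (rule has_integral_integral_lborel)
  then have "(f has_integral integral\<^sup>L lborel ?F) {a<..<b}"
    by (subst has_integral_restrict_UNIV[symmetric])
      (simp add: indicator_def if_distrib of_bool_def cong: if_cong)
  moreover have "(g has_integral I) {a<..<b}"
    using I by (simp add: has_integral_Icc_iff_Ioo)
  ultimately have "I \<le> integral\<^sup>L lborel ?F"
    using has_integral_le g by blast
  moreover have "(\<integral>\<^sup>+x. ennreal (?F x) \<partial>lborel) = ennreal (integral\<^sup>L lborel ?F)"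
    using int F0 by (intro nn_integral_eq_integral) auto
  ultimately show ?thesis by (simp add: nn ennreal_leI)
qed auto

section \<open>The rim against the whole cylinder\<close>

text \<open>
  Layer cake: the superlevel sets of the weight are symmetric intervals.
\<close>

lemma unimodal_weight_mono:
  fixes p q :: "real \<Rightarrow> ennreal"
  assumes [measurable]: "p \<in> borel_measurable borel" "q \<in> borel_measurable borel"
    and le: "\<And>l. 0 < l \<Longrightarrow> l \<le> 1 \<Longrightarrow>
      (\<integral>\<^sup>+v. indicator {-1..1} v * p (l * v) \<partial>lborel) \<le> (\<integral>\<^sup>+v. indicator {-1..1} v * q (l * v) \<partial>lborel)"
  shows "(\<integral>\<^sup>+v. ennreal (sqrt (1 - v\<^sup>2) ^ j) * indicator {-1..1} v * p v \<partial>lborel) \<le>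
    (\<integral>\<^sup>+v. ennreal (sqrt (1 - v\<^sup>2) ^ j) * indicator {-1..1} v * q v \<partial>lborel)"
proof -
  define w where "w = (\<lambda>v::real. sqrt (1 - v\<^sup>2) ^ j)"
  have [measurable]: "w \<in> borel_measurable borel" unfolding w_def by measurable
  have w01: "0 \<le> w v" "w v \<le> 1" if "v \<in> {-1..1}" for v
  proof -
    have "v\<^sup>2 \<le> 1" using that by (simp add: abs_square_le_1 abs_le_iff)
    then show "0 \<le> w v" "w v \<le> 1" by (auto simp: w_def intro!: power_le_one)
  qed
  have layer: "(\<integral>\<^sup>+v. ennreal (w v) * indicator {-1..1} v * f v \<partial>lborel) =
      (\<integral>\<^sup>+\<theta>. indicator {0<..<1} \<theta> * (\<integral>\<^sup>+v. of_bool (\<theta> < w v) * indicator {-1..1} v * f v \<partial>lborel) \<partial>lborel)"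
    if [measurable]: "f \<in> borel_measurable borel" for f :: "real \<Rightarrow> ennreal"
  proof -
    have "(\<integral>\<^sup>+v. ennreal (w v) * indicator {-1..1} v * f v \<partial>lborel) =
      (\<integral>\<^sup>+v. \<integral>\<^sup>+\<theta>. indicator {0<..<1} \<theta> * (of_bool (\<theta> < w v) * indicator {-1..1} v * f v) \<partial>lborel \<partial>lborel)"
    proof (rule nn_integral_cong)
      fix v :: real
      show "ennreal (w v) * indicator {-1..1} v * f v =
        (\<integral>\<^sup>+\<theta>. indicator {0<..<1} \<theta> * (of_bool (\<theta> < w v) * indicator {-1..1} v * f v) \<partial>lborel)"
      proof (cases "v \<in> {-1..1}")
        case True
        have "(\<integral>\<^sup>+\<theta>. indicator {0<..<1} \<theta> * (of_bool (\<theta> < w v) * indicator {-1..1} v * f v) \<partial>lborel) =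
          (\<integral>\<^sup>+\<theta>. f v * indicator {0<..<min 1 (w v)} \<theta> \<partial>lborel)"
          using True by (intro nn_integral_cong) (auto simp: indicator_def)
        also have "\<dots> = f v * ennreal (w v)"
          using w01[OF True] by (subst nn_integral_cmult_indicator) (auto simp: min_def)
        finally show ?thesis using True by (simp add: mult.commute)
      qed simp
    qed
    also have "\<dots> = (\<integral>\<^sup>+\<theta>. \<integral>\<^sup>+v. indicator {0<..<1} \<theta> * (of_bool (\<theta> < w v) * indicator {-1..1} v * f v) \<partial>lborel \<partial>lborel)"
      by (rule lborel_pair.Fubini') measurable
    finally show ?thesis by (simp add: nn_integral_cmult)
  qed
  have slice: "\<exists>l. 0 < l \<and> l \<le> 1 \<and> (\<forall>f\<in>borel_measurable borel.
      (\<integral>\<^sup>+v. of_bool (\<theta> < w v) * indicator {-1..1} v * f v \<partial>lborel) =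
      ennreal l * (\<integral>\<^sup>+v. indicator {-1..1} v * f (l * v) \<partial>lborel))" if \<theta>: "0 < \<theta>" "\<theta> < 1" for \<theta>
  proof -
    \<comment> \<open>The superlevel set is open when \<open>j > 0\<close>, hence the exemption of
      the endpoints, which are null.\<close>
    obtain l where l: "0 < l" "l \<le> 1" "\<And>v. \<bar>v\<bar> \<noteq> l \<Longrightarrow> (\<theta> < w v \<and> v \<in> {-1..1}) \<longleftrightarrow> v \<in> {-l..l}"
    proof (cases "j = 0")
      case True
      \<comment> \<open>Exponent 0 is the case m = 3: the weight is constant and the superlevel set
        is all of [-1, 1].\<close>
      show ?thesis by (rule that[of 1]) (use True \<theta> in \<open>auto simp: w_def\<close>)
    next
      case False
      define z where "z = root j \<theta>"
      have z: "0 < z" "z < 1" "z ^ j = \<theta>" using False \<theta> by (auto simp: z_def)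
      define l where "l = sqrt (1 - z\<^sup>2)"
      have z2: "z\<^sup>2 < 1" using z by (simp add: abs_square_less_1)
      have l: "0 < l" "l \<le> 1" "l\<^sup>2 = 1 - z\<^sup>2" using z2 by (auto simp: l_def)
      show ?thesis
      proof (rule that[of l])
        fix v :: real assume v: "\<bar>v\<bar> \<noteq> l"
        show "(\<theta> < w v \<and> v \<in> {-1..1}) \<longleftrightarrow> v \<in> {-l..l}"
        proof (cases "v \<in> {-1..1}")
          case True
          then have v1: "v\<^sup>2 \<le> 1" by (simp add: abs_square_le_1 abs_le_iff)
          have "\<theta> < w v \<longleftrightarrow> z < sqrt (1 - v\<^sup>2)"
            unfolding w_def z(3)[symmetric] using False z v1
            by (auto intro: power_strict_mono power_less_imp_less_base)
          also have "\<dots> \<longleftrightarrow> z\<^sup>2 < 1 - v\<^sup>2"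
            using z real_less_rsqrt real_sqrt_less_iff[of "z\<^sup>2" "1 - v\<^sup>2"] by simp
          also have "\<dots> \<longleftrightarrow> \<bar>v\<bar>\<^sup>2 < l\<^sup>2" using l by auto
          also have "\<dots> \<longleftrightarrow> \<bar>v\<bar> < l" using abs_le_square_iff[of l v] l(1) by (auto simp flip: not_le)
          also have "\<dots> \<longleftrightarrow> v \<in> {-l..l}" using v by auto
          finally show ?thesis using True by simp
        next
          case False
          then show ?thesis using l by auto
        qed
      qed (use l in auto)
    qed
    have "(\<integral>\<^sup>+v. of_bool (\<theta> < w v) * indicator {-1..1} v * f v \<partial>lborel) =
      ennreal l * (\<integral>\<^sup>+v. indicator {-1..1} v * f (l * v) \<partial>lborel)"
      if [measurable]: "f \<in> borel_measurable borel" for f :: "real \<Rightarrow> ennreal"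
    proof -
      have "AE v in lborel. v \<noteq> l" "AE v in lborel. v \<noteq> - l" by (rule AE_lborel_singleton)+
      then have "AE v in lborel. of_bool (\<theta> < w v) * indicator {-1..1} v * f v = indicator {-l..l} v * f v"
      proof eventually_elim
        case (elim v)
        then have "\<bar>v\<bar> \<noteq> l" using l by auto
        from l(3)[OF this] show ?case by (auto simp: indicator_def)
      qed
      then have "(\<integral>\<^sup>+v. of_bool (\<theta> < w v) * indicator {-1..1} v * f v \<partial>lborel) =
        (\<integral>\<^sup>+v. indicator {-l..l} v * f v \<partial>lborel)"
        by (rule nn_integral_cong_AE)
      also have "\<dots> = \<bar>l\<bar> * (\<integral>\<^sup>+v. indicator {-l..l} (0 + l * v) * f (0 + l * v) \<partial>lborel)"
        using l by (intro nn_integral_real_affine) auto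
      also have "\<dots> = ennreal l * (\<integral>\<^sup>+v. indicator {-1..1} v * f (l * v) \<partial>lborel)"
      proof -
        have "l * v \<in> {-l..l} \<longleftrightarrow> v \<in> {-1..1}" for v
          using l mult_le_cancel_left_pos[of l v 1] mult_le_cancel_left_pos[of l "-1" v] by auto
        then show ?thesis using l by (simp add: indicator_def)
      qed
      finally show ?thesis .
    qed
    then show ?thesis using l by blast
  qed
  have "(\<integral>\<^sup>+v. ennreal (w v) * indicator {-1..1} v * p v \<partial>lborel) \<le> (\<integral>\<^sup>+v. ennreal (w v) * indicator {-1..1} v * q v \<partial>lborel)"
    unfolding layer[OF assms(1)] layer[OF assms(2)]
  proof (rule nn_integral_mono)
    fix \<theta> :: real
    show "indicator {0<..<1} \<theta> * (\<integral>\<^sup>+v. of_bool (\<theta> < w v) * indicator {-1..1} v * p v \<partial>lborel) \<le>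
      indicator {0<..<1} \<theta> * (\<integral>\<^sup>+v. of_bool (\<theta> < w v) * indicator {-1..1} v * q v \<partial>lborel)"
    proof (cases "0 < \<theta> \<and> \<theta> < 1")
      case True
      then obtain l where "0 < l" "l \<le> 1" and eq: "\<And>f. f \<in> borel_measurable borel \<Longrightarrow>
        (\<integral>\<^sup>+v. of_bool (\<theta> < w v) * indicator {-1..1} v * f v \<partial>lborel) =
        ennreal l * (\<integral>\<^sup>+v. indicator {-1..1} v * f (l * v) \<partial>lborel)"
        using slice by blast
      then show ?thesis using le by (simp add: eq mult_left_mono)
    qed (auto simp: indicator_def)
  qed
  then show ?thesis by (simp add: w_def)
qed

section \<open>Integrals over cross sections in the coordinates t and r\<close>

lemma ln_abs_le: "\<bar>z\<bar> \<le> N \<Longrightarrow> ln \<bar>z\<bar> \<le> (N::real)"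
  by (cases "z = 0") (auto intro: order_trans[OF ln_le_minus_one])

lemma abs_combination_le:
  fixes a b s t :: real
  assumes "0 \<le> a" "0 \<le> b" "\<bar>t\<bar> \<le> 1" "\<bar>s\<bar> \<le> 1"
  shows "\<bar>a * t + b * s\<bar> \<le> a + b"
proof -
  have "a * \<bar>t\<bar> \<le> a * 1" "b * \<bar>s\<bar> \<le> b * 1"
    using assms by (auto simp only: intro!: mult_left_mono)
  then show ?thesis
    using abs_triangle_ineq[of "a * t" "b * s"] assms by (simp add: abs_mult)
qed

lemma avg_log_le:
  assumes "0 \<le> \<tau>" "0 \<le> \<beta>" "\<tau> + \<beta> \<le> N"
  shows "avg_log \<tau> \<beta> \<le> N"
proof -
  have "2 * avg_log \<tau> \<beta> \<le> N * 2"
  proof (rule has_integral_le)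
    show "((\<lambda>v. ln \<bar>\<tau> + \<beta> * v\<bar>) has_integral 2 * avg_log \<tau> \<beta>) {-1..1}"
      using assms by (intro has_integral_avg_log) auto
    show "((\<lambda>v. N) has_integral N * 2) {-1..(1::real)}"
      using has_integral_const_real[of N "-1" 1] by (simp add: mult.commute)
    show "ln \<bar>\<tau> + \<beta> * v\<bar> \<le> N" if "v \<in> {-1..1}" for v
      using abs_combination_le[of \<tau> \<beta> 1 v] that assms by (intro ln_abs_le) (auto simp: abs_le_iff)
  qed
  then show ?thesis by simp
qed

lemma nn_integral_power_unit:
  assumes m: "m \<ge> 1"
  shows "(\<integral>\<^sup>+r. ennreal (r ^ (m - 1)) * indicator {0<..1} r \<partial>lborel) = ennreal (1 / m)"
proof -
  have "(\<integral>\<^sup>+r. ennreal (r ^ (m - 1)) * indicator {0<..1} r \<partial>lborel) = (\<integral>\<^sup>+r. ennreal (r ^ (m - 1)) * indicator {0..1} r \<partial>lborel)"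
    using AE_lborel_singleton[of "0::real"]
    by (intro nn_integral_cong_AE) (auto elim!: eventually_mono simp: indicator_def)
  also have "\<dots> = ennreal (1 ^ m / m - 0 ^ m / m)"
    using m by (intro nn_integral_FTC_Icc) (auto intro!: derivative_eq_intros)
  finally show ?thesis using m by (simp add: zero_power)
qed

text \<open>
  Here \<open>t\<close> is the axial coordinate and \<open>r\<close> the distance from the axis. The constant \<open>N\<close> keeps the
  integrand nonnegative, so that \<open>ennreal\<close> integrals lose nothing.
\<close>

definition shell :: "real \<Rightarrow> real \<Rightarrow> nat \<Rightarrow> (real \<times> real) set \<Rightarrow> real \<Rightarrow> ennreal" where
  "shell N a k S \<beta> = (\<integral>\<^sup>+t. \<integral>\<^sup>+r. ennreal (r ^ k) * indicator {0<..1} r * indicator S (t, r) *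
     ennreal (N - ln \<bar>a * t + \<beta> * r\<bar>) \<partial>lborel \<partial>lborel)"

text \<open>Up to factors that do not depend on \<open>S\<close>, the volume of the body of
  revolution with cross section \<open>S\<close>.\<close>

definition shell_mass :: "nat \<Rightarrow> (real \<times> real) set \<Rightarrow> ennreal" where
  "shell_mass k S = (\<integral>\<^sup>+t. \<integral>\<^sup>+r. ennreal (r ^ k) * indicator {0<..1} r * indicator S (t, r) \<partial>lborel \<partial>lborel)"

lemma shell_measurable [measurable]:
  assumes [measurable]: "S \<in> sets borel"
  shows "shell N a k S \<in> borel_measurable borel"
  unfolding shell_def by measurable

text \<open>By Tonelli the integral over \<open>v\<close> can be done innermost, where it closes up
  to \<open>avg_log\<close>. The bound on \<open>N\<close> ensures that \<open>ennreal\<close> never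
  truncates a negative value.\<close>

lemma shell_swap:
  assumes S [measurable]: "S \<in> sets borel" and b: "0 \<le> a" "0 \<le> b" "a + b \<le> N" and S1: "S \<subseteq> {-1..1} \<times> UNIV"
  shows "(\<integral>\<^sup>+v. indicator {-1..1} v * shell N a k S (b * v) \<partial>lborel) =
    (\<integral>\<^sup>+t. \<integral>\<^sup>+r. ennreal (r ^ k) * indicator {0<..1} r * indicator S (t, r) *
      ennreal (2 * (N - avg_log (a * t) (b * r))) \<partial>lborel \<partial>lborel)"
proof -
  let ?g = "\<lambda>v t r. ennreal (r ^ k) * indicator {0<..1} r * indicator S (t, r) * (ennreal (N - ln \<bar>a * t + b * r * v\<bar>) * indicator {-1..1} v)"
  have "(\<integral>\<^sup>+v. indicator {-1..1} v * shell N a k S (b * v) \<partial>lborel) =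
    (\<integral>\<^sup>+v. \<integral>\<^sup>+t. \<integral>\<^sup>+r. ?g v t r \<partial>lborel \<partial>lborel \<partial>lborel)"
  proof (rule nn_integral_cong)
    fix v :: real
    have "(\<integral>\<^sup>+t. \<integral>\<^sup>+r. ?g v t r \<partial>lborel \<partial>lborel) =
      (\<integral>\<^sup>+t. \<integral>\<^sup>+r. indicator {-1..1} v * (ennreal (r ^ k) * indicator {0<..1} r * indicator S (t, r) *
         ennreal (N - ln \<bar>a * t + b * v * r\<bar>)) \<partial>lborel \<partial>lborel)"
      by (intro nn_integral_cong) (simp add: mult_ac)
    then show "indicator {-1..1} v * shell N a k S (b * v) = (\<integral>\<^sup>+t. \<integral>\<^sup>+r. ?g v t r \<partial>lborel \<partial>lborel)"
      by (simp add: shell_def nn_integral_cmult)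
  qed
  also have "\<dots> = (\<integral>\<^sup>+t. \<integral>\<^sup>+v. \<integral>\<^sup>+r. ?g v t r \<partial>lborel \<partial>lborel \<partial>lborel)"
    by (rule lborel_pair.Fubini') measurable
  also have "\<dots> = (\<integral>\<^sup>+t. \<integral>\<^sup>+r. \<integral>\<^sup>+v. ?g v t r \<partial>lborel \<partial>lborel \<partial>lborel)"
    by (intro nn_integral_cong lborel_pair.Fubini') measurable
  also have "\<dots> = (\<integral>\<^sup>+t. \<integral>\<^sup>+r. ennreal (r ^ k) * indicator {0<..1} r * indicator S (t, r) *
      ennreal (2 * (N - avg_log (a * t) (b * r))) \<partial>lborel \<partial>lborel)"
  proof (intro nn_integral_cong)
    fix t r :: real
    show "(\<integral>\<^sup>+v. ?g v t r \<partial>lborel) = ennreal (r ^ k) * indicator {0<..1} r * indicator S (t, r) *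
      ennreal (2 * (N - avg_log (a * t) (b * r)))"
    proof (cases "0 < r \<and> r \<le> 1 \<and> (t, r) \<in> S")
      case True
      then have t: "\<bar>t\<bar> \<le> 1" using S1 by (auto simp: abs_le_iff)
      have "ln \<bar>a * t + b * r * v\<bar> \<le> N" if "v \<in> {-1..1}" for v
      proof (rule ln_abs_le)
        have "\<bar>r * v\<bar> \<le> 1" using True that by (auto simp: abs_mult abs_le_iff intro!: mult_le_one)
        then show "\<bar>a * t + b * r * v\<bar> \<le> N"
          using abs_combination_le[of a b t "r * v"] t b by (simp add: mult.assoc)
      qed
      then have "(\<integral>\<^sup>+v. ennreal (N - ln \<bar>a * t + b * r * v\<bar>) * indicator {-1..1} v \<partial>lborel) =
        ennreal (2 * (N - avg_log (a * t) (b * r)))"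
        using True b by (intro nn_integral_avg_log) auto
      then show ?thesis by (simp add: nn_integral_cmult)
    qed (auto simp: indicator_def)
  qed
  finally show ?thesis .
qed

text \<open>\<open>avg_log\<close> is not monotone in its second argument, so \<open>r\<close> is
  scaled out: what is left is ln r \<ge> ln \<open>\<eta>\<close> and a first argument a|t|/r \<ge>
  \<open>\<eta> * a\<close>, in which \<open>avg_log\<close> is monotone.\<close>

lemma shell_rim_le:
  assumes S [measurable]: "S \<in> sets borel" and b: "0 \<le> a" "0 \<le> b" "0 < a + b" "a + b \<le> N"
    and \<eta>: "0 < \<eta>" "\<eta> \<le> 1"
    and S1: "\<And>t r. (t, r) \<in> S \<Longrightarrow> \<bar>t\<bar> \<le> 1 \<and> \<eta> \<le> \<bar>t\<bar> \<and> \<eta> \<le> r"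
  shows "(\<integral>\<^sup>+v. indicator {-1..1} v * shell N a k S (b * v) \<partial>lborel) \<le>
    ennreal (2 * (N - avg_log (\<eta> * a) b - ln \<eta>)) * shell_mass k S"
proof -
  have "(\<integral>\<^sup>+v. indicator {-1..1} v * shell N a k S (b * v) \<partial>lborel) \<le>
    (\<integral>\<^sup>+t. \<integral>\<^sup>+r. ennreal (2 * (N - avg_log (\<eta> * a) b - ln \<eta>)) *
      (ennreal (r ^ k) * indicator {0<..1} r * indicator S (t, r)) \<partial>lborel \<partial>lborel)"
  proof (subst shell_swap)
    show "S \<subseteq> {- 1..1} \<times> UNIV" using S1 by (auto simp: abs_le_iff)
    show "(\<integral>\<^sup>+t. \<integral>\<^sup>+r. ennreal (r ^ k) * indicator {0<..1} r * indicator S (t, r) *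
        ennreal (2 * (N - avg_log (a * t) (b * r))) \<partial>lborel \<partial>lborel) \<le>
      (\<integral>\<^sup>+t. \<integral>\<^sup>+r. ennreal (2 * (N - avg_log (\<eta> * a) b - ln \<eta>)) *
      (ennreal (r ^ k) * indicator {0<..1} r * indicator S (t, r)) \<partial>lborel \<partial>lborel)"
    proof (intro nn_integral_mono)
      fix t r :: real
      have "N - avg_log (a * t) (b * r) \<le> N - avg_log (\<eta> * a) b - ln \<eta>"
        if "0 < r" "r \<le> 1" "(t, r) \<in> S"
      proof -
        have tr: "\<eta> \<le> \<bar>t\<bar>" "\<eta> \<le> r" using S1 that by auto
        have "avg_log (a * t) (b * r) = avg_log (r * (a * \<bar>t\<bar> / r)) (r * b)"
          using avg_log_abs[of "a * t" "b * r"] b that by (simp add: abs_mult mult.commute)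
        also have "\<dots> = ln r + avg_log (a * \<bar>t\<bar> / r) b"
          using b that tr \<eta> by (intro avg_log_scale) auto
        also have "\<dots> \<ge> ln \<eta> + avg_log (\<eta> * a) b"
        proof (rule add_mono)
          show "ln \<eta> \<le> ln r" using tr \<eta> by simp
          have "\<eta> * r \<le> \<bar>t\<bar> * 1" using tr \<eta> that by (intro mult_mono) auto
          then have "a * (\<eta> * r) \<le> a * (\<bar>t\<bar> * 1)" using b by (intro mult_left_mono) auto
          then have "\<eta> * a \<le> a * \<bar>t\<bar> / r"
            using that by (simp add: pos_le_divide_eq mult_ac)
          moreover have "0 < \<eta> * a \<or> 0 < b" using b \<eta> by (cases "a = 0") auto
          ultimately show "avg_log (\<eta> * a) b \<le> avg_log (a * \<bar>t\<bar> / r) b"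
            using b \<eta> by (intro avg_log_mono) auto
        qed
        finally show ?thesis by simp
      qed
      then have "ennreal (2 * (N - avg_log (a * t) (b * r))) \<le> ennreal (2 * (N - avg_log (\<eta> * a) b - ln \<eta>))"
        if "0 < r" "r \<le> 1" "(t, r) \<in> S"
        using that by (intro ennreal_leI mult_left_mono) auto
      from mult_left_mono[OF this, of "ennreal (r ^ k)"]
      show "ennreal (r ^ k) * indicator {0<..1} r * indicator S (t, r) *
        ennreal (2 * (N - avg_log (a * t) (b * r))) \<le>
        ennreal (2 * (N - avg_log (\<eta> * a) b - ln \<eta>)) *
      (ennreal (r ^ k) * indicator {0<..1} r * indicator S (t, r))"
        by (cases "0 < r \<and> r \<le> 1 \<and> (t, r) \<in> S") (auto simp: indicator_def mult.commute)
    qed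
  qed (use b in auto)
  also have "\<dots> = ennreal (2 * (N - avg_log (\<eta> * a) b - ln \<eta>)) * shell_mass k S"
    unfolding shell_mass_def by (simp add: nn_integral_cmult)
  finally show ?thesis .
qed

lemma avg_log_measurable [measurable]:
  assumes [measurable]: "f \<in> borel_measurable M" "g \<in> borel_measurable M"
  shows "(\<lambda>x. avg_log (f x) (g x)) \<in> borel_measurable M"
  unfolding avg_log_def xlnx_def by measurable

text \<open>Each slice at height \<open>t\<close> is a ball average with \<open>\<tau>\<close> =
  a|t|/b. As t^2 has mean 1/3, the term 3/2 \<open>\<tau>\<close>^2 averages to (a/b)^2/2, the
  quadratic term of \<open>avg_log_lower\<close>. The factor 4/m is the total mass in
  \<open>t\<close>, \<open>r\<close> and \<open>v\<close>.\<close>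

lemma shell_full_ge_near:
  assumes m: "m \<ge> 3" and b: "0 \<le> a" "0 < b" "a + b \<le> N"
  shows "ennreal (4 / m * (N - ln b + 1 + 1 / m - (a / b)\<^sup>2 / 2)) \<le>
    (\<integral>\<^sup>+v. indicator {-1..1} v * shell N a (m - 1) ({-1..1} \<times> UNIV) (b * v) \<partial>lborel)"
proof -
  define c where "c = N - ln b + 1 + 1 / m"
  define h where "h = (\<lambda>t. 2 / m * (c - 3 / 2 * (a / b)\<^sup>2 * t\<^sup>2))"
  have row: "ennreal (h t) \<le> (\<integral>\<^sup>+r. ennreal (2 * r ^ (m - 1) * (N - avg_log (a * t) (b * r))) * indicator {0<..<1} r \<partial>lborel)"
    if t: "\<bar>t\<bar> \<le> 1" for t
  proof -
    define \<tau> where "\<tau> = a / b * \<bar>t\<bar>"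
    have "0 \<le> \<tau>" using b by (simp add: \<tau>_def)
    then obtain G I where G: "(G has_integral I) {0..1}" "I \<le> 3 / 2 * \<tau>\<^sup>2 - 1 - 1 / real m"
      "\<And>r. r \<in> {0<..<1} \<Longrightarrow> real m * r ^ (m - 1) * avg_log \<tau> r \<le> G r"
      using avg_log_ball_bound[OF m] by blast
    have scale: "avg_log (a * t) (b * r) = ln b + avg_log \<tau> r" if "r > 0" for r
    proof -
      have "avg_log (a * t) (b * r) = avg_log (b * \<tau>) (b * r)"
        using b avg_log_abs[of "a * t" "b * r"] by (simp add: \<tau>_def abs_mult)
      then show ?thesis using b that by (simp add: avg_log_scale)
    qed
    have nn: "0 \<le> 2 * r ^ (m - 1) * (N - avg_log (a * t) (b * r))" if r: "r \<in> {0<..<1}" for r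
    proof -
      have "avg_log \<bar>a * t\<bar> (b * r) \<le> N"
      proof (rule avg_log_le)
        have "a * \<bar>t\<bar> \<le> a * 1" "b * r \<le> b * 1"
          using b t r by (auto simp only: greaterThanLessThan_iff intro!: mult_left_mono)
        moreover have "\<bar>a * t\<bar> = a * \<bar>t\<bar>" using b by (simp add: abs_mult)
        ultimately show "\<bar>a * t\<bar> + b * r \<le> N" using b by linarith
      qed (use b r in auto)
      then have "avg_log (a * t) (b * r) \<le> N" by (simp only: avg_log_abs)
      then show ?thesis using r by simp
    qed
    have pint: "((\<lambda>r. real m * r ^ (m - 1)) has_integral 1) {0..1}"
    proof -
      have "((\<lambda>r. real m * r ^ (m - 1)) has_integral (\<lambda>r::real. r ^ m) 1 - (\<lambda>r. r ^ m) 0) {0..1}"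
        by (intro fundamental_theorem_of_calculus)
          (auto simp flip: has_real_derivative_iff_has_vector_derivative intro!: derivative_eq_intros)
      then show ?thesis using m by (simp add: zero_power)
    qed
    have "((\<lambda>r. 2 / m * ((N - ln b) * (real m * r ^ (m - 1)) - G r)) has_integral 2 / m * ((N - ln b) * 1 - I)) {0..1}"
      by (intro has_integral_mult_right has_integral_diff pint G(1))
    then have "ennreal (2 / m * ((N - ln b) * 1 - I)) \<le>
      (\<integral>\<^sup>+r. ennreal (2 * r ^ (m - 1) * (N - avg_log (a * t) (b * r))) * indicator {0<..<1} r \<partial>lborel)"
    proof (rule nn_integral_ge_has_integral[rotated 3])
      fix r :: real assume r: "r \<in> {0<..<1}"
      then have "(N - ln b) * (real m * r ^ (m - 1)) - G r \<le> real m * r ^ (m - 1) * (N - ln b - avg_log \<tau> r)"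
        using G(3)[of r] by (simp add: algebra_simps)
      then have "2 / m * ((N - ln b) * (real m * r ^ (m - 1)) - G r) \<le> 2 / m * (real m * r ^ (m - 1) * (N - ln b - avg_log \<tau> r))"
        by (intro mult_left_mono) auto
      also have "\<dots> = 2 * r ^ (m - 1) * (N - (ln b + avg_log \<tau> r))"
        using m by (simp add: diff_diff_eq)
      finally show "2 / m * ((N - ln b) * (real m * r ^ (m - 1)) - G r) \<le> 2 * r ^ (m - 1) * (N - avg_log (a * t) (b * r))"
        using r by (simp only: scale greaterThanLessThan_iff)
    qed (use nn in auto)
    moreover have "h t \<le> 2 / m * ((N - ln b) * 1 - I)"
    proof -
      have "\<tau>\<^sup>2 = (a / b)\<^sup>2 * t\<^sup>2" by (simp add: \<tau>_def power_mult_distrib power_divide)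
      then have "c - 3 / 2 * (a / b)\<^sup>2 * t\<^sup>2 \<le> (N - ln b) * 1 - I"
        using G(2) by (simp add: c_def)
      then show ?thesis unfolding h_def by (intro mult_left_mono) auto
    qed
    ultimately show ?thesis by (meson ennreal_leI order_trans)
  qed
  define H where "H = (\<lambda>t::real. 2 / m * (c * t - (a / b)\<^sup>2 * t ^ 3 / 2))"
  have "(h has_integral H 1 - H (-1)) {-1..1}"
    unfolding h_def H_def using m by (intro fundamental_theorem_of_calculus)
      (auto simp flip: has_real_derivative_iff_has_vector_derivative intro!: derivative_eq_intros)
  \<comment> \<open>\<open>h\<close> may be negative, while the dominating function must not be;
    \<open>ennreal\<close> makes the truncation harmless.\<close>
  then have "ennreal (H 1 - H (-1))
    \<le> (\<integral>\<^sup>+t. ennreal (max 0 (h t)) * indicator {-1<..<1} t \<partial>lborel)"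
    by (rule nn_integral_ge_has_integral[rotated 3]) (auto simp: h_def)
  also have "\<dots> \<le> (\<integral>\<^sup>+t. \<integral>\<^sup>+r. ennreal (r ^ (m - 1)) * indicator {0<..1} r * indicator ({-1..1} \<times> UNIV) (t, r) *
      ennreal (2 * (N - avg_log (a * t) (b * r))) \<partial>lborel \<partial>lborel)"
  proof (rule nn_integral_mono)
    fix t :: real
    show "ennreal (max 0 (h t)) * indicator {-1<..<1} t \<le> (\<integral>\<^sup>+r. ennreal (r ^ (m - 1)) * indicator {0<..1} r * indicator ({-1..1} \<times> UNIV) (t, r) *
      ennreal (2 * (N - avg_log (a * t) (b * r))) \<partial>lborel)"
    proof (cases "t \<in> {-1<..<1}")
      case True
      have "ennreal (max 0 (h t)) = ennreal (h t)" by (simp add: max_def ennreal_neg)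
      also have "\<dots> \<le> (\<integral>\<^sup>+r. ennreal (2 * r ^ (m - 1) * (N - avg_log (a * t) (b * r))) * indicator {0<..<1} r \<partial>lborel)"
        using True by (intro row) auto
      also have "\<dots> \<le> (\<integral>\<^sup>+r. ennreal (r ^ (m - 1)) * indicator {0<..1} r * indicator ({-1..1} \<times> UNIV) (t, r) *
      ennreal (2 * (N - avg_log (a * t) (b * r))) \<partial>lborel)"
      proof (rule nn_integral_mono)
        fix r :: real
        show "ennreal (2 * r ^ (m - 1) * (N - avg_log (a * t) (b * r))) * indicator {0<..<1} r \<le>
          ennreal (r ^ (m - 1)) * indicator {0<..1} r * indicator ({-1..1} \<times> UNIV) (t, r) *
      ennreal (2 * (N - avg_log (a * t) (b * r)))"
        proof (cases "r \<in> {0<..<1}")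
          case r: True
          have "ennreal (2 * r ^ (m - 1) * (N - avg_log (a * t) (b * r))) = ennreal (r ^ (m - 1)) * ennreal (2 * (N - avg_log (a * t) (b * r)))"
          proof -
            have "2 * r ^ (m - 1) * z = r ^ (m - 1) * (2 * z)" for z by simp
            then show ?thesis using r by (simp only:) (rule ennreal_mult', simp)
          qed
          then show ?thesis using r True by simp
        qed simp
      qed
      finally show ?thesis using True by simp
    qed simp
  qed
  also have "\<dots> = (\<integral>\<^sup>+v. indicator {-1..1} v * shell N a (m - 1) ({-1..1} \<times> UNIV) (b * v) \<partial>lborel)"
    using b by (subst shell_swap) (auto simp: borel_Times)
  finally have "ennreal (H 1 - H (-1)) \<le> (\<integral>\<^sup>+v. indicator {-1..1} v * shell N a (m - 1) ({-1..1} \<times> UNIV) (b * v) \<partial>lborel)" .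
  moreover have "H 1 - H (-1) = 4 / m * (c - (a / b)\<^sup>2 / 2)"
    by (simp add: H_def algebra_simps)
  ultimately show ?thesis by (simp only: c_def)
qed

text \<open>
  For \<open>b \<le> a\<close> the roles of \<open>t\<close> and \<open>v\<close> are exchanged, integrating over \<open>t\<close> first.
\<close>

lemma shell_full_ge_far:
  assumes m: "m \<ge> 1" and b: "0 < a" "0 \<le> b" "b \<le> a" "a + b \<le> N"
  shows "ennreal (4 / m * (N - ln a + 2 / 3)) \<le>
    (\<integral>\<^sup>+v. indicator {-1..1} v * shell N a (m - 1) ({-1..1} \<times> UNIV) (b * v) \<partial>lborel)"
proof -
  define c where "c = N - ln a"
  have c: "c \<ge> 0" using ln_abs_le[of a N] b by (simp add: c_def)
  \<comment> \<open>Twice the bound that \<open>avg_log_upper\<close> gives for the integral over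
    \<open>t\<close>; the mean 1/3 of v^2 turns the 1 into 2/3.\<close>
  define h where "h = (\<lambda>v::real. 2 * (c + 1 - v\<^sup>2))"
  have inner: "ennreal (h v) \<le> (\<integral>\<^sup>+t. ennreal (N - ln \<bar>a * t + b * v * r\<bar>) * indicator {-1..1} t \<partial>lborel)"
    if v: "v \<in> {-1<..<1}" and r: "0 < r" "r \<le> 1" for v r
  proof -
    have "\<bar>v * r\<bar> \<le> \<bar>v\<bar>" using r by (simp add: abs_mult mult_right_le_one_le)
    then have "\<bar>b * (v * r)\<bar> \<le> a * \<bar>v\<bar>" unfolding abs_mult[of b] using b by (intro mult_mono) auto
    then have bv: "\<bar>b * v * r\<bar> \<le> a * \<bar>v\<bar>" by (simp add: mult.assoc)
    have bv1: "\<bar>b * v * r\<bar> \<le> b * 1"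
      unfolding abs_mult mult.assoc using b v r by (intro mult_mono mult_le_one) (auto simp: abs_le_iff)
    have ba: "\<bar>b * v * r\<bar> \<le> a" using bv1 b by simp
    have "\<bar>b * v * r / a\<bar> \<le> \<bar>v\<bar>" using bv b by (simp add: field_simps)
    then have sq: "(b * v * r / a)\<^sup>2 \<le> v\<^sup>2" by (simp only: abs_le_square_iff)
    have "avg_log (b * v * r) a \<le> ln a - 1 + v\<^sup>2"
      using avg_log_upper[OF b(1) ba] sq by simp
    then have "ennreal (h v) \<le> ennreal (2 * (N - avg_log (b * v * r) a))"
      unfolding h_def c_def by (intro ennreal_leI) simp
    also have "\<dots> = (\<integral>\<^sup>+t. ennreal (N - ln \<bar>b * v * r + a * t\<bar>) * indicator {-1..1} t \<partial>lborel)"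
    proof (rule nn_integral_avg_log[symmetric])
      fix t :: real assume t: "t \<in> {-1..1}"
      have "\<bar>a * t\<bar> \<le> a * 1" unfolding abs_mult using b t by (intro mult_mono) (auto simp: abs_le_iff)
      then show "ln \<bar>b * v * r + a * t\<bar> \<le> N"
        using bv1 b by (intro ln_abs_le) linarith
    qed (use b in auto)
    finally show ?thesis by (simp add: add.commute)
  qed
  note rint = nn_integral_power_unit[OF m]
  have hpos: "0 \<le> h v" if "v \<in> {-1..1}" for v
  proof -
    have "v\<^sup>2 \<le> 1" using that by (simp add: abs_square_le_1 abs_le_iff)
    then show ?thesis using c by (simp add: h_def)
  qed
  have row: "ennreal (h v / m) \<le> shell N a (m - 1) ({-1..1} \<times> UNIV) (b * v)" if v: "v \<in> {-1<..<1}" for v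
  proof -
    have h0: "0 \<le> h v" using hpos v by auto
    have "shell N a (m - 1) ({-1..1} \<times> UNIV) (b * v) =
      (\<integral>\<^sup>+r. \<integral>\<^sup>+t. ennreal (r ^ (m - 1)) * indicator {0<..1} r * (ennreal (N - ln \<bar>a * t + b * v * r\<bar>) * indicator {-1..1} t) \<partial>lborel \<partial>lborel)"
      unfolding shell_def by (subst lborel_pair.Fubini'[symmetric]) (auto simp: indicator_def mult_ac intro!: nn_integral_cong)
    also have "\<dots> \<ge> (\<integral>\<^sup>+r. ennreal (r ^ (m - 1)) * indicator {0<..1} r * ennreal (h v) \<partial>lborel)"
    proof (rule nn_integral_mono)
      fix r :: real
      show "ennreal (r ^ (m - 1)) * indicator {0<..1} r * ennreal (h v) \<le>
        (\<integral>\<^sup>+t. ennreal (r ^ (m - 1)) * indicator {0<..1} r * (ennreal (N - ln \<bar>a * t + b * v * r\<bar>) * indicator {-1..1} t) \<partial>lborel)"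
        using inner[OF v, of r] by (subst nn_integral_cmult) (auto simp: indicator_def intro!: mult_left_mono)
    qed
    also have "(\<integral>\<^sup>+r. ennreal (r ^ (m - 1)) * indicator {0<..1} r * ennreal (h v) \<partial>lborel) = ennreal (h v / m)"
    proof -
      have "(\<integral>\<^sup>+r. ennreal (r ^ (m - 1)) * indicator {0<..1} r * ennreal (h v) \<partial>lborel) =
          (\<integral>\<^sup>+r. ennreal (r ^ (m - 1)) * indicator {0<..1} r \<partial>lborel) * ennreal (h v)"
        by (rule nn_integral_multc) measurable
      also have "\<dots> = ennreal (h v / m)"
        unfolding rint using h0 by (subst ennreal_mult[symmetric]) auto
      finally show ?thesis .
    qed
    finally show ?thesis .
  qed
  define H where "H = (\<lambda>v::real. 2 * ((c + 1) * v - v ^ 3 / 3) / m)"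
  have "((\<lambda>v. h v / m) has_integral H 1 - H (-1)) {-1..1}"
    unfolding h_def H_def using m by (intro fundamental_theorem_of_calculus)
      (auto simp flip: has_real_derivative_iff_has_vector_derivative intro!: derivative_eq_intros)
  then have "ennreal (H 1 - H (-1)) \<le>
      (\<integral>\<^sup>+v. ennreal (h v / m) * indicator {-1<..<1} v \<partial>lborel)"
    using hpos by (intro nn_integral_ge_has_integral) (auto simp: h_def)
  also have "\<dots> \<le> (\<integral>\<^sup>+v. indicator {-1..1} v * shell N a (m - 1) ({-1..1} \<times> UNIV) (b * v) \<partial>lborel)"
    using row by (intro nn_integral_mono) (auto simp: indicator_def)
  finally have "ennreal (H 1 - H (-1)) \<le> (\<integral>\<^sup>+v. indicator {-1..1} v * shell N a (m - 1) ({-1..1} \<times> UNIV) (b * v) \<partial>lborel)" .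
  moreover have "H 1 - H (-1) = 4 / m * (N - ln a + 2 / 3)"
    using m by (simp add: H_def c_def field_simps)
  ultimately show ?thesis by (simp only:)
qed

text \<open>
  The value of \<open>\<eta>\<close> splits the slack \<open>1/m - 1/(m + 1) = 1/(m (m + 1))\<close> evenly between the term
  \<open>- ln \<eta>\<close> and the loss from replacing \<open>a\<close> by \<open>\<eta>a\<close>.
\<close>

lemma shell_rim_full:
  fixes m :: nat and \<eta> :: real
  assumes m: "m \<ge> 3" and \<eta>: "0 < \<eta>" "1 / \<eta>\<^sup>2 = 1 + 1 / (real m * (real m + 1))"
    and S [measurable]: "S \<in> sets borel"
    and S1: "\<And>t r. (t, r) \<in> S \<Longrightarrow> \<bar>t\<bar> \<le> 1 \<and> \<eta> \<le> \<bar>t\<bar> \<and> \<eta> \<le> r"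
    and b: "0 \<le> a" "0 \<le> b" "0 < a + b" "a + b \<le> N"
  shows "ennreal (2 / m) * (\<integral>\<^sup>+v. indicator {-1..1} v * shell N a (m - 1) S (b * v) \<partial>lborel) +
      ennreal (4 / (m * (m + 1))) * shell_mass (m - 1) S \<le>
    shell_mass (m - 1) S * (\<integral>\<^sup>+v. indicator {-1..1} v * shell N a (m - 1) ({-1..1} \<times> UNIV) (b * v) \<partial>lborel)"
proof -
  define d where "d = 1 / (real m * (real m + 1))"
  have d: "d > 0" "d \<le> 1 / 12"
  proof -
    have "3 * 4 \<le> real m * (real m + 1)" using m by (intro mult_mono) auto
    then show "d > 0" "d \<le> 1 / 12" by (auto simp: d_def divide_simps)
  qed
  have mn: "1 / real m = 1 / (real m + 1) + d" using m by (simp add: d_def divide_simps)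
  have n4: "1 / (real m + 1) \<le> 1 / 4" using m by (simp add: divide_simps)
  have \<eta>1: "\<eta> \<le> 1"
  proof (rule ccontr)
    assume "\<not> \<eta> \<le> 1"
    then have "\<eta>\<^sup>2 > 1" by (simp add: one_less_power)
    then have "1 / \<eta>\<^sup>2 < 1" by (simp add: divide_simps)
    then show False using \<eta> d by (simp add: d_def)
  qed
  have ln\<eta>: "- 2 * ln \<eta> \<le> d"
  proof -
    have "- 2 * ln \<eta> = ln (1 / \<eta>\<^sup>2)" using \<eta>(1) by (simp add: ln_div ln_realpow)
    also have "\<dots> \<le> 1 / \<eta>\<^sup>2 - 1" using \<eta>(1) by (intro ln_le_minus_one) auto
    finally show ?thesis by (simp add: \<eta>(2) d_def)
  qed
  have ln\<eta>0: "ln \<eta> \<le> 0" using \<eta> \<eta>1 by simp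
  define C1 where "C1 = N - avg_log (\<eta> * a) b - ln \<eta>"
  have \<eta>a: "0 \<le> \<eta> * a" "\<eta> * a \<le> a" using \<eta> \<eta>1 b by (auto simp: mult_left_le_one_le)
  have C1: "C1 \<ge> 0" using avg_log_le[of "\<eta> * a" b N] \<eta>a b ln\<eta>0 by (simp add: C1_def)
  let ?w = "shell_mass (m - 1) S"
  let ?JK = "\<integral>\<^sup>+v. indicator {-1..1} v * shell N a (m - 1) ({-1..1} \<times> UNIV) (b * v) \<partial>lborel"
  have JK: "ennreal (4 / m * (C1 + 1 / (real m + 1))) \<le> ?JK"
  \<comment> \<open>The split is at \<open>\<eta> * a\<close> rather than at \<open>a\<close>
    because the average inside \<open>C1\<close> has first argument \<open>\<eta> * a\<close>;
    \<open>b \<le> a\<close> still follows in the first case.\<close>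
  proof (cases "b \<le> \<eta> * a")
    case True
    have a: "a > 0"
    proof (rule ccontr)
      assume "\<not> a > 0"
      then show False using True b by auto
    qed
    have "ln (\<eta> * a) + ln 2 - 1 \<le> avg_log (\<eta> * a) b"
      using True a \<eta> b by (intro avg_log_lower_far) auto
    moreover have "ln (\<eta> * a) = ln \<eta> + ln a" using a \<eta> by (simp add: ln_mult)
    \<comment> \<open>The losses 1 - ln 2 \<le> 1/3, -2 ln \<open>\<eta>\<close> \<le> 1/12 and 1/(m
      + 1) \<le> 1/4 add up to exactly 2/3.\<close>
    ultimately have "C1 + 1 / (real m + 1) \<le> N - ln a + 2 / 3"
      unfolding C1_def using ln\<eta> d n4 ln2_ge_two_thirds by linarith
    then have "4 / m * (C1 + 1 / (real m + 1)) \<le> 4 / m * (N - ln a + 2 / 3)"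
      by (intro mult_left_mono) auto
    also have "ennreal \<dots> \<le> ?JK"
      using m a b True \<eta>a by (intro shell_full_ge_far) auto
    finally show ?thesis by (simp add: ennreal_leI)
  next
    case False
    then have b0: "b > 0" using \<eta>a by linarith
    have "ln b - 1 + (\<eta> * a / b)\<^sup>2 / 2 \<le> avg_log (\<eta> * a) b"
      using False b0 \<eta>a by (intro avg_log_lower) auto
    then have "C1 + 1 / (real m + 1) \<le> N - ln b + 1 - (\<eta> * a / b)\<^sup>2 / 2 + d / 2 + 1 / (real m + 1)"
      using ln\<eta> by (simp add: C1_def)
    also have "\<dots> \<le> N - ln b + 1 + 1 / m - (a / b)\<^sup>2 / 2"
    proof -
      have "(\<eta> * a / b)\<^sup>2 = \<eta>\<^sup>2 * (a / b)\<^sup>2" by (simp add: power_mult_distrib power_divide)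
      \<comment> \<open>The cost of \<open>\<eta>\<close> in the quadratic term: in this case a/b <
        1/\<open>\<eta>\<close>, and 1/\<open>\<eta>\<close>^2 - 1 is \<open>d\<close>. After
        halving it uses up d/2, as -ln \<open>\<eta>\<close> does.\<close>
      moreover have "(a / b)\<^sup>2 * (1 - \<eta>\<^sup>2) \<le> d"
      proof -
        have "\<eta> * a / b \<le> 1" using False b0 by simp
        then have "(\<eta> * a / b)\<^sup>2 \<le> 1" using \<eta>a b0 by (intro power_le_one) auto
        then have "(a / b)\<^sup>2 \<le> 1 / \<eta>\<^sup>2"
          using \<eta>(1) by (simp add: power_mult_distrib power_divide field_simps)
        moreover have "0 \<le> 1 - \<eta>\<^sup>2" using \<eta> \<eta>1 by (simp add: power_le_one)
        ultimately have "(a / b)\<^sup>2 * (1 - \<eta>\<^sup>2) \<le> 1 / \<eta>\<^sup>2 * (1 - \<eta>\<^sup>2)" by (rule mult_right_mono)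
        also have "\<dots> = 1 / \<eta>\<^sup>2 - 1" using \<eta>(1) by (simp add: field_simps)
        finally show ?thesis by (simp add: \<eta>(2) d_def)
      qed
      ultimately show ?thesis using mn by (simp add: algebra_simps)
    qed
    finally have "4 / m * (C1 + 1 / (real m + 1)) \<le> 4 / m * (N - ln b + 1 + 1 / m - (a / b)\<^sup>2 / 2)"
      by (intro mult_left_mono) auto
    also have "ennreal \<dots> \<le> ?JK"
      using m b0 b by (intro shell_full_ge_near) auto
    finally show ?thesis by (simp add: ennreal_leI)
  qed
  have "ennreal (2 / m) * (\<integral>\<^sup>+v. indicator {-1..1} v * shell N a (m - 1) S (b * v) \<partial>lborel) +
      ennreal (4 / (m * (m + 1))) * ?w \<le> ennreal (2 / m) * (ennreal (2 * C1) * ?w) + ennreal (4 / (m * (m + 1))) * ?w"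
    unfolding C1_def using b \<eta>(1) \<eta>1 S1 by (intro add_mono mult_left_mono shell_rim_le order_refl) auto
  also have "\<dots> = (ennreal (2 / m) * ennreal (2 * C1) + ennreal (4 / (m * (m + 1)))) * ?w"
    by (simp add: distrib_right mult.assoc)
  also have "ennreal (2 / m) * ennreal (2 * C1) + ennreal (4 / (m * (m + 1))) = ennreal (2 / m * (2 * C1) + 4 / (m * (m + 1)))"
    using C1 by (simp add: ennreal_mult'[symmetric] ennreal_plus[symmetric] del: ennreal_plus)
  also have "2 / m * (2 * C1) + 4 / (m * (m + 1)) = 4 / m * (C1 + 1 / (real m + 1))"
    by (simp add: distrib_left add.commute)
  also have "ennreal (4 / m * (C1 + 1 / (real m + 1))) * ?w \<le> ?JK * ?w"
    using JK by (intro mult_right_mono) auto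
  finally show ?thesis by (simp add: mult.commute)
qed

lemma shell_mass_full: "m \<ge> 1 \<Longrightarrow> shell_mass (m - 1) ({-1..1} \<times> UNIV) = ennreal (2 / m)"
proof -
  assume m: "m \<ge> 1"
  note rint = nn_integral_power_unit[OF m]
  have "shell_mass (m - 1) ({-1..1} \<times> UNIV) = (\<integral>\<^sup>+t. indicator {-1..(1::real)} t * (\<integral>\<^sup>+r. ennreal (r ^ (m - 1)) * indicator {0<..1} r \<partial>lborel) \<partial>lborel)"
    unfolding shell_mass_def
  proof (rule nn_integral_cong)
    fix t :: real
    have "(\<integral>\<^sup>+r. ennreal (r ^ (m - 1)) * indicator {0<..1} r * indicator ({-1..1} \<times> UNIV) (t, r) \<partial>lborel) =
      (\<integral>\<^sup>+r. indicator {-1..1} t * (ennreal (r ^ (m - 1)) * indicator {0<..1} r) \<partial>lborel)"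
      by (intro nn_integral_cong) (auto simp: indicator_def)
    then show "(\<integral>\<^sup>+r. ennreal (r ^ (m - 1)) * indicator {0<..1} r * indicator ({-1..1} \<times> UNIV) (t, r) \<partial>lborel) =
      indicator {-1..1} t * (\<integral>\<^sup>+r. ennreal (r ^ (m - 1)) * indicator {0<..1} r \<partial>lborel)"
      by (simp add: nn_integral_cmult)
  qed
  also have "\<dots> = emeasure lborel {-1..(1::real)} * ennreal (1 / m)"
    unfolding rint by (subst nn_integral_multc) auto
  also have "\<dots> = ennreal (2 / m)" using ennreal_mult[of 2 "1 / real m"] by simp
  finally show ?thesis .
qed

section \<open>Bodies of revolution\<close>

text \<open>The cut at distance 1 is built in, so that the strip
  \<open>{-1..1} \<times> UNIV\<close> yields the full cylinder and the range \<open>{0<..1}\<close>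
  of \<open>r\<close> suits every cross section.\<close>

definition revolve :: "'a::euclidean_space \<Rightarrow> (real \<times> real) set \<Rightarrow> 'a set" where
  "revolve e R = {x. axial e x \<le> 1 \<and> (x \<bullet> e, axial e x) \<in> R}"

lemma revolve_measurable [measurable]:
  assumes [measurable]: "R \<in> sets borel"
  shows "revolve e R \<in> sets borel"
proof -
  have "revolve e R = {x \<in> space borel. axial e x \<le> 1} \<inter> (\<lambda>x. (x \<bullet> e, axial e x)) -` R \<inter> space borel"
    by (auto simp: revolve_def)
  also have "\<dots> \<in> sets borel" by measurable
  finally show ?thesis .
qed

lemma axial_nonneg: "0 \<le> axial e x"
  by (simp add: axial_def)

text \<open>The integral over \<open>v\<close> is moved outermost, so that the spherical weight
  meets a function of \<open>v\<close> alone, as \<open>unimodal_weight_mono\<close>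
  requires.\<close>

lemma nn_integral_revolve:
  fixes f :: "real \<times> real \<Rightarrow> ennreal" and e0 e1 :: "'a::euclidean_space"
  assumes e: "e0 \<in> Basis" "e1 \<in> Basis" "e0 \<noteq> e1" and D: "DIM('a) \<ge> 4"
    and [measurable]: "f \<in> borel_measurable borel" "R \<in> sets borel"
  defines "k \<equiv> DIM('a) - 2"
  shows "(\<integral>\<^sup>+x. indicator (revolve e0 R) x * f (x \<bullet> e0, x \<bullet> e1) \<partial>lborel) =
    ennreal (unit_ball_vol k * k) * (\<integral>\<^sup>+v. ennreal (sqrt (1 - v\<^sup>2) ^ (k - 2)) * indicator {-1..1} v *
      (\<integral>\<^sup>+t. \<integral>\<^sup>+r. ennreal (r ^ k) * indicator {0<..1} r * indicator R (t, r) * f (t, v * r) \<partial>lborel \<partial>lborel) \<partial>lborel)"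
proof -
  define P where "P = (\<lambda>(t, s, r). indicator {..1} r * indicator R (t, r) * f (t, s))"
  have Pm [measurable]: "P \<in> borel_measurable borel"
    unfolding P_def borel_prod[symmetric] by measurable
  let ?W = "\<lambda>v::real. ennreal (sqrt (1 - v\<^sup>2) ^ (k - 2)) * indicator {-1..1} v"
  let ?g = "\<lambda>t r v. ennreal (r ^ k) * indicator {0<..1} r * (?W v * P (t, r * v, r))"
  have [measurable]: "(\<lambda>x. P (t, snd x * fst x, snd x)) \<in> borel_measurable (lborel \<Otimes>\<^sub>M lborel)"
     "(\<lambda>x. P (t, fst x * snd x, fst x)) \<in> borel_measurable (lborel \<Otimes>\<^sub>M lborel)" for t
  proof -
    have *: "borel_measurable (lborel \<Otimes>\<^sub>M lborel) = (borel_measurable (borel \<Otimes>\<^sub>M borel) :: (real \<times> real \<Rightarrow> ennreal) set)"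
      by (intro measurable_cong_sets sets_pair_measure_cong) auto
    show "(\<lambda>x. P (t, snd x * fst x, snd x)) \<in> borel_measurable (lborel \<Otimes>\<^sub>M lborel)"
      "(\<lambda>x. P (t, fst x * snd x, fst x)) \<in> borel_measurable (lborel \<Otimes>\<^sub>M lborel)"
      unfolding * by measurable
  qed
  have "(\<integral>\<^sup>+x. indicator (revolve e0 R) x * f (x \<bullet> e0, x \<bullet> e1) \<partial>lborel) =
    (\<integral>\<^sup>+x. P (x \<bullet> e0, x \<bullet> e1, axial e0 x) \<partial>lborel)"
    by (intro nn_integral_cong) (auto simp: P_def revolve_def indicator_def)
  also have "\<dots> = ennreal (unit_ball_vol k * k) * (\<integral>\<^sup>+t. \<integral>\<^sup>+r. \<integral>\<^sup>+v. ?g t r v \<partial>lborel \<partial>lborel \<partial>lborel)"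
    unfolding k_def using D by (intro nn_integral_axial e Pm) (auto simp: P_def)
  also have "(\<integral>\<^sup>+t. \<integral>\<^sup>+r. \<integral>\<^sup>+v. ?g t r v \<partial>lborel \<partial>lborel \<partial>lborel) = (\<integral>\<^sup>+t. \<integral>\<^sup>+v. \<integral>\<^sup>+r. ?g t r v \<partial>lborel \<partial>lborel \<partial>lborel)"
    by (intro nn_integral_cong lborel_pair.Fubini') measurable
  also have "\<dots> = (\<integral>\<^sup>+v. \<integral>\<^sup>+t. \<integral>\<^sup>+r. ?g t r v \<partial>lborel \<partial>lborel \<partial>lborel)"
    by (rule lborel_pair.Fubini') measurable
  also have "\<dots> = (\<integral>\<^sup>+v. ?W v * (\<integral>\<^sup>+t. \<integral>\<^sup>+r. ennreal (r ^ k) * indicator {0<..1} r * indicator R (t, r) * f (t, v * r) \<partial>lborel \<partial>lborel) \<partial>lborel)"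
  proof (rule nn_integral_cong)
    fix v :: real
    have "(\<integral>\<^sup>+t. \<integral>\<^sup>+r. ?g t r v \<partial>lborel \<partial>lborel) =
      (\<integral>\<^sup>+t. \<integral>\<^sup>+r. ?W v * (ennreal (r ^ k) * indicator {0<..1} r * indicator R (t, r) * f (t, v * r)) \<partial>lborel \<partial>lborel)"
      by (intro nn_integral_cong) (auto simp: P_def indicator_def mult_ac)
    then show "(\<integral>\<^sup>+t. \<integral>\<^sup>+r. ?g t r v \<partial>lborel \<partial>lborel) =
      ?W v * (\<integral>\<^sup>+t. \<integral>\<^sup>+r. ennreal (r ^ k) * indicator {0<..1} r * indicator R (t, r) * f (t, v * r) \<partial>lborel \<partial>lborel)"
      by (simp add: nn_integral_cmult)
  qed
  finally show ?thesis .
qed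

text \<open>A Householder reflection that fixes the axis \<open>e0\<close>.\<close>

lemma orthogonal_to_axis:
  fixes e0 e1 \<xi> :: "'a::euclidean_space"
  assumes e: "e0 \<in> Basis" "e1 \<in> Basis" "e0 \<noteq> e1"
  obtains T where "orthogonal_transformation T" "T e0 = e0" "T \<xi> = (\<xi> \<bullet> e0) *\<^sub>R e0 + axial e0 \<xi> *\<^sub>R e1"
proof -
  define \<eta> where "\<eta> = \<xi> - (\<xi> \<bullet> e0) *\<^sub>R e0"
  define b where "b = norm \<eta>"
  define v where "v = \<eta> - b *\<^sub>R e1"
  \<comment> \<open>For \<open>v = 0\<close> division by zero makes \<open>T\<close> the identity,
    which is then the map wanted.\<close>
  define T where "T = (\<lambda>x. x - (2 * (x \<bullet> v) / (v \<bullet> v)) *\<^sub>R v)"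
  have n: "e0 \<bullet> e0 = 1" "e1 \<bullet> e1 = 1" "e1 \<bullet> e0 = 0" "e0 \<bullet> e1 = 0"
    using e by (auto simp: inner_Basis)
  have \<eta>0: "e0 \<bullet> \<eta> = 0" by (simp add: \<eta>_def inner_diff_right n inner_commute)
  then have v0: "e0 \<bullet> v = 0" by (simp add: v_def inner_diff_right n)
  have T0: "T e0 = e0" by (simp add: T_def v0)
  have lin: "linear T"
    unfolding T_def by (rule linearI) (simp_all add: algebra_simps inner_add_left add_divide_distrib)
  have orth: "orthogonal_transformation T"
    unfolding orthogonal_transformation_def
  proof (intro conjI allI lin)
    fix x y
    show "T x \<bullet> T y = x \<bullet> y"
    proof (cases "v = 0")
      case False
      then have "v \<bullet> v \<noteq> 0" by simp
      moreover have "v \<bullet> y = y \<bullet> v" by (rule inner_commute)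
      ultimately show ?thesis
        by (simp add: T_def inner_diff_left inner_diff_right)
    qed (simp add: T_def)
  qed
  have T\<eta>: "T \<eta> = b *\<^sub>R e1"
  proof (cases "v = 0")
    case True
    then show ?thesis by (simp add: T_def v_def)
  next
    case False
    have "\<eta> \<bullet> \<eta> = b * b" by (simp add: b_def power2_norm_eq_inner[symmetric] power2_eq_square)
    moreover have "e1 \<bullet> \<eta> = \<eta> \<bullet> e1" by (rule inner_commute)
    ultimately have "v \<bullet> v = 2 * (\<eta> \<bullet> v)"
      by (simp add: v_def inner_diff_left inner_diff_right n algebra_simps)
    moreover have "v \<bullet> v \<noteq> 0" using False by simp
    ultimately have "2 * (\<eta> \<bullet> v) / (v \<bullet> v) = 1" by (metis divide_self)
    then have "T \<eta> = \<eta> - v" unfolding T_def by (simp only: scaleR_one)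
    then show ?thesis by (simp add: v_def)
  qed
  have "T \<xi> = T ((\<xi> \<bullet> e0) *\<^sub>R e0 + \<eta>)" by (simp add: \<eta>_def)
  also have "\<dots> = (\<xi> \<bullet> e0) *\<^sub>R e0 + b *\<^sub>R e1"
    by (simp add: linear_add[OF lin] linear_cmul[OF lin] T0 T\<eta>)
  finally show ?thesis
    using that[OF orth T0] by (simp add: b_def axial_def \<eta>_def)
qed

text \<open>An orthogonal map fixing the axis preserves both the body and the measure, so the part
  of \<open>\<xi>\<close> orthogonal to the axis may be turned into the direction
  \<open>e1\<close>.\<close>

lemma nn_integral_revolve_align:
  fixes f :: "real \<Rightarrow> ennreal" and e0 e1 \<xi> :: "'a::euclidean_space"
  assumes e: "e0 \<in> Basis" "e1 \<in> Basis" "e0 \<noteq> e1"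
    and [measurable]: "f \<in> borel_measurable borel" "R \<in> sets borel"
  shows "(\<integral>\<^sup>+x. indicator (revolve e0 R) x * f (x \<bullet> \<xi>) \<partial>lborel) =
    (\<integral>\<^sup>+x. indicator (revolve e0 R) x * f ((\<xi> \<bullet> e0) * (x \<bullet> e0) + axial e0 \<xi> * (x \<bullet> e1)) \<partial>lborel)"
proof -
  obtain T where T: "orthogonal_transformation T" "T e0 = e0" "T \<xi> = (\<xi> \<bullet> e0) *\<^sub>R e0 + axial e0 \<xi> *\<^sub>R e1"
    using orthogonal_to_axis[OF e] .
  have inner: "T x \<bullet> T y = x \<bullet> y" for x y using T(1) by (simp add: orthogonal_transformation_def)
  have lin: "linear T" using T(1) by (rule orthogonal_transformation_linear)
  have 0: "T x \<bullet> e0 = x \<bullet> e0" for x using inner[of x e0] T(2) by simp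
  have ax: "axial e0 (T x) = axial e0 x" for x
  proof -
    have "T x - (x \<bullet> e0) *\<^sub>R e0 = T (x - (x \<bullet> e0) *\<^sub>R e0)"
      by (simp add: linear_diff[OF lin] linear_cmul[OF lin] T(2))
    then show ?thesis using orthogonal_transformation_norm[OF T(1)] by (simp add: axial_def 0)
  qed
  let ?h = "\<lambda>x. indicator (revolve e0 R) x * f (x \<bullet> T \<xi>)"
  have "(\<integral>\<^sup>+x. indicator (revolve e0 R) x * f (x \<bullet> \<xi>) \<partial>lborel) = (\<integral>\<^sup>+x. ?h (T x) \<partial>lborel)"
    by (intro nn_integral_cong) (auto simp: revolve_def indicator_def 0 ax inner)
  also have "\<dots> = (\<integral>\<^sup>+x. ?h x \<partial>lborel)"
    by (rule nn_integral_lborel_orthogonal[OF T(1)]) measurable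
  also have "\<dots> = (\<integral>\<^sup>+x. indicator (revolve e0 R) x * f ((\<xi> \<bullet> e0) * (x \<bullet> e0) + axial e0 \<xi> * (x \<bullet> e1)) \<partial>lborel)"
    by (simp add: T(3) inner_add_right)
  finally show ?thesis .
qed

text \<open>If \<open>b > 0\<close>, the singularity in \<open>r\<close> is at worst -ln r and is
  absorbed by a factor \<open>r\<close>, which is why \<open>k \<ge> 1\<close>. If
  \<open>b = 0\<close>, the logarithm depends on \<open>t\<close> alone and is integrated in
  \<open>t\<close>.\<close>

lemma shell_full_finite:
  assumes b: "0 \<le> a" "0 \<le> b" "0 < a + b" "a + b \<le> N" and k: "k \<ge> 1"
  shows "(\<integral>\<^sup>+v. indicator {-1..1} v * shell N a k ({-1..1} \<times> UNIV) (b * v) \<partial>lborel) < \<infinity>"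
proof (cases "b = 0")
  case False
  then have b0: "b > 0" using b by simp
  define c where "c = 2 * (\<bar>N + 1 - ln b\<bar> + 1)"
  have "(\<integral>\<^sup>+v. indicator {-1..1} v * shell N a k ({-1..1} \<times> UNIV) (b * v) \<partial>lborel) =
    (\<integral>\<^sup>+t. \<integral>\<^sup>+r. ennreal (r ^ k) * indicator {0<..1} r * indicator ({-1..1} \<times> UNIV) (t, r) *
      ennreal (2 * (N - avg_log (a * t) (b * r))) \<partial>lborel \<partial>lborel)"
    using b by (intro shell_swap) (auto simp: borel_Times)
  also have "\<dots> \<le> (\<integral>\<^sup>+t. \<integral>\<^sup>+r. indicator {-1..(1::real)} t * (ennreal c * indicator {0..(1::real)} r) \<partial>lborel \<partial>lborel)"
  proof (intro nn_integral_mono)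
    fix t r :: real
    show "ennreal (r ^ k) * indicator {0<..1} r * indicator ({-1..1} \<times> UNIV) (t, r) *
      ennreal (2 * (N - avg_log (a * t) (b * r))) \<le> indicator {-1..1} t * (ennreal c * indicator {0..1} r)"
    proof (cases "0 < r \<and> r \<le> 1 \<and> t \<in> {-1..1}")
      case True
      have "ln (b * r) - 1 \<le> avg_log 0 (b * r)"
        using avg_log_lower[of "b * r" 0] True b0 by simp
      also have "\<dots> \<le> avg_log \<bar>a * t\<bar> (b * r)"
        using True b0 by (intro avg_log_mono) auto
      finally have "ln b + ln r - 1 \<le> avg_log (a * t) (b * r)"
        using True b0 by (simp add: avg_log_abs ln_mult)
      then have le: "N - avg_log (a * t) (b * r) \<le> \<bar>N + 1 - ln b\<bar> - ln r" by linarith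
      have rk: "0 \<le> r ^ k" "r ^ k \<le> r" using True k power_decreasing[of 1 k r] by auto
      have "r * (- ln r) \<le> r * (1 / r - 1)"
        using True ln_le_minus_one[of "1 / r"] by (intro mult_left_mono) (auto simp: ln_div)
      also have "\<dots> \<le> 1" using True by (simp add: algebra_simps)
      finally have rl: "r * (- ln r) \<le> 1" .
      have "ln r \<le> 0" using True by simp
      then have pos: "0 \<le> \<bar>N + 1 - ln b\<bar> - ln r" by linarith
      have "r ^ k * (2 * (N - avg_log (a * t) (b * r))) \<le> r ^ k * (2 * (\<bar>N + 1 - ln b\<bar> - ln r))"
        using le rk by (intro mult_left_mono) auto
      also have "\<dots> \<le> r * (2 * (\<bar>N + 1 - ln b\<bar> - ln r))"
        using rk pos by (intro mult_right_mono) auto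
      also have "\<dots> = 2 * (r * \<bar>N + 1 - ln b\<bar> + r * (- ln r))" by (simp add: algebra_simps)
      also have "\<dots> \<le> 2 * (1 * \<bar>N + 1 - ln b\<bar> + 1)"
        using rl True by (intro mult_left_mono add_mono mult_right_mono) auto
      finally have "r ^ k * (2 * (N - avg_log (a * t) (b * r))) \<le> c" by (simp add: c_def)
      moreover have "ennreal (r ^ k) * ennreal (2 * (N - avg_log (a * t) (b * r))) = ennreal (r ^ k * (2 * (N - avg_log (a * t) (b * r))))"
        using rk by (simp only: ennreal_mult')
      ultimately have "ennreal (r ^ k) * ennreal (2 * (N - avg_log (a * t) (b * r))) \<le> ennreal c"
        by (simp only: ennreal_leI)
      then show ?thesis using True by simp
    qed (auto simp: indicator_def)
  qed
  also have "\<dots> = 2 * ennreal c"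
    by (simp add: nn_integral_cmult nn_integral_cmult_indicator nn_integral_multc)
  also have "\<dots> < \<infinity>" by (simp add: ennreal_mult_less_top)
  finally show ?thesis .
next
  case True
  then have a: "a > 0" using b by simp
  have "shell N a k ({-1..1} \<times> UNIV) 0 \<le> (\<integral>\<^sup>+t. \<integral>\<^sup>+r. (ennreal (N - ln \<bar>0 + a * t\<bar>) * indicator {-1..1} t) * indicator {0..1} (r::real) \<partial>lborel \<partial>lborel)"
    unfolding shell_def
  proof (intro nn_integral_mono)
    fix t r :: real
    show "ennreal (r ^ k) * indicator {0<..1} r * indicator ({-1..1} \<times> UNIV) (t, r) * ennreal (N - ln \<bar>a * t + 0 * r\<bar>) \<le>
      (ennreal (N - ln \<bar>0 + a * t\<bar>) * indicator {-1..1} t) * indicator {0..1} r"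
    proof (cases "0 < r \<and> r \<le> 1 \<and> t \<in> {-1..1}")
      case r: True
      then have "ennreal (r ^ k) \<le> 1" by (simp add: power_le_one)
      from mult_right_mono[OF this, of "ennreal (N - ln \<bar>a * t\<bar>)"] show ?thesis using r by simp
    qed (auto simp: indicator_def)
  qed
  also have "\<dots> = (\<integral>\<^sup>+t. ennreal (N - ln \<bar>0 + a * t\<bar>) * indicator {-1..1} t \<partial>lborel)"
    by (simp add: nn_integral_cmult)
  also have "\<dots> = ennreal (2 * (N - avg_log 0 a))"
  proof (rule nn_integral_avg_log)
    show "ln \<bar>0 + a * v\<bar> \<le> N" if "v \<in> {-1..1}" for v
    proof (rule ln_abs_le)
      have "a * \<bar>v\<bar> \<le> a * 1" using that a by (intro mult_left_mono) auto
      moreover have "\<bar>0 + a * v\<bar> = a * \<bar>v\<bar>" using a by (simp add: abs_mult)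
      ultimately show "\<bar>0 + a * v\<bar> \<le> N" using b by linarith
    qed
  qed (use a in simp)
  also have "\<dots> < top" by simp
  finally have "shell N a k ({-1..1} \<times> UNIV) 0 < top" .
  then show ?thesis
    using True by (simp add: nn_integral_multc ennreal_mult_less_top)
qed

section \<open>Logarithmic averages over the cylinder and its rim\<close>

text \<open>The estimates only use that the cross section \<open>R\<close> lies close to the rim.
  Its precise shape matters for convexity and is left open until the bodies are built.\<close>

locale cylinder_rim =
  fixes e0 :: "'a::euclidean_space" and R :: "(real \<times> real) set" and \<eta> :: real
  assumes e0: "e0 \<in> Basis" and D: "DIM('a) \<ge> 4"
    and \<eta>: "0 < \<eta>" "1 / \<eta>\<^sup>2 = 1 + 1 / ((real DIM('a) - 1) * real DIM('a))"
    and R [measurable]: "R \<in> sets borel"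
    and R1: "\<And>t r. (t, r) \<in> R \<Longrightarrow> \<bar>t\<bar> \<le> 1 \<and> \<eta> \<le> \<bar>t\<bar> \<and> \<eta> \<le> r"
begin

definition cyl :: "'a set" where "cyl = revolve e0 ({-1..1} \<times> UNIV)"

definition rim :: "'a set" where "rim = revolve e0 R"

text \<open>When \<open>N\<close> dominates the logarithm on \<open>G\<close> and the integral is
  finite, this is N vol(G) minus the integral of the logarithm, so inequalities between averages
  appear reversed.\<close>

definition log_pot :: "real \<Rightarrow> 'a \<Rightarrow> 'a set \<Rightarrow> ennreal" where
  "log_pot N \<xi> G = (\<integral>\<^sup>+x. indicator G x * ennreal (N - ln \<bar>x \<bullet> \<xi>\<bar>) \<partial>lborel)"

lemma full_measurable [measurable]: "{-1..1::real} \<times> (UNIV::real set) \<in> sets borel"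
  by (intro borel_Times) auto

lemma cyl_rim_measurable [measurable]: "cyl \<in> sets borel" "rim \<in> sets borel"
  unfolding cyl_def rim_def by measurable

text \<open>The gap 1/n between the two averages, multiplied by both volumes so that neither
  division nor truncating subtraction occurs.\<close>

lemma log_pot_nonneg_axis:
  assumes \<xi>: "\<xi> \<noteq> 0" "0 \<le> \<xi> \<bullet> e0" and N: "\<xi> \<bullet> e0 + axial e0 \<xi> \<le> N"
  shows "emeasure lborel cyl * log_pot N \<xi> rim +
      ennreal (1 / DIM('a)) * emeasure lborel cyl * emeasure lborel rim \<le> emeasure lborel rim * log_pot N \<xi> cyl"
    and "log_pot N \<xi> cyl < \<infinity>"
proof -
  define m where "m = DIM('a) - 1"
  define k where "k = DIM('a) - 2"
  have mk: "m - 1 = k" "m \<ge> 3" "real m = real DIM('a) - 1" "k \<ge> 1" using D by (auto simp: m_def k_def)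
  obtain e1 where e1: "e1 \<in> Basis" "e0 \<noteq> e1"
  proof -
    have "\<not> Basis \<subseteq> {e0}" using D card_mono[of "{e0}" "Basis"] by auto
    then show ?thesis using that by auto
  qed
  define a where "a = \<xi> \<bullet> e0"
  define b where "b = axial e0 \<xi>"
  have ab: "0 \<le> a" "0 \<le> b" "a + b \<le> N" using \<xi> N by (auto simp: a_def b_def axial_nonneg)
  have ab0: "0 < a + b"
  proof (rule ccontr)
    assume "\<not> 0 < a + b"
    then have "a = 0" "b = 0" using ab by auto
    then show False using \<xi> by (simp add: a_def b_def axial_def)
  qed
  define C where "C = ennreal (unit_ball_vol k * k)"
  define W where "W = (\<lambda>v::real. ennreal (sqrt (1 - v\<^sup>2) ^ (k - 2)) * indicator {-1..1} v)"
  have [measurable]: "W \<in> borel_measurable borel" unfolding W_def by measurable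
  define W0 where "W0 = (\<integral>\<^sup>+v. W v \<partial>lborel)"
  have pot: "log_pot N \<xi> (revolve e0 S) = C * (\<integral>\<^sup>+v. W v * shell N a k S (b * v) \<partial>lborel)"
    if [measurable]: "S \<in> sets borel" for S
  proof -
    define f where "f = (\<lambda>(t, s). ennreal (N - ln \<bar>a * t + b * s\<bar>))"
    have fm: "f \<in> borel_measurable borel" unfolding f_def borel_prod[symmetric] by measurable
    have "log_pot N \<xi> (revolve e0 S) = (\<integral>\<^sup>+x. indicator (revolve e0 S) x * f (x \<bullet> e0, x \<bullet> e1) \<partial>lborel)"
      unfolding log_pot_def f_def a_def b_def using e0 e1
      by (subst nn_integral_revolve_align[where ?e1.0=e1 and f="\<lambda>y. ennreal (N - ln \<bar>y\<bar>)"]) auto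
    also have "\<dots> = C * (\<integral>\<^sup>+v. W v * (\<integral>\<^sup>+t. \<integral>\<^sup>+r. ennreal (r ^ k) * indicator {0<..1} r * indicator S (t, r) * f (t, v * r) \<partial>lborel \<partial>lborel) \<partial>lborel)"
      unfolding C_def W_def k_def by (rule nn_integral_revolve[OF e0 e1(1) e1(2) D fm that])
    finally show ?thesis by (simp add: f_def shell_def mult.assoc)
  qed
  have vol: "emeasure lborel (revolve e0 S) = C * (W0 * shell_mass k S)"
    if [measurable]: "S \<in> sets borel" for S
  proof -
    have "emeasure lborel (revolve e0 S) = (\<integral>\<^sup>+x. indicator (revolve e0 S) x * (\<lambda>_::real\<times>real. 1) (x \<bullet> e0, x \<bullet> e1) \<partial>lborel)"
      by simp
    also have "\<dots> = C * (\<integral>\<^sup>+v. W v * (\<integral>\<^sup>+t. \<integral>\<^sup>+r. ennreal (r ^ k) * indicator {0<..1} r * indicator S (t, r) * (\<lambda>_::real\<times>real. 1) (t, v * r) \<partial>lborel \<partial>lborel) \<partial>lborel)"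
      unfolding C_def W_def k_def by (rule nn_integral_revolve[OF e0 e1(1) e1(2) D _ that]) auto
    also have "\<dots> = C * (\<integral>\<^sup>+v. W v * shell_mass k S \<partial>lborel)" by (simp add: shell_mass_def)
    also have "(\<integral>\<^sup>+v. W v * shell_mass k S \<partial>lborel) = W0 * shell_mass k S"
      unfolding W0_def by (rule nn_integral_multc) measurable
    finally show ?thesis .
  qed
  let ?w = "shell_mass k R"
  let ?F = "{-1..1::real} \<times> (UNIV::real set)"
  \<comment> \<open>This is 1/n, with n = m + 1, times the mass 2/m of the full strip.\<close>
  let ?c = "ennreal (2 / (m * (m + 1)))"
  \<comment> \<open>\<open>p\<close> and \<open>q\<close> are the two sides as functions of
    \<open>v\<close>. Averaging them over [-l, l] amounts to replacing \<open>b\<close> by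
    \<open>b * l\<close>, where \<open>shell_rim_full\<close> applies; unimodality then carries the
    inequality over to the weight \<open>W\<close>.\<close>
  define p where "p = (\<lambda>v. ennreal (2 / m) * shell N a k R (b * v) + ?c * ?w)"
  define q where "q = (\<lambda>v. ?w * shell N a k ?F (b * v))"
  have pq[measurable]: "p \<in> borel_measurable borel" "q \<in> borel_measurable borel"
    unfolding p_def q_def by measurable
  have "(\<integral>\<^sup>+v. ennreal (sqrt (1 - v\<^sup>2) ^ (k - 2)) * indicator {-1..1} v * p v \<partial>lborel) \<le>
    (\<integral>\<^sup>+v. ennreal (sqrt (1 - v\<^sup>2) ^ (k - 2)) * indicator {-1..1} v * q v \<partial>lborel)"
  proof (rule unimodal_weight_mono[OF pq])
    fix l :: real assume l: "0 < l" "l \<le> 1"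
    have bl: "0 \<le> b * l" "b * l \<le> b" using l ab by (auto simp: mult_right_le_one_le)
    have abl: "0 < a + b * l" using ab ab0 l by (cases "b = 0") (auto intro: add_nonneg_pos)
    have "(\<integral>\<^sup>+v. indicator {-1..1} v * p (l * v) \<partial>lborel) =
      (\<integral>\<^sup>+v. ennreal (2 / m) * (indicator {-1..1} v * shell N a k R (b * l * v)) + (?c * ?w) * indicator {-1..1} v \<partial>lborel)"
      by (intro nn_integral_cong) (simp add: p_def distrib_left mult_ac)
    also have "\<dots> = ennreal (2 / m) * (\<integral>\<^sup>+v. indicator {-1..1} v * shell N a k R (b * l * v) \<partial>lborel) + (?c * ?w) * 2"
      by (subst nn_integral_add) (auto simp: nn_integral_cmult)
    also have "(?c * ?w) * 2 = ennreal (4 / (m * (m + 1))) * ?w"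
    proof -
      have "?c * 2 = ennreal (4 / (m * (m + 1)))" using ennreal_mult[of "2 / (m * (m + 1))" 2] by simp
      moreover have "(?c * ?w) * 2 = (?c * 2) * ?w" by (simp only: mult_ac)
      ultimately show ?thesis by (simp only:)
    qed
    also have "ennreal (2 / m) * (\<integral>\<^sup>+v. indicator {-1..1} v * shell N a k R (b * l * v) \<partial>lborel) + ennreal (4 / (m * (m + 1))) * ?w \<le>
      ?w * (\<integral>\<^sup>+v. indicator {-1..1} v * shell N a k ?F (b * l * v) \<partial>lborel)"
    proof -
      have "1 / \<eta>\<^sup>2 = 1 + 1 / (real m * (real m + 1))" using \<eta>(2) mk(3) by simp
      from shell_rim_full[OF mk(2) \<eta>(1) this R R1 ab(1) bl(1) abl] bl(2) ab(3)
      show ?thesis unfolding mk(1) by simp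
    qed
    also have "\<dots> = (\<integral>\<^sup>+v. indicator {-1..1} v * q (l * v) \<partial>lborel)"
      by (subst nn_integral_cmult[symmetric]) (auto simp: q_def mult_ac)
    finally show "(\<integral>\<^sup>+v. indicator {-1..1} v * p (l * v) \<partial>lborel) \<le> (\<integral>\<^sup>+v. indicator {-1..1} v * q (l * v) \<partial>lborel)" .
  qed
  then have pq_le: "(\<integral>\<^sup>+v. W v * p v \<partial>lborel) \<le> (\<integral>\<^sup>+v. W v * q v \<partial>lborel)" by (simp add: W_def)
  let ?A = "\<integral>\<^sup>+v. W v * shell N a k R (b * v) \<partial>lborel"
  let ?B = "\<integral>\<^sup>+v. W v * shell N a k ?F (b * v) \<partial>lborel"
  have "(\<integral>\<^sup>+v. W v * p v \<partial>lborel) = (\<integral>\<^sup>+v. ennreal (2 / m) * (W v * shell N a k R (b * v)) + (?c * ?w) * W v \<partial>lborel)"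
    by (intro nn_integral_cong) (simp add: p_def distrib_left mult_ac)
  also have "\<dots> = ennreal (2 / m) * ?A + (?c * ?w) * W0"
    by (subst nn_integral_add) (auto simp: nn_integral_cmult W0_def)
  finally have P: "(\<integral>\<^sup>+v. W v * p v \<partial>lborel) = ennreal (2 / m) * ?A + (?c * ?w) * W0" .
  have Q: "(\<integral>\<^sup>+v. W v * q v \<partial>lborel) = ?w * ?B"
    by (subst nn_integral_cmult[symmetric]) (auto simp: q_def mult_ac)
  have full: "shell_mass k ?F = ennreal (2 / m)" using shell_mass_full[of m] mk by simp
  have cyl: "emeasure lborel cyl = C * (W0 * ennreal (2 / m))" "log_pot N \<xi> cyl = C * ?B"
    unfolding cyl_def by (simp_all only: vol[OF full_measurable] pot[OF full_measurable] full)
  have rim: "emeasure lborel rim = C * (W0 * ?w)" "log_pot N \<xi> rim = C * ?A"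
    unfolding rim_def by (simp_all only: vol[OF R] pot[OF R])
  have cc: "ennreal (1 / DIM('a)) * ennreal (2 / m) = ?c"
  proof -
    have "real DIM('a) = real m + 1" using mk by simp
    then have "1 / DIM('a) * (2 / m) = 2 / (m * (m + 1))" by (simp add: algebra_simps)
    then show ?thesis by (simp add: ennreal_mult[symmetric] del: of_nat_mult)
  qed
  have "emeasure lborel cyl * log_pot N \<xi> rim + ennreal (1 / DIM('a)) * emeasure lborel cyl * emeasure lborel rim =
    C * W0 * C * (ennreal (2 / m) * ?A + (ennreal (1 / DIM('a)) * ennreal (2 / m) * ?w) * W0)"
    unfolding cyl rim by (simp only: distrib_left mult_ac)
  also have "\<dots> \<le> C * W0 * C * (?w * ?B)"
    using pq_le unfolding P Q cc by (rule mult_left_mono) simp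
  also have "\<dots> = emeasure lborel rim * log_pot N \<xi> cyl"
    unfolding cyl rim by (simp only: mult_ac)
  finally show "emeasure lborel cyl * log_pot N \<xi> rim +
      ennreal (1 / DIM('a)) * emeasure lborel cyl * emeasure lborel rim \<le> emeasure lborel rim * log_pot N \<xi> cyl" .
  have "?B \<le> (\<integral>\<^sup>+v. indicator {-1..1} v * shell N a k ?F (b * v) \<partial>lborel)"
  proof (intro nn_integral_mono mult_right_mono)
    fix v :: real
    have "sqrt (1 - v\<^sup>2) ^ (k - 2) \<le> 1" if "v \<in> {-1..1}"
    proof -
      have "v\<^sup>2 \<le> 1" using that by (simp add: abs_square_le_1 abs_le_iff)
      then show ?thesis by (intro power_le_one) auto
    qed
    then show "W v \<le> indicator {-1..1} v" by (auto simp: W_def indicator_def)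
  qed simp
  also have "\<dots> < \<infinity>" using ab ab0 mk by (intro shell_full_finite) auto
  finally show "log_pot N \<xi> cyl < \<infinity>"
    by (simp add: cyl C_def ennreal_mult_less_top)
qed

text \<open>The potential is even in \<open>\<xi>\<close>, so the axial component may be taken
  nonnegative.\<close>

lemma log_pot_compare:
  assumes \<xi>: "\<xi> \<noteq> 0" and N: "\<bar>\<xi> \<bullet> e0\<bar> + axial e0 \<xi> \<le> N"
  shows "emeasure lborel cyl * log_pot N \<xi> rim +
      ennreal (1 / DIM('a)) * emeasure lborel cyl * emeasure lborel rim \<le> emeasure lborel rim * log_pot N \<xi> cyl"
    and "log_pot N \<xi> cyl < \<infinity>"
proof -
  have m: "axial e0 (- \<xi>) = axial e0 \<xi>" "log_pot N (- \<xi>) G = log_pot N \<xi> G" for G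
    by (simp_all add: axial_def log_pot_def norm_minus_commute)
  show "emeasure lborel cyl * log_pot N \<xi> rim +
      ennreal (1 / DIM('a)) * emeasure lborel cyl * emeasure lborel rim \<le> emeasure lborel rim * log_pot N \<xi> cyl"
    "log_pot N \<xi> cyl < \<infinity>"
    using log_pot_nonneg_axis[of \<xi> N] log_pot_nonneg_axis[of "- \<xi>" N] \<xi> N
    by (cases "0 \<le> \<xi> \<bullet> e0"; simp add: m)+
qed

end

text \<open>An average over the removed part that exceeds the overall one pushes down the average
  over the rest. The constant \<open>N\<close> cancels.\<close>

lemma average_gap_arith:
  fixes Vc Ve Fc Fe N n :: real
  assumes "0 \<le> Ve" "Ve < Vc" and le: "Vc * (N * Ve - Fe) + 1 / n * Vc * Ve \<le> Ve * (N * Vc - Fc)"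
  shows "(Fc - Fe) / (Vc - Ve) + Ve / (n * (Vc - Ve)) \<le> Fc / Vc"
proof -
  have V: "Vc > 0" "Vc - Ve > 0" using assms by auto
  have "Vc * (N * Ve - Fe) = N * (Vc * Ve) - Vc * Fe" "Ve * (N * Vc - Fc) = N * (Vc * Ve) - Ve * Fc"
    by algebra+
  moreover have "1 / n * Vc * Ve = Vc * Ve / n" by simp
  ultimately have "N * (Vc * Ve) - Vc * Fe + Vc * Ve / n \<le> N * (Vc * Ve) - Ve * Fc"
    using le by (simp only:)
  then have "Fc * Vc - Vc * Fe + Vc * Ve / n \<le> Fc * Vc - Ve * Fc" by linarith
  moreover have "Fc * (Vc - Ve) = Fc * Vc - Ve * Fc" by algebra
  moreover have "(Fc - Fe + z) * Vc = Fc * Vc - Vc * Fe + Vc * z" for z by algebra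
  from this[of "Ve / n"] have "(Fc - Fe + Ve / n) * Vc = Fc * Vc - Vc * Fe + Vc * Ve / n"
    by (simp only: times_divide_eq_right)
  ultimately have "(Fc - Fe + Ve / n) * Vc \<le> Fc * (Vc - Ve)" by (simp only:)
  then show ?thesis
    unfolding divide_divide_eq_left[symmetric] add_divide_distrib[symmetric]
    by (simp only: pos_divide_le_eq[OF V(2)] times_divide_eq_left pos_le_divide_eq[OF V(1)])
qed

context cylinder_rim
begin

lemma mem_cyl: "x \<in> cyl \<longleftrightarrow> \<bar>x \<bullet> e0\<bar> \<le> 1 \<and> axial e0 x \<le> 1"
  by (auto simp: cyl_def revolve_def abs_le_iff)

lemma mem_rim: "x \<in> rim \<longleftrightarrow> axial e0 x \<le> 1 \<and> (x \<bullet> e0, axial e0 x) \<in> R"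
  by (simp add: rim_def revolve_def)

lemma inner_cyl_le:
  assumes "x \<in> cyl"
  shows "\<bar>x \<bullet> \<xi>\<bar> \<le> \<bar>\<xi> \<bullet> e0\<bar> + axial e0 \<xi>"
proof -
  let ?p = "\<lambda>x. x - (x \<bullet> e0) *\<^sub>R e0"
  have x: "\<bar>x \<bullet> e0\<bar> \<le> 1" "axial e0 x \<le> 1" using assms by (auto simp: mem_cyl)
  have "x \<bullet> \<xi> = (x \<bullet> e0) * (\<xi> \<bullet> e0) + ?p x \<bullet> ?p \<xi>"
    using e0 inner_commute[of e0 \<xi>] by (simp add: inner_diff_left inner_diff_right)
  then have "\<bar>x \<bullet> \<xi>\<bar> \<le> \<bar>x \<bullet> e0\<bar> * \<bar>\<xi> \<bullet> e0\<bar> + \<bar>?p x \<bullet> ?p \<xi>\<bar>"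
    by (metis abs_mult abs_triangle_ineq)
  also have "\<bar>?p x \<bullet> ?p \<xi>\<bar> \<le> axial e0 x * axial e0 \<xi>"
    unfolding axial_def by (rule Cauchy_Schwarz_ineq2)
  also have "\<bar>x \<bullet> e0\<bar> * \<bar>\<xi> \<bullet> e0\<bar> + axial e0 x * axial e0 \<xi> \<le> 1 * \<bar>\<xi> \<bullet> e0\<bar> + 1 * axial e0 \<xi>"
    using x by (intro add_mono mult_right_mono) (auto simp: axial_nonneg)
  finally show ?thesis by simp
qed

lemma norm_le_axial: "norm x \<le> \<bar>x \<bullet> e0\<bar> + axial e0 x"
proof -
  have "norm x \<le> norm ((x \<bullet> e0) *\<^sub>R e0) + norm (x - (x \<bullet> e0) *\<^sub>R e0)"
    by (metis add.commute diff_add_cancel norm_triangle_ineq)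
  then show ?thesis using e0 by (simp add: axial_def)
qed

lemma bounded_cyl: "bounded cyl"
proof (rule boundedI)
  show "norm x \<le> 2" if "x \<in> cyl" for x
    using norm_le_axial[of x] that by (simp add: mem_cyl)
qed

text \<open>Finiteness of the potential on the cylinder yields integrability of the logarithm on
  every Borel subset, and only then can the \<open>ennreal\<close> inequality be read as one between
  real integrals.\<close>

lemma log_average_gap:
  assumes \<xi>: "\<xi> \<noteq> 0" and sub: "rim \<subseteq> cyl" and V: "measure lborel rim < measure lborel cyl"
  shows "set_integrable lborel (cyl - rim) (\<lambda>x. ln \<bar>x \<bullet> \<xi>\<bar>)"
    and "(LINT x:cyl - rim|lborel. ln \<bar>x \<bullet> \<xi>\<bar>) / measure lborel (cyl - rim) +
        measure lborel rim / (DIM('a) * measure lborel (cyl - rim)) \<le>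
      (LINT x:cyl|lborel. ln \<bar>x \<bullet> \<xi>\<bar>) / measure lborel cyl"
proof -
  define N where "N = \<bar>\<xi> \<bullet> e0\<bar> + axial e0 \<xi>"
  define f where "f = (\<lambda>x. ln \<bar>x \<bullet> \<xi>\<bar>)"
  have [measurable]: "f \<in> borel_measurable borel" unfolding f_def by measurable
  have fN: "f x \<le> N" if "x \<in> cyl" for x
    unfolding f_def N_def using inner_cyl_le[OF that] by (rule ln_abs_le)
  have fin: "emeasure lborel G < \<infinity>" if "G \<subseteq> cyl" for G
    using emeasure_bounded_finite[OF bounded_subset[OF bounded_cyl that]] by simp
  have key: "integrable lborel (\<lambda>x. indicator G x * f x)"
    "log_pot N \<xi> G = ennreal (N * measure lborel G - (\<integral>x. indicator G x * f x \<partial>lborel))"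
    "0 \<le> N * measure lborel G - (\<integral>x. indicator G x * f x \<partial>lborel)"
    if G: "G \<subseteq> cyl" and [measurable]: "G \<in> sets borel" for G
  proof -
    let ?h = "\<lambda>x. indicator G x * (N - f x)"
    have h0: "0 \<le> ?h x" for x using fN G by (auto simp: indicator_def)
    have pot: "log_pot N \<xi> G = (\<integral>\<^sup>+x. ennreal (?h x) \<partial>lborel)"
      unfolding log_pot_def f_def by (intro nn_integral_cong) (auto simp: indicator_def)
    have "log_pot N \<xi> G \<le> log_pot N \<xi> cyl"
      unfolding log_pot_def using G by (intro nn_integral_mono) (auto simp: indicator_def)
    also have "\<dots> < \<infinity>" using \<xi> by (intro log_pot_compare(2)) (simp_all add: N_def)
    finally have int: "integrable lborel ?h"
      using h0 by (intro integrableI_nonneg) (auto simp: pot)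
    have intG: "integrable lborel (\<lambda>x. N * indicator G x :: real)"
      using fin[OF G] by (intro integrable_mult_right integrable_real_indicator) auto
    have eq: "(\<lambda>x. indicator G x * f x) = (\<lambda>x. N * indicator G x - ?h x)"
      by (auto simp: indicator_def)
    show "integrable lborel (\<lambda>x. indicator G x * f x)"
      unfolding eq using intG int by (rule Bochner_Integration.integrable_diff)
    have "(\<integral>x. indicator G x * f x \<partial>lborel) = N * measure lborel G - (\<integral>x. ?h x \<partial>lborel)"
      unfolding eq by (subst Bochner_Integration.integral_diff[OF intG int]) simp
    then have I: "(\<integral>x. ?h x \<partial>lborel) = N * measure lborel G - (\<integral>x. indicator G x * f x \<partial>lborel)"
      by simp
    show "log_pot N \<xi> G = ennreal (N * measure lborel G - (\<integral>x. indicator G x * f x \<partial>lborel))"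
      unfolding pot I[symmetric] using int h0 by (intro nn_integral_eq_integral) auto
    show "0 \<le> N * measure lborel G - (\<integral>x. indicator G x * f x \<partial>lborel)"
      unfolding I[symmetric] using h0 by (intro integral_nonneg_AE) auto
  qed
  define Vc where "Vc = measure lborel cyl"
  define Ve where "Ve = measure lborel rim"
  define Fc where "Fc = (\<integral>x. indicator cyl x * f x \<partial>lborel)"
  define Fe where "Fe = (\<integral>x. indicator rim x * f x \<partial>lborel)"
  define n where "n = real DIM('a)"
  have n: "n > 0" by (simp add: n_def)
  have Ve: "0 \<le> Ve" "Ve < Vc" using V by (simp_all add: Ve_def Vc_def)
  have em: "emeasure lborel cyl = ennreal Vc" "emeasure lborel rim = ennreal Ve"
    using fin[OF order_refl] fin[OF sub] by (simp_all add: Vc_def Ve_def emeasure_eq_ennreal_measure)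
  note kc = key[OF order_refl cyl_rim_measurable(1), folded Vc_def Fc_def]
  note ke = key[OF sub cyl_rim_measurable(2), folded Ve_def Fe_def]
  have "ennreal Vc * ennreal (N * Ve - Fe) + ennreal (1 / n) * ennreal Vc * ennreal Ve \<le> ennreal Ve * ennreal (N * Vc - Fc)"
    unfolding em[symmetric] kc(2)[symmetric] ke(2)[symmetric] n_def
    using \<xi> by (rule log_pot_compare(1)) (simp add: N_def)
  note compare = this
  have "ennreal Vc * ennreal (N * Ve - Fe) + ennreal (1 / n) * ennreal Vc * ennreal Ve =
      ennreal (Vc * (N * Ve - Fe) + 1 / n * Vc * Ve)"
  proof -
    have "ennreal Vc * ennreal (N * Ve - Fe) = ennreal (Vc * (N * Ve - Fe))"
      using Ve ke(3) by (intro ennreal_mult[symmetric]) auto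
    moreover have "ennreal (1 / n) * ennreal Vc * ennreal Ve = ennreal (1 / n * Vc * Ve)"
      using Ve n by (subst ennreal_mult, simp, simp, subst ennreal_mult, simp_all)
    moreover have "0 \<le> Vc * (N * Ve - Fe)" "0 \<le> 1 / n * Vc * Ve"
      using Ve ke(3) n by auto
    ultimately show ?thesis by (simp only: ennreal_plus)
  qed
  moreover have "ennreal Ve * ennreal (N * Vc - Fc) = ennreal (Ve * (N * Vc - Fc))"
    using Ve(1) kc(3) by (intro ennreal_mult[symmetric])
  ultimately have "ennreal (Vc * (N * Ve - Fe) + 1 / n * Vc * Ve) \<le> ennreal (Ve * (N * Vc - Fc))"
    using compare by (simp only:)
  then have "Vc * (N * Ve - Fe) + 1 / n * Vc * Ve \<le> Ve * (N * Vc - Fc)"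
    using ennreal_le_iff[OF mult_nonneg_nonneg[OF Ve(1) kc(3)]] by (simp only:)
  from average_gap_arith[OF Ve this]
  have gap: "(Fc - Fe) / (Vc - Ve) + Ve / (n * (Vc - Ve)) \<le> Fc / Vc" .
  have L: "(\<lambda>x. indicator (cyl - rim) x * f x) = (\<lambda>x. indicator cyl x * f x - indicator rim x * f x)"
    using sub by (auto simp: indicator_def fun_eq_iff)
  show "set_integrable lborel (cyl - rim) (\<lambda>x. ln \<bar>x \<bullet> \<xi>\<bar>)"
  proof -
    have "integrable lborel (\<lambda>x. indicator (cyl - rim) x * f x)"
      unfolding L by (rule Bochner_Integration.integrable_diff[OF kc(1) ke(1)])
    then show ?thesis by (simp add: set_integrable_def f_def)
  qed
  have FL: "(LINT x:cyl - rim|lborel. ln \<bar>x \<bullet> \<xi>\<bar>) = Fc - Fe"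
  proof -
    have "(LINT x:cyl - rim|lborel. ln \<bar>x \<bullet> \<xi>\<bar>) = (\<integral>x. indicator (cyl - rim) x * f x \<partial>lborel)"
      by (simp add: set_lebesgue_integral_def f_def)
    also have "\<dots> = Fc - Fe"
      unfolding L Fc_def Fe_def by (rule Bochner_Integration.integral_diff[OF kc(1) ke(1)])
    finally show ?thesis .
  qed
  have VL: "measure lborel (cyl - rim) = Vc - Ve"
    unfolding Vc_def Ve_def using fin[OF order_refl] sub by (intro measure_Diff) auto
  have FC: "(LINT x:cyl|lborel. ln \<bar>x \<bullet> \<xi>\<bar>) = Fc"
    by (simp add: set_lebesgue_integral_def f_def Fc_def)
  show "(LINT x:cyl - rim|lborel. ln \<bar>x \<bullet> \<xi>\<bar>) / measure lborel (cyl - rim) +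
        measure lborel rim / (DIM('a) * measure lborel (cyl - rim)) \<le>
      (LINT x:cyl|lborel. ln \<bar>x \<bullet> \<xi>\<bar>) / measure lborel cyl"
    unfolding FL FC VL Ve_def[symmetric] Vc_def[symmetric] n_def[symmetric] by (rule gap)
qed

end

lemma set_integral_scale:
  fixes f :: "'a::euclidean_space \<Rightarrow> real"
  assumes s: "s > 0" and [measurable]: "f \<in> borel_measurable borel" "S \<in> sets borel"
  shows "(LINT x:(\<lambda>x. s *\<^sub>R x) ` S|lborel. f x) = s ^ DIM('a) * (LINT x:S|lborel. f (s *\<^sub>R x))"
proof -
  have im: "(\<lambda>x. s *\<^sub>R x) ` S = (\<lambda>x. (1 / s) *\<^sub>R x) -` S \<inter> space borel"
  proof (intro equalityI subsetI)
    fix x assume "x \<in> (\<lambda>x. (1 / s) *\<^sub>R x) -` S \<inter> space borel"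
    then have "s *\<^sub>R ((1 / s) *\<^sub>R x) \<in> (\<lambda>x. s *\<^sub>R x) ` S" by blast
    then show "x \<in> (\<lambda>x. s *\<^sub>R x) ` S" using s by simp
  qed (use s in auto)
  have [measurable]: "(\<lambda>x. s *\<^sub>R x) ` S \<in> sets borel"
    unfolding im by measurable
  let ?F = "\<lambda>x. indicator ((\<lambda>x. s *\<^sub>R x) ` S) x *\<^sub>R f x"
  have lb: "lborel = density (distr lborel borel (\<lambda>x::'a. 0 + s *\<^sub>R x)) (\<lambda>_. ennreal (\<bar>s\<bar> ^ DIM('a)))"
    using s by (intro lborel_affine) auto
  have "(\<integral>x. ?F x \<partial>lborel) = (\<integral>x. ?F x \<partial>density (distr lborel borel (\<lambda>x. 0 + s *\<^sub>R x)) (\<lambda>_. ennreal (\<bar>s\<bar> ^ DIM('a))))"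
    by (rule arg_cong[OF lb])
  also have "\<dots> = (\<integral>x. \<bar>s\<bar> ^ DIM('a) *\<^sub>R ?F x \<partial>distr lborel borel (\<lambda>x. 0 + s *\<^sub>R x))"
    by (subst integral_density) auto
  also have "\<dots> = (\<integral>x. \<bar>s\<bar> ^ DIM('a) *\<^sub>R ?F (0 + s *\<^sub>R x) \<partial>lborel)"
    by (subst integral_distr) auto
  also have "\<dots> = s ^ DIM('a) * (\<integral>x. indicator S x *\<^sub>R f (s *\<^sub>R x) \<partial>lborel)"
  proof -
    have "s *\<^sub>R x \<in> (\<lambda>x. s *\<^sub>R x) ` S \<longleftrightarrow> x \<in> S" for x using s by (auto simp: image_iff)
    then have e: "?F (0 + s *\<^sub>R x) = indicator S x *\<^sub>R f (s *\<^sub>R x)" for x by (simp add: indicator_def)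
    show ?thesis using s by (simp only: e) simp
  qed
  finally show ?thesis by (simp add: set_lebesgue_integral_def)
qed

section \<open>The counterexample\<close>

lemma vol_eq_lborel: "S \<in> sets borel \<Longrightarrow> vol S = measure lborel S"
  by (simp add: vol_def)

lemma set_integral_lebesgue_eq:
  fixes f :: "real ^ 'n \<Rightarrow> real"
  assumes [measurable]: "S \<in> sets borel" "f \<in> borel_measurable borel"
  shows "(LINT x:S|lebesgue. f x) = (LINT x:S|lborel. f x)"
  unfolding set_lebesgue_integral_def by (rule integral_completion) measurable

theorem theorem3p8:
  assumes "CARD('n::finite) \<ge> 4"
  shows "\<exists>K L :: (real ^ 'n) set.
           convex_body K \<and> origin_symmetric K \<and>
           convex_body L \<and> origin_symmetric L \<and>
           polar_centroid0_body K \<subseteq> polar_centroid0_body L \<and>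
           vol K < vol L"
proof -
  define n where "n = real CARD('n)"
  have n: "n \<ge> 4" using assms by (simp add: n_def)
  obtain e0 :: "real ^ 'n" where e0: "e0 \<in> Basis" using nonempty_Basis by blast
  obtain e1 :: "real ^ 'n" where e1: "e1 \<in> Basis" "e1 \<noteq> e0"
  proof -
    have "\<not> (Basis :: (real ^ 'n) set) \<subseteq> {e0}"
      using assms card_mono[of "{e0}" "Basis :: (real ^ 'n) set"] by auto
    then show ?thesis using that by auto
  qed
  \<comment> \<open>The slack 1/(n - 1) - 1/n.\<close>
  define d where "d = 1 / ((n - 1) * n)"
  define \<eta> where "\<eta> = sqrt (1 / (1 + d))"
  have "d > 0" using n by (simp add: d_def)
  then have eta: "0 < \<eta>" "\<eta> < 1" "1 / \<eta>\<^sup>2 = 1 + 1 / ((n - 1) * n)"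
    unfolding \<eta>_def d_def[symmetric] by (simp_all add: real_sqrt_lt_1_iff divide_less_eq)
  \<comment> \<open>As |t| and r are at most 1, the last condition forces both above
    \<open>\<eta>\<close>. It cuts along a level of the convex function |t| + r, so what remains is
    convex; strictness keeps it closed.\<close>
  define R where "R = {p :: real \<times> real. \<bar>fst p\<bar> \<le> 1 \<and> snd p \<le> 1 \<and> 1 + \<eta> < \<bar>fst p\<bar> + snd p}"
  interpret cylinder_rim e0 R \<eta>
  proof
    have "R = {p \<in> space borel. \<bar>fst p\<bar> \<le> 1} \<inter> {p \<in> space borel. snd p \<le> 1} \<inter> {p \<in> space borel. 1 + \<eta> < \<bar>fst p\<bar> + snd p}"
      by (auto simp: R_def)
    also have "\<dots> \<in> sets borel" unfolding borel_prod[symmetric] by measurable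
    finally show "R \<in> sets borel" .
  qed (use assms e0 eta in \<open>auto simp: R_def n_def\<close>)
  have rim_iff: "x \<in> rim \<longleftrightarrow> \<bar>x \<bullet> e0\<bar> \<le> 1 \<and> axial e0 x \<le> 1 \<and> 1 + \<eta> < \<bar>x \<bullet> e0\<bar> + axial e0 x" for x
    unfolding mem_rim by (auto simp: R_def)
  then have sub: "rim \<subseteq> cyl" by (auto simp: mem_cyl)
  define L0 where "L0 = cyl - rim"
  have mem_L0: "x \<in> L0 \<longleftrightarrow> \<bar>x \<bullet> e0\<bar> \<le> 1 \<and> axial e0 x \<le> 1 \<and> \<bar>x \<bullet> e0\<bar> + axial e0 x \<le> 1 + \<eta>" for x
    by (auto simp: L0_def mem_cyl rim_iff)
  have cont: "continuous_on UNIV (axial e0)" "continuous_on UNIV (\<lambda>x. \<bar>x \<bullet> e0\<bar>)"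
    unfolding axial_def by (intro continuous_intros)+
  have cl: "closed cyl" "closed L0"
  proof -
    have "cyl = {x. \<bar>x \<bullet> e0\<bar> \<le> 1} \<inter> {x. axial e0 x \<le> 1}" by (auto simp: mem_cyl)
    also have "closed \<dots>" by (intro closed_Int closed_Collect_le cont continuous_intros)
    finally show "closed cyl" .
    have "L0 = {x. \<bar>x \<bullet> e0\<bar> \<le> 1} \<inter> {x. axial e0 x \<le> 1} \<inter> {x. \<bar>x \<bullet> e0\<bar> + axial e0 x \<le> 1 + \<eta>}"
      by (auto simp: mem_L0)
    also have "closed \<dots>" by (intro closed_Int closed_Collect_le cont continuous_intros)
    finally show "closed L0" .
  qed
  have ax_comb: "axial e0 (u *\<^sub>R x + v *\<^sub>R y) \<le> u * axial e0 x + v * axial e0 y"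
    "\<bar>(u *\<^sub>R x + v *\<^sub>R y) \<bullet> e0\<bar> \<le> u * \<bar>x \<bullet> e0\<bar> + v * \<bar>y \<bullet> e0\<bar>" if "0 \<le> u" "0 \<le> v" for u v x y
  proof -
    let ?p = "\<lambda>x. x - (x \<bullet> e0) *\<^sub>R e0"
    have "?p (u *\<^sub>R x + v *\<^sub>R y) = u *\<^sub>R ?p x + v *\<^sub>R ?p y"
      by (simp add: inner_add_left algebra_simps)
    then have "axial e0 (u *\<^sub>R x + v *\<^sub>R y) = norm (u *\<^sub>R ?p x + v *\<^sub>R ?p y)"
      by (simp only: axial_def)
    also have "\<dots> \<le> u * axial e0 x + v * axial e0 y"
      using norm_triangle_ineq[of "u *\<^sub>R ?p x" "v *\<^sub>R ?p y"] that by (simp add: axial_def)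
    finally show "axial e0 (u *\<^sub>R x + v *\<^sub>R y) \<le> u * axial e0 x + v * axial e0 y" .
    show "\<bar>(u *\<^sub>R x + v *\<^sub>R y) \<bullet> e0\<bar> \<le> u * \<bar>x \<bullet> e0\<bar> + v * \<bar>y \<bullet> e0\<bar>"
      using abs_triangle_ineq[of "u * (x \<bullet> e0)" "v * (y \<bullet> e0)"] that
      by (simp add: inner_add_left abs_mult)
  qed
  have conv: "convex cyl" "convex L0"
  proof -
    have bd: "u * s + v * t \<le> c" if "0 \<le> u" "0 \<le> v" "u + v = 1" "s \<le> c" "t \<le> c" for u v s t c :: real
      using convex_bound_le[of s c t u v] that by simp
    show "convex cyl"
    proof (rule convexI)
      fix x y and u v :: real
      assume "x \<in> cyl" "y \<in> cyl" and uv: "0 \<le> u" "0 \<le> v" "u + v = 1"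
      then have "u * \<bar>x \<bullet> e0\<bar> + v * \<bar>y \<bullet> e0\<bar> \<le> 1" "u * axial e0 x + v * axial e0 y \<le> 1"
        by (auto simp: mem_cyl intro!: bd)
      then show "u *\<^sub>R x + v *\<^sub>R y \<in> cyl"
        using ax_comb[OF uv(1,2), of x y] by (auto simp only: mem_cyl)
    qed
    show "convex L0"
    proof (rule convexI)
      fix x y and u v :: real
      assume xy: "x \<in> L0" "y \<in> L0" and uv: "0 \<le> u" "0 \<le> v" "u + v = 1"
      then have "u * \<bar>x \<bullet> e0\<bar> + v * \<bar>y \<bullet> e0\<bar> \<le> 1" "u * axial e0 x + v * axial e0 y \<le> 1"
        by (auto simp: mem_L0 intro!: bd)
      moreover have "u * (\<bar>x \<bullet> e0\<bar> + axial e0 x) + v * (\<bar>y \<bullet> e0\<bar> + axial e0 y) \<le> 1 + \<eta>"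
        using xy by (intro bd uv) (auto simp: mem_L0)
      then have "(u * \<bar>x \<bullet> e0\<bar> + v * \<bar>y \<bullet> e0\<bar>) + (u * axial e0 x + v * axial e0 y) \<le> 1 + \<eta>"
        by (simp add: algebra_simps)
      ultimately show "u *\<^sub>R x + v *\<^sub>R y \<in> L0"
        using ax_comb[OF uv(1,2), of x y] unfolding mem_L0 by linarith
    qed
  qed
  define U where "U = {x. \<bar>x \<bullet> e0\<bar> < 1 / 2} \<inter> {x. axial e0 x < 1 / 2}"
  have U: "open U" "U \<subseteq> L0" "0 \<in> U"
  proof -
    show "open U" unfolding U_def by (intro open_Int open_Collect_less cont continuous_intros)
    show "U \<subseteq> L0" using eta by (auto simp: U_def mem_L0)
    show "0 \<in> U" by (simp add: U_def axial_def)
  qed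
  have int_cyl: "interior cyl \<noteq> {}"
    using U interior_maximal[of U cyl] by (auto simp: L0_def)
  have bL0: "bounded L0" using bounded_cyl by (rule bounded_subset) (auto simp: L0_def)
  have mL0 [measurable]: "L0 \<in> sets borel" using cl by simp
  have open_pos: "measure lborel S > 0" if S: "open O'" "O' \<noteq> {}" "O' \<subseteq> S" "bounded S" "S \<in> sets borel" for O' S :: "(real ^ 'n) set"
  proof -
    have "emeasure lborel O' \<noteq> 0"
      using open_not_negligible[OF S(1,2)] S(1) by (simp add: negligible_iff_null_sets null_sets_completion_iff null_sets_def)
    then have "emeasure lborel S \<noteq> 0"
      using emeasure_mono[OF S(3), of lborel] S(5) by auto
    moreover have "emeasure lborel S < \<infinity>" using emeasure_bounded_finite[OF S(4)] by simp
    ultimately show ?thesis by (simp add: measure_def enn2real_positive_iff zero_less_iff_neq_zero)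
  qed
  define Vc where "Vc = measure lborel cyl"
  define Ve where "Ve = measure lborel rim"
  define Vl where "Vl = measure lborel L0"
  have Vl: "Vl > 0" unfolding Vl_def using U by (intro open_pos[of U] bL0 mL0) auto
  have "Vl = Vc - Ve"
    unfolding Vl_def Vc_def Ve_def L0_def
    using emeasure_bounded_finite[OF bounded_cyl] sub by (intro measure_Diff) auto
  then have Vce: "Vc = Vl + Ve" by simp
  have Ve: "Ve > 0"
    unfolding Ve_def
  proof (rule open_pos)
    let ?O = "{x. \<bar>x \<bullet> e0\<bar> < 1} \<inter> {x. axial e0 x < 1} \<inter> {x. 1 + \<eta> < \<bar>x \<bullet> e0\<bar> + axial e0 x}"
    show "open ?O" by (intro open_Int open_Collect_less cont continuous_intros)
    \<comment> \<open>The midpoint of (1 + \<open>\<eta>\<close>)/2 and 1: below 1 in both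
      coordinates, yet with sum above 1 + \<open>\<eta>\<close>.\<close>
    define c where "c = (3 + \<eta>) / 4"
    have c: "0 < c" "c < 1" "1 + \<eta> < 2 * c" using eta by (auto simp: c_def)
    have "(c *\<^sub>R e0 + c *\<^sub>R e1) \<bullet> e0 = c"
      using e0 e1 by (simp add: inner_add_left inner_Basis)
    moreover from this have "axial e0 (c *\<^sub>R e0 + c *\<^sub>R e1) = c"
      using e1 c by (simp add: axial_def)
    ultimately have "c *\<^sub>R e0 + c *\<^sub>R e1 \<in> ?O" using c by simp
    then show "?O \<noteq> {}" by blast
    show "?O \<subseteq> rim" by (auto simp: rim_iff)
    show "bounded rim" using bounded_cyl sub by (rule bounded_subset)
  qed simp
  define s where "s = exp (Ve / (n * Vl))"
  have s: "s > 0" "ln s = Ve / (n * Vl)" "s ^ CARD('n) = exp (Ve / Vl)"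
    using n by (simp_all add: s_def exp_of_nat_mult[symmetric] n_def)
  define L where "L = (\<lambda>x. s *\<^sub>R x) ` L0"
  have cbL0: "compact L0" using cl bL0 by (simp add: compact_eq_bounded_closed)
  have cL: "compact L" unfolding L_def by (rule compact_scaling[OF cbL0])
  then have mL [measurable]: "L \<in> sets borel" by (intro borel_compact)
  have volL: "vol L = s ^ CARD('n) * Vl"
    unfolding vol_eq_lborel[OF mL]
    using set_integral_scale[OF s(1), of "\<lambda>x::real ^ 'n. 1" L0] cL
    by (simp add: set_lebesgue_integral_def L_def Vl_def)
  have norms: "polar_centroid0_norm L \<xi> \<le> polar_centroid0_norm cyl \<xi>" for \<xi>
  proof (cases "\<xi> = 0")
    case False
    let ?A = "LINT x:L0|lborel. ln \<bar>x \<bullet> \<xi>\<bar>"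
    have V: "measure lborel rim < measure lborel cyl" using Vce Vl by (simp add: Vc_def Ve_def)
    have int: "set_integrable lborel L0 (\<lambda>x. ln \<bar>x \<bullet> \<xi>\<bar>)"
      using log_average_gap(1)[OF False sub V] by (simp add: L0_def)
    have gap: "?A / Vl + Ve / (n * Vl) \<le> (LINT x:cyl|lborel. ln \<bar>x \<bullet> \<xi>\<bar>) / Vc"
      using log_average_gap(2)[OF False sub V] by (simp add: L0_def Vl_def Ve_def Vc_def n_def)
    have "(LINT x:L|lebesgue. ln \<bar>x \<bullet> \<xi>\<bar>) = (LINT x:L|lborel. ln \<bar>x \<bullet> \<xi>\<bar>)"
      by (rule set_integral_lebesgue_eq) measurable
    also have "\<dots> = s ^ CARD('n) * (LINT x:L0|lborel. ln \<bar>(s *\<^sub>R x) \<bullet> \<xi>\<bar>)"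
      unfolding L_def using set_integral_scale[OF s(1), of "\<lambda>x. ln \<bar>x \<bullet> \<xi>\<bar>" L0] by simp
    \<comment> \<open>Only almost everywhere: on the hyperplane orthogonal to \<open>\<xi>\<close>
      the convention \<open>ln 0 = 0\<close> spoils the product rule.\<close>
    also have "(LINT x:L0|lborel. ln \<bar>(s *\<^sub>R x) \<bullet> \<xi>\<bar>) = (LINT x:L0|lborel. ln s + ln \<bar>x \<bullet> \<xi>\<bar>)"
    proof (rule set_lebesgue_integral_cong_AE)
      have "negligible {x. \<xi> \<bullet> x = 0}" using False by (intro negligible_hyperplane) auto
      then have "{x. \<xi> \<bullet> x = 0} \<in> null_sets lborel"
        by (simp add: negligible_iff_null_sets null_sets_completion_iff closed_hyperplane)
      then have "AE x in lborel. x \<bullet> \<xi> \<noteq> 0"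
        by (rule AE_not_in[THEN eventually_mono]) (simp add: inner_commute)
      then show "AE x\<in>L0 in lborel. ln \<bar>(s *\<^sub>R x) \<bullet> \<xi>\<bar> = ln s + ln \<bar>x \<bullet> \<xi>\<bar>"
        by eventually_elim (use s(1) in \<open>simp add: abs_mult ln_mult\<close>)
    qed measurable
    also have "\<dots> = ln s * Vl + ?A"
    proof -
      have "set_integrable lborel L0 (\<lambda>x. ln s)"
        unfolding set_integrable_def
        using emeasure_bounded_finite[OF bL0] by (intro integrable_scaleR_left integrable_real_indicator) auto
      then have "(LINT x:L0|lborel. ln s + ln \<bar>x \<bullet> \<xi>\<bar>) = (LINT x:L0|lborel. ln s) + ?A"
        using int by (rule set_integral_add(2))
      then show ?thesis by (simp add: set_lebesgue_integral_def Vl_def mult.commute)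
    qed
    \<comment> \<open>The powers of \<open>s\<close> cancel in the average, and the dilation
      contributes exactly the \<open>ln s\<close> that the gap allows.\<close>
    finally have "1 / vol L * (LINT x:L|lebesgue. ln \<bar>x \<bullet> \<xi>\<bar>) = ?A / Vl + Ve / (n * Vl)"
      using s Vl by (simp add: volL field_simps)
    also have "\<dots> \<le> 1 / vol cyl * (LINT x:cyl|lebesgue. ln \<bar>x \<bullet> \<xi>\<bar>)"
      using gap by (simp add: vol_eq_lborel Vc_def set_integral_lebesgue_eq)
    finally show ?thesis using False by (simp add: polar_centroid0_norm_def)
  qed (simp add: polar_centroid0_norm_def)
  have "convex_body cyl"
    using cl bounded_cyl conv int_cyl by (simp add: convex_body_def compact_eq_bounded_closed)
  moreover have "convex_body L"
  proof -
    have "open ((\<lambda>x. s *\<^sub>R x) ` U)" using U s(1) by (intro open_scaling) auto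
    moreover have "(\<lambda>x. s *\<^sub>R x) ` U \<subseteq> L" using U by (auto simp: L_def)
    ultimately have "(\<lambda>x. s *\<^sub>R x) ` U \<subseteq> interior L" by (rule interior_maximal[rotated])
    then have "interior L \<noteq> {}" using U by blast
    moreover have "convex L" unfolding L_def by (rule convex_scaling[OF conv(2)])
    ultimately show ?thesis using cL by (simp add: convex_body_def)
  qed
  moreover have "origin_symmetric cyl" "origin_symmetric L0"
    by (auto simp: origin_symmetric_def mem_cyl mem_L0 axial_def norm_minus_commute)
  moreover from this(2) have "origin_symmetric L"
    by (auto simp: origin_symmetric_def L_def scaleR_minus_right[symmetric] simp del: scaleR_minus_right)
  moreover have "polar_centroid0_body cyl \<subseteq> polar_centroid0_body L"
    using norms by (auto simp: polar_centroid0_body_def intro: order_trans)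
  moreover have "vol cyl < vol L"
  proof -
    have "0 < Ve / Vl" using Ve Vl by simp
    \<comment> \<open>The quadratic Taylor term makes the inequality strict.\<close>
    then have "1 + Ve / Vl < exp (Ve / Vl)"
      using exp_lower_Taylor_quadratic[of "Ve / Vl"] by (smt (verit) zero_less_power divide_pos_pos)
    then have "(1 + Ve / Vl) * Vl < exp (Ve / Vl) * Vl"
      using Vl by (rule mult_strict_right_mono)
    moreover have "(1 + Ve / Vl) * Vl = Vc" using Vl by (simp add: distrib_right Vce)
    moreover have "vol cyl = Vc" by (simp add: vol_eq_lborel Vc_def)
    ultimately show ?thesis by (simp only: volL s(3))
  qed
  ultimately show ?thesis by blast
qed

end
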